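(* Let $s<0$. The two-dimensional Dysthe equation $$\partial_t u+L(u)=N(u),\qquad u|_{t=0}=u_0,\qquad (x,y)\in\mathbb{R}^2,$$ where $$L(u) = -\tfrac{1}{16} \partial_x^3 u + \tfrac{i}{8} \partial_x^2 u + \tfrac{1}{2}\partial_x u - \tfrac{i}{4}\partial_y^2 u + \tfrac{3}{8}\partial_x\partial_y^2 u,$$ $$N(u)= -\tfrac{i}{2} |u|^2 u - \tfrac{3}{2} |u|^2 \partial_x u - \tfrac{1}{4} u^2 \partial_x \overline{u} + \tfrac{i}{2} u\, \partial_x^2 |\nabla|^{-1} (|u|^2),$$ is ill-posed in $H^s(\mathbb{R}^2)$, in the sense that, for every $T>0$ (no matter how small), the initial data-to-solution map $u_0\mapsto u$ from $H^s(\mathbb{R}^2)$ to $C([0,T],H^s(\mathbb{R}^2))$ is not $C^3$.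
   Context: Here $u=u(t,x,y)$ is complex-valued, $|\nabla|^{-1}$ is the Fourier multiplier on $\mathbb{R}^2$ with symbol $(\xi^2+\mu^2)^{-1/2}$ ($\xi,\mu$ being the frequencies dual to $x,y$), and $H^s(\mathbb{R}^2)$ is the usual $L^2$-based Sobolev space. Meaning of "not $C^3$": let $u_1(t)=e^{-tL}u_0$ and let $u_3$ be the cubic term of the Picard iteration, $$u_3(t)=\int_0^t e^{-(t-t')L}N(u_1(t'))\,dt',$$ i.e. the solution of $\partial_t u_3+L(u_3)=N(u_1)$, $u_3|_{t=0}=0$. For data $\epsilon u_0$ the solution has the formal expansion $\epsilon u_1+\epsilon^3u_3+\dots$. The failure of the data-to-solution map to be $C^3$ (as a map from $H^s(\mathbb{R}^2)$ to $C([0,T],H^s(\mathbb{R}^2))$) is understood, equivalently, as the failure of the cubic map $u_0\mapsto u_3$ to be continuous from $H^s(\mathbb{R}^2)$ to $C([0,T],H^s(\mathbb{R}^2))$, i.e. no constant $C$ gives $\sup_{t\in[0,T]}\|u_3(t)\|_{H^s}\le C\|u_0\|_{H^s}^3$ for all (say, Schwartz) $u_0$. *)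

theory Defs
  imports "HOL-Analysis.Analysis"
begin

section \<open>Functions on the plane\<close>

text \<open>Points of the plane are pairs, \<open>z = (x, y)\<close> in physical space and \<open>\<zeta> = (\<xi>, \<mu>)\<close> in
  frequency space.\<close>

type_synonym plane_fun = "real \<times> real \<Rightarrow> complex"

definition dx :: "plane_fun \<Rightarrow> plane_fun" where
  "dx f = (\<lambda>(x, y). vector_derivative (\<lambda>x'. f (x', y)) (at x))"

definition dy :: "plane_fun \<Rightarrow> plane_fun" where
  "dy f = (\<lambda>(x, y). vector_derivative (\<lambda>y'. f (x, y')) (at y))"

text \<open>The first conjunct is smoothness: if all the iterated derivatives below are (totally)
  differentiable, then mixed partials commute and \<open>f\<close> has continuous partials of every order.\<close>

definition schwartz :: "plane_fun \<Rightarrow> bool" where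
  "schwartz f \<longleftrightarrow>
     (\<forall>a b. (dx ^^ a) ((dy ^^ b) f) differentiable_on UNIV) \<and>
     (\<forall>a b k. \<exists>B. \<forall>z. (1 + norm z) ^ k * cmod ((dx ^^ a) ((dy ^^ b) f) z) \<le> B)"

definition fourier :: "plane_fun \<Rightarrow> plane_fun" where
  "fourier f \<zeta> = (LINT z|lborel. f z * cis (- (z \<bullet> \<zeta>)))"

definition inv_fourier :: "plane_fun \<Rightarrow> plane_fun" where
  "inv_fourier g z = complex_of_real (1 / (2 * pi)\<^sup>2) * (LINT \<zeta>|lborel. g \<zeta> * cis (z \<bullet> \<zeta>))"

definition multiplier :: "plane_fun \<Rightarrow> plane_fun \<Rightarrow> plane_fun" where
  "multiplier m f = inv_fourier (\<lambda>\<zeta>. m \<zeta> * fourier f \<zeta>)"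

text \<open>The square of the Sobolev norm, and the norm itself; both are infinite when the defining
  integral diverges.\<close>

definition sobolev_sqnorm :: "real \<Rightarrow> plane_fun \<Rightarrow> ennreal" where
  "sobolev_sqnorm s f =
     (\<integral>\<^sup>+ \<zeta>. ennreal ((1 + (norm \<zeta>)\<^sup>2) powr s * (cmod (fourier f \<zeta>))\<^sup>2) \<partial>lborel)"

definition sobolev_norm :: "real \<Rightarrow> plane_fun \<Rightarrow> ennreal" where
  "sobolev_norm s f =
     (if sobolev_sqnorm s f = \<infinity> then \<infinity> else ennreal (sqrt (enn2real (sobolev_sqnorm s f))))"

section \<open>The Dysthe equation\<close>

definition dysthe_L :: "plane_fun \<Rightarrow> plane_fun" where
  "dysthe_L u z =
     - (1/16) * (dx ^^ 3) u z + (\<i>/8) * (dx ^^ 2) u z + (1/2) * dx u z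
     - (\<i>/4) * (dy ^^ 2) u z + (3/8) * dx ((dy ^^ 2) u) z"

text \<open>The symbol of \<open>|\<nabla>|\<^sup>-\<^sup>1\<close>; its value 0 at the origin is irrelevant.\<close>

definition inv_abs_grad :: "plane_fun \<Rightarrow> plane_fun" where
  "inv_abs_grad = multiplier (\<lambda>(\<xi>, \<mu>). complex_of_real ((\<xi>\<^sup>2 + \<mu>\<^sup>2) powr (- 1/2)))"

definition dysthe_N :: "plane_fun \<Rightarrow> plane_fun" where
  "dysthe_N u z =
     - (\<i>/2) * complex_of_real ((cmod (u z))\<^sup>2) * u z
     - (3/2) * complex_of_real ((cmod (u z))\<^sup>2) * dx u z
     - (1/4) * (u z)\<^sup>2 * dx (\<lambda>w. cnj (u w)) z
     + (\<i>/2) * u z * (dx ^^ 2) (inv_abs_grad (\<lambda>w. complex_of_real ((cmod (u w))\<^sup>2))) z"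

text \<open>The symbol of the constant-coefficient operator \<open>L\<close>, read off from its action on the
  plane wave of frequency \<open>\<zeta>\<close> (an eigenfunction of \<open>L\<close>, see \<open>dysthe_L_plane_wave\<close>).\<close>

definition plane_wave :: "real \<times> real \<Rightarrow> plane_fun" where
  "plane_wave \<zeta> z = cis (z \<bullet> \<zeta>)"

definition dysthe_symbol :: plane_fun where
  "dysthe_symbol \<zeta> = dysthe_L (plane_wave \<zeta>) (0, 0)"

text \<open>\<open>dysthe_flow t\<close> is \<open>e\<^sup>-\<^sup>t\<^sup>L\<close>.\<close>

definition dysthe_flow :: "real \<Rightarrow> plane_fun \<Rightarrow> plane_fun" where
  "dysthe_flow t = multiplier (\<lambda>\<zeta>. exp (- complex_of_real t * dysthe_symbol \<zeta>))"

text \<open>The linear and the cubic term \<open>u\<^sub>1(t)\<close>, \<open>u\<^sub>3(t)\<close> of the Picard iteration with data \<open>u\<^sub>0\<close>.\<close>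

definition picard1 :: "plane_fun \<Rightarrow> real \<Rightarrow> plane_fun" where
  "picard1 u0 t = dysthe_flow t u0"

definition picard3 :: "plane_fun \<Rightarrow> real \<Rightarrow> plane_fun" where
  "picard3 u0 t z = (LINT t':{0..t}|lborel. dysthe_flow (t - t') (dysthe_N (picard1 u0 t')) z)"

section \<open>The symbol in closed form\<close>

lemma dx_scaled_plane_wave:
  "dx (\<lambda>z. c * plane_wave (\<xi>, \<mu>) z) = (\<lambda>z. (c * (\<i> * complex_of_real \<xi>)) * plane_wave (\<xi>, \<mu>) z)"
proof (rule ext, clarify)
  fix x y :: real
  have "((\<lambda>x'. c * exp (\<i> * complex_of_real (x' * \<xi> + y * \<mu>))) has_vector_derivative
          c * (\<i> * complex_of_real \<xi>) * exp (\<i> * complex_of_real (x * \<xi> + y * \<mu>))) (at x)"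
    by (rule has_vector_derivative_real_field
          [where f = "\<lambda>w. c * exp (\<i> * (w * complex_of_real \<xi> + complex_of_real (y * \<mu>)))",
            simplified of_real_mult[symmetric] of_real_add[symmetric]])
       (auto intro!: derivative_eq_intros)
  then show "dx (\<lambda>z. c * plane_wave (\<xi>, \<mu>) z) (x, y)
      = (c * (\<i> * complex_of_real \<xi>)) * plane_wave (\<xi>, \<mu>) (x, y)"
    by (simp add: dx_def plane_wave_def cis_conv_exp vector_derivative_at)
qed

lemma dy_scaled_plane_wave:
  "dy (\<lambda>z. c * plane_wave (\<xi>, \<mu>) z) = (\<lambda>z. (c * (\<i> * complex_of_real \<mu>)) * plane_wave (\<xi>, \<mu>) z)"
proof (rule ext, clarify)
  fix x y :: real
  have "((\<lambda>y'. c * exp (\<i> * complex_of_real (x * \<xi> + y' * \<mu>))) has_vector_derivative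
          c * (\<i> * complex_of_real \<mu>) * exp (\<i> * complex_of_real (x * \<xi> + y * \<mu>))) (at y)"
    by (rule has_vector_derivative_real_field
          [where f = "\<lambda>w. c * exp (\<i> * (complex_of_real (x * \<xi>) + w * complex_of_real \<mu>))",
            simplified of_real_mult[symmetric] of_real_add[symmetric]])
       (auto intro!: derivative_eq_intros)
  then show "dy (\<lambda>z. c * plane_wave (\<xi>, \<mu>) z) (x, y)
      = (c * (\<i> * complex_of_real \<mu>)) * plane_wave (\<xi>, \<mu>) (x, y)"
    by (simp add: dy_def plane_wave_def cis_conv_exp vector_derivative_at)
qed

lemma dysthe_L_plane_wave_closed:
  "dysthe_L (plane_wave (\<xi>, \<mu>)) z =
     \<i> * complex_of_real (\<xi>^3/16 - \<xi>\<^sup>2/8 + \<xi>/2 + \<mu>\<^sup>2/4 - 3/8 * \<xi> * \<mu>\<^sup>2) * plane_wave (\<xi>, \<mu>) z"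
proof -
  have x: "dx (plane_wave (\<xi>, \<mu>)) = (\<lambda>z. (\<i> * complex_of_real \<xi>) * plane_wave (\<xi>, \<mu>) z)"
    using dx_scaled_plane_wave[of 1 \<xi> \<mu>] by simp
  have y: "dy (plane_wave (\<xi>, \<mu>)) = (\<lambda>z. (\<i> * complex_of_real \<mu>) * plane_wave (\<xi>, \<mu>) z)"
    using dy_scaled_plane_wave[of 1 \<xi> \<mu>] by simp
  show ?thesis
    unfolding dysthe_L_def numeral_2_eq_2 numeral_3_eq_3
    by (simp only: funpow.simps o_apply id_apply x y dx_scaled_plane_wave dy_scaled_plane_wave)
       (simp add: algebra_simps)
qed

lemma dysthe_symbol_closed:
  "dysthe_symbol (\<xi>, \<mu>) =
     \<i> * complex_of_real (\<xi>^3/16 - \<xi>\<^sup>2/8 + \<xi>/2 + \<mu>\<^sup>2/4 - 3/8 * \<xi> * \<mu>\<^sup>2)"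
  unfolding dysthe_symbol_def dysthe_L_plane_wave_closed by (simp add: plane_wave_def)

lemma dysthe_L_plane_wave: "dysthe_L (plane_wave \<zeta>) z = dysthe_symbol \<zeta> * plane_wave \<zeta> z"
  by (cases \<zeta>) (simp only: dysthe_L_plane_wave_closed dysthe_symbol_closed)

end

theory Submission
  imports Defs "HOL-Probability.Characteristic_Functions" "HOL-Probability.Sinc_Integral"
begin

text \<open>The obstruction is a high-frequency wave packet. Let the data be a Gaussian modulated to the
frequency \<open>(N, 0)\<close>, so that its Fourier transform is a Gaussian bump of unit width at \<open>(N, 0)\<close>
and its \<open>H\<^sup>s\<close> norm is of size \<open>N\<^sup>s\<close>. In the cubic term three frequencies near \<open>(N, 0)\<close> combine,
as \<open>\<zeta>\<^sub>1 - \<zeta>\<^sub>2 + \<zeta>\<^sub>3\<close>, to another frequency near \<open>(N, 0)\<close>. The terms of the nonlinearity with an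
\<open>x\<close>-derivative contribute the factor \<open>- (3/2) \<i> N + (1/4) \<i> N = - (5/4) \<i> N\<close>; everything else is of
size \<open>1\<close>, the nonlocal term included, because its symbol \<open>\<xi>\<^sup>2 / |\<zeta>|\<close> is evaluated at the
difference of two nearby frequencies. The only enemy is the oscillation \<open>exp (\<i> t' \<Psi>)\<close> under the
time integral. The resonance function \<open>\<Psi>\<close> is a second difference of the cubic dispersion
relation, hence only of size \<open>N\<close>, and there is no oscillation up to times \<open>t \<lless> 1 / N\<close>. At
\<open>t = N\<^sup>s\<^sup>-\<^sup>1\<close>, which is such a time as \<open>s < 0\<close>, all contributions add up, and the Fourier
transform of \<open>u\<^sub>3(t)\<close> is at least \<open>c t N = c N\<^sup>s\<close> on a unit ball around \<open>(N, 0)\<close>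
(\<open>fourier_picard3_lower_bound\<close>). Therefore the \<open>H\<^sup>s\<close> norm of \<open>u\<^sub>3(t)\<close> is at least \<open>c N\<^sup>2\<^sup>s\<close>
(\<open>sobolev_norm_ge_of_carrier_bound\<close>), against \<open>N\<^sup>3\<^sup>s\<close> for the cube of the norm of the data
(\<open>sobolev_norm_datum_le\<close>), and \<open>N\<^sup>2\<^sup>s / N\<^sup>3\<^sup>s\<close> is unbounded.

Most of the work goes into the formula for the Fourier transform of \<open>u\<^sub>3(t)\<close>
(\<open>fourier_picard3_datum\<close>). It is a Lebesgue integral, so \<open>u\<^sub>3(t)\<close> must be shown to be
integrable over the plane although the symbol of \<open>|\<nabla>|\<^sup>-\<^sup>1\<close> is singular at the origin. Every term
of the nonlinearity has an undifferentiated factor \<open>u\<^sub>1\<close>; thus \<open>N(u\<^sub>1) = u\<^sub>1 W\<close>, where \<open>W\<close> is the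
inverse Fourier transform of an integrable function, the \<open>potential\<close>, which absorbs the
singularity (\<open>dysthe_N_picard1_datum\<close>). Consequently \<open>exp (- (t - t') L) N(u\<^sub>1(t'))\<close> is a
superposition over \<open>\<omega>\<close>, with the weights \<open>potential \<omega>\<close>, of inverse Fourier transforms of functions
\<open>\<eta> \<mapsto> exp (Q(\<eta>))\<close> with \<open>Q\<close> a polynomial. Integration by parts bounds those by
\<open>1 / ((1 + x\<^sup>2) (1 + y\<^sup>2))\<close> times a power of \<open>1 + |\<omega>|\<close> (\<open>member_inv_fourier_decay\<close>), which the Gaussian
decay of the potential makes summable. Fubini's theorem and the inversion formula
(\<open>fourier_inv_fourier\<close>) finish the computation.\<close>

section \<open>Gaussian integrals and the inversion formula\<close>

lemma borel_measurable_cis[measurable]: "cis \<in> borel_measurable borel"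
  by (intro borel_measurable_continuous_onI continuous_intros)

text \<open>Nearly all applications of Fubini's theorem below are to functions dominated by a product, and
this is the form in which it is used.\<close>
lemma integrable_pair_bound:
  fixes F :: "'a::euclidean_space \<Rightarrow> 'b::euclidean_space \<Rightarrow> 'c::{banach, second_countable_topology}"
    and A :: "'a \<Rightarrow> real" and B :: "'b \<Rightarrow> real"
  assumes F[measurable]: "case_prod F \<in> borel_measurable (lborel \<Otimes>\<^sub>M lborel)"
    and A: "integrable lborel A" and B: "integrable lborel B"
    and le: "\<And>x y. norm (F x y) \<le> A x * B y"
  shows "integrable (lborel \<Otimes>\<^sub>M lborel) (case_prod F)"
proof (rule Bochner_Integration.integrable_bound)
  have [measurable]: "A \<in> borel_measurable borel" "B \<in> borel_measurable borel"
    using A B by (auto dest: borel_measurable_integrable)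
  show "integrable (lborel \<Otimes>\<^sub>M lborel) (\<lambda>(x, y). A x * B y)"
  proof (rule lborel_pair.Fubini_integrable)
    show "integrable lborel (\<lambda>x. LINT y|lborel. norm (case (x, y) of (x, y) \<Rightarrow> A x * B y))"
      using integrable_norm[OF A] by (simp add: abs_mult)
  qed (use B in simp_all)
  show "AE x in lborel \<Otimes>\<^sub>M lborel. norm (case_prod F x) \<le> norm (case x of (x, y) \<Rightarrow> A x * B y)"
    using le by (intro AE_I2) (auto intro: order_trans[OF _ abs_ge_self])
qed simp

lemma integral_swap_bound:
  fixes F :: "'a::euclidean_space \<Rightarrow> 'b::euclidean_space \<Rightarrow> 'c::{banach, second_countable_topology}"
    and A :: "'a \<Rightarrow> real" and B :: "'b \<Rightarrow> real"
  assumes F: "case_prod F \<in> borel_measurable (lborel \<Otimes>\<^sub>M lborel)"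
    and A: "integrable lborel A" and B: "integrable lborel B"
    and le: "\<And>x y. norm (F x y) \<le> A x * B y"
  shows "(LINT x|lborel. LINT y|lborel. F x y) = (LINT y|lborel. LINT x|lborel. F x y)"
  using lborel_pair.Fubini_integral[OF integrable_pair_bound[OF assms]] by simp

lemma plane_integral_tensor:
  fixes a b :: "real \<Rightarrow> complex"
  assumes a: "integrable lborel a" and b: "integrable lborel b"
  shows "integrable lborel (\<lambda>z :: real \<times> real. a (fst z) * b (snd z))"
    and "(LINT z|lborel. a (fst z) * b (snd z)) = (LINT x|lborel. a x) * (LINT y|lborel. b y)"
proof -
  have [measurable]: "a \<in> borel_measurable borel" "b \<in> borel_measurable borel"
    using a b by (auto dest: borel_measurable_integrable)
  have i: "integrable (lborel \<Otimes>\<^sub>M lborel) (\<lambda>(x, y). a x * b y)"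
    by (rule integrable_pair_bound[OF _ integrable_norm[OF a] integrable_norm[OF b]])
       (simp_all add: norm_mult)
  then show "integrable lborel (\<lambda>z :: real \<times> real. a (fst z) * b (snd z))"
    by (simp add: lborel_prod split_beta')
  show "(LINT z|lborel. a (fst z) * b (snd z)) = (LINT x|lborel. a x) * (LINT y|lborel. b y)"
    using lborel_pair.integral_fst[OF i] by (simp add: lborel_prod split_beta')
qed

lemma norm_plane_sq: "(norm (z :: real \<times> real))\<^sup>2 = (fst z)\<^sup>2 + (snd z)\<^sup>2"
  by (simp add: norm_Pair[of "fst z" "snd z", simplified])

lemma gaussian_fourier_line:
  "integrable lborel (\<lambda>x. complex_of_real (exp (- x\<^sup>2 / 2)))"
  "(LINT x|lborel. complex_of_real (exp (- x\<^sup>2 / 2)) * cis (- (x * \<xi>))) = complex_of_real (sqrt (2 * pi) * exp (- \<xi>\<^sup>2 / 2))"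
proof -
  have e: "exp (- x\<^sup>2 / 2) = sqrt (2 * pi) * std_normal_density x" for x
    by (simp add: std_normal_density_def)
  show "integrable lborel (\<lambda>x. complex_of_real (exp (- x\<^sup>2 / 2)))"
    unfolding e using integrable_mult_right[of "sqrt (2*pi)" lborel std_normal_density]
    by (simp del: real_sqrt_mult add: complex_of_real_integrable_eq)
  have "complex_of_real (exp (- (- \<xi>)\<^sup>2 / 2)) = char std_normal_distribution (- \<xi>)"
    by (subst char_std_normal_distribution) simp
  also have "\<dots> = (LINT x|lborel. complex_of_real (std_normal_density x) * cis (- (x * \<xi>)))"
    unfolding char_def
    by (subst integral_density) (auto simp: scaleR_conv_of_real cis_conv_exp normal_density_nonneg mult.commute intro!: Bochner_Integration.integral_cong)
  finally have 1: "(LINT x|lborel. complex_of_real (std_normal_density x) * cis (- (x * \<xi>))) = complex_of_real (exp (- \<xi>\<^sup>2 / 2))"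
    by simp
  show "(LINT x|lborel. complex_of_real (exp (- x\<^sup>2 / 2)) * cis (- (x * \<xi>))) = complex_of_real (sqrt (2 * pi) * exp (- \<xi>\<^sup>2 / 2))"
    unfolding e[of x for x] mult.assoc of_real_mult integral_mult_right_zero 1
    by (simp add: std_normal_density_def)
qed

lemma gaussian_fourier_plane:
  fixes \<zeta> :: "real \<times> real"
  shows "(LINT z|lborel. complex_of_real (exp (- (norm z)\<^sup>2 / 2)) * cis (- (z \<bullet> \<zeta>)))
    = complex_of_real (2 * pi * exp (- (norm \<zeta>)\<^sup>2 / 2))"
proof -
  let ?a = "\<lambda>\<xi> x. complex_of_real (exp (- x\<^sup>2 / 2)) * cis (- (x * \<xi>))"
  have i: "integrable lborel (?a \<xi>)" for \<xi>
    by (rule Bochner_Integration.integrable_bound[OF gaussian_fourier_line(1)]) (auto simp: norm_mult)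
  have "complex_of_real (exp (- (norm z)\<^sup>2 / 2)) * cis (- (z \<bullet> \<zeta>)) = ?a (fst \<zeta>) (fst z) * ?a (snd \<zeta>) (snd z)" for z :: "real \<times> real"
    by (simp add: norm_plane_sq inner_prod_def cis_mult exp_add[symmetric] of_real_mult[symmetric]
        field_simps add_divide_distrib del: of_real_mult flip: of_real_exp)
  then have "(LINT z|lborel. complex_of_real (exp (- (norm z)\<^sup>2 / 2)) * cis (- (z \<bullet> \<zeta>)))
     = (LINT x|lborel. ?a (fst \<zeta>) x) * (LINT x|lborel. ?a (snd \<zeta>) x)"
    using plane_integral_tensor(2)[OF i i] by simp
  also have "\<dots> = complex_of_real (sqrt (2 * pi) * exp (- (fst \<zeta>)\<^sup>2 / 2) * (sqrt (2 * pi) * exp (- (snd \<zeta>)\<^sup>2 / 2)))"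
    unfolding gaussian_fourier_line by simp
  also have "sqrt (2 * pi) * exp (- (fst \<zeta>)\<^sup>2 / 2) * (sqrt (2 * pi) * exp (- (snd \<zeta>)\<^sup>2 / 2))
     = (sqrt (2 * pi) * sqrt (2 * pi)) * (exp (- (fst \<zeta>)\<^sup>2 / 2) * exp (- (snd \<zeta>)\<^sup>2 / 2))"
    by (simp only: mult_ac)
  also have "\<dots> = 2 * pi * exp (- (norm \<zeta>)\<^sup>2 / 2)"
    by (simp only: exp_add[symmetric] norm_plane_sq) (simp add: field_simps)
  finally show ?thesis .
qed

lemma lborel_plane_affine:
  fixes f :: "real \<times> real \<Rightarrow> 'a::{banach, second_countable_topology}"
  assumes [measurable]: "f \<in> borel_measurable borel" and c: "c \<noteq> 0"
  shows "(LINT z|lborel. f z) = c\<^sup>2 *\<^sub>R (LINT z|lborel. f (t + c *\<^sub>R z))"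
  by (subst lborel_affine[OF c, of t])
     (simp add: integral_density integral_distr power2_eq_square)

lemma integrable_plane_affine:
  fixes f :: "'b::euclidean_space \<Rightarrow> 'a::{banach, second_countable_topology}"
  assumes f: "integrable lborel f" and c: "c \<noteq> 0"
  shows "integrable lborel (\<lambda>z. f (t + c *\<^sub>R z))"
proof -
  have [measurable]: "f \<in> borel_measurable borel" using f by (auto dest: borel_measurable_integrable)
  have "integrable (density (distr lborel borel (\<lambda>x. t + c *\<^sub>R x)) (\<lambda>_. ennreal (\<bar>c\<bar>^DIM('b)))) f"
    using f lborel_affine[OF c, of t] by (simp add: ennreal_power)
  then have "integrable lborel (\<lambda>x. \<bar>c\<bar>^DIM('b) *\<^sub>R f (t + c *\<^sub>R x))"
    by (subst (asm) integrable_density) (simp_all add: integrable_distr_eq)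
  from integrable_scaleR_right[OF this, of "1 / \<bar>c\<bar>^DIM('b)"] show ?thesis using c by simp
qed

lemma gaussian_plane:
  "integrable lborel (\<lambda>z :: real \<times> real. exp (- (norm z)\<^sup>2 / 2))"
  "(LINT z :: real \<times> real|lborel. complex_of_real (exp (- (norm z)\<^sup>2 / 2))) = complex_of_real (2 * pi)"
proof -
  have "integrable lborel (\<lambda>z :: real \<times> real. complex_of_real (exp (- (fst z)\<^sup>2 / 2)) * complex_of_real (exp (- (snd z)\<^sup>2 / 2)))"
    by (rule plane_integral_tensor(1)[OF gaussian_fourier_line(1) gaussian_fourier_line(1)])
  then have "integrable lborel (\<lambda>z :: real \<times> real. norm (complex_of_real (exp (- (fst z)\<^sup>2 / 2)) * complex_of_real (exp (- (snd z)\<^sup>2 / 2))))"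
    by (rule integrable_norm)
  then show "integrable lborel (\<lambda>z :: real \<times> real. exp (- (norm z)\<^sup>2 / 2))"
    by (simp only: norm_mult norm_of_real abs_exp_cancel exp_add[symmetric] norm_plane_sq
        add_divide_distrib minus_add_distrib)
  show "(LINT z :: real \<times> real|lborel. complex_of_real (exp (- (norm z)\<^sup>2 / 2))) = complex_of_real (2 * pi)"
    using gaussian_fourier_plane[of 0] by simp
qed

lemma inv_fourier_measurable:
  assumes [measurable]: "g \<in> borel_measurable borel"
  shows "inv_fourier g \<in> borel_measurable borel"
  unfolding inv_fourier_def by measurable

text \<open>Inversion by Gaussian regularisation: inserting \<open>exp (- |c z|\<^sup>2 / 2)\<close> into the integral that defines
the left-hand side turns it, by Fubini's theorem, into an average of \<open>g\<close> over a Gaussian of width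
\<open>c\<close> around \<open>\<eta>\<close>. As \<open>c\<close> tends to \<open>0\<close>, dominated convergence applies to both expressions.\<close>
theorem fourier_inv_fourier:
  assumes g: "integrable lborel g" and bound: "\<And>\<zeta>. cmod (g \<zeta>) \<le> B" and cont: "continuous_on UNIV g"
    and f: "integrable lborel (inv_fourier g)"
  shows "fourier (inv_fourier g) \<eta> = g \<eta>"
proof -
  have [measurable]: "g \<in> borel_measurable borel" "inv_fourier g \<in> borel_measurable borel"
    using g f by (auto dest: borel_measurable_integrable)
  define c where "c = (\<lambda>n. inverse (real (Suc n)))"
  have c0: "c n > 0" for n by (simp add: c_def)
  have clim: "c \<longlonglongrightarrow> 0" unfolding c_def by (rule LIMSEQ_inverse_real_of_nat)
  define k where "k = (\<lambda>v :: real \<times> real. complex_of_real (exp (- (norm v)\<^sup>2 / 2)))"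
  have [measurable]: "k \<in> borel_measurable borel" unfolding k_def by measurable
  have k_le: "cmod (k v) \<le> 1" and kint: "integrable lborel k" "integrable lborel (\<lambda>v. cmod (k v))" for v
    unfolding k_def using gaussian_plane(1) by (simp_all add: norm_exp_eq_Re del: of_real_exp)
  \<comment> \<open>the regularised transform, and its value as a Gaussian average of \<open>g\<close>\<close>
  define L where "L = (\<lambda>n. LINT z|lborel. inv_fourier g z * cis (- (z \<bullet> \<eta>)) * k (c n *\<^sub>R z))"
  define R where "R = (\<lambda>n. complex_of_real (1 / (2 * pi)) * (LINT v|lborel. g (\<eta> + c n *\<^sub>R v) * k v))"
  have LR: "L n = R n" for n
  proof -
    let ?K = "complex_of_real (1 / (2 * pi)\<^sup>2)"
    have c_split: "cis (- (z \<bullet> (\<eta> - \<zeta>))) = cis (z \<bullet> \<zeta>) * cis (- (z \<bullet> \<eta>))" for z \<zeta> :: "real \<times> real"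
      by (simp add: cis_mult inner_diff_right)
    have "L n = (LINT z|lborel. LINT \<zeta>|lborel. (?K * k (c n *\<^sub>R z)) * (g \<zeta> * cis (- (z \<bullet> (\<eta> - \<zeta>)))))"
      unfolding L_def inv_fourier_def
      by (intro Bochner_Integration.integral_cong refl)
         (simp add: c_split mult_ac flip: integral_mult_right_zero integral_mult_left_zero)
    also have "\<dots> = (LINT \<zeta>|lborel. LINT z|lborel. (?K * k (c n *\<^sub>R z)) * (g \<zeta> * cis (- (z \<bullet> (\<eta> - \<zeta>)))))"
    proof (rule integral_swap_bound)
      show "integrable lborel (\<lambda>z. cmod (?K * k (c n *\<^sub>R z)))"
        using integrable_plane_affine[OF kint(2), of "c n" 0] c0[of n] by (simp add: norm_mult norm_divide)
      show "integrable lborel (\<lambda>\<zeta>. cmod (g \<zeta>))" using g by simp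
    qed (simp_all add: norm_mult norm_divide split_beta')
    also have "\<dots> = (LINT \<zeta>|lborel. ?K * g \<zeta> * (LINT z|lborel. k (c n *\<^sub>R z) * cis (- (z \<bullet> (\<eta> - \<zeta>)))))"
      by (intro Bochner_Integration.integral_cong refl)
         (simp add: mult_ac flip: integral_mult_right_zero)
    also have "\<dots> = (LINT \<zeta>|lborel. ?K * g \<zeta> * (complex_of_real (2 * pi / (c n)\<^sup>2) * k ((1 / c n) *\<^sub>R (\<eta> - \<zeta>))))"
    proof (intro Bochner_Integration.integral_cong refl arg_cong2[where f = "(*)"])
      fix \<zeta> :: "real \<times> real"
      have "complex_of_real (2 * pi) * k ((1 / c n) *\<^sub>R (\<eta> - \<zeta>)) = (LINT z|lborel. k z * cis (- (z \<bullet> ((1 / c n) *\<^sub>R (\<eta> - \<zeta>)))))"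
        using gaussian_fourier_plane[of "(1 / c n) *\<^sub>R (\<eta> - \<zeta>)"] by (simp add: k_def del: of_real_exp)
      also have "\<dots> = (c n)\<^sup>2 *\<^sub>R (LINT z|lborel. k (0 + c n *\<^sub>R z) * cis (- ((0 + c n *\<^sub>R z) \<bullet> ((1 / c n) *\<^sub>R (\<eta> - \<zeta>)))))"
        using c0[of n] by (intro lborel_plane_affine) auto
      also have "\<dots> = (c n)\<^sup>2 *\<^sub>R (LINT z|lborel. k (c n *\<^sub>R z) * cis (- (z \<bullet> (\<eta> - \<zeta>))))"
      proof -
        have "(0 + c n *\<^sub>R z) \<bullet> ((1 / c n) *\<^sub>R (\<eta> - \<zeta>)) = z \<bullet> (\<eta> - \<zeta>)" for z
          using c0[of n] by (simp only: inner_scaleR_left inner_scaleR_right add_0_left) simp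
        then show ?thesis by (simp only: add_0_left)
      qed
      finally show "(LINT z|lborel. k (c n *\<^sub>R z) * cis (- (z \<bullet> (\<eta> - \<zeta>)))) = complex_of_real (2 * pi / (c n)\<^sup>2) * k ((1 / c n) *\<^sub>R (\<eta> - \<zeta>))"
        using c0[of n] by (simp add: scaleR_conv_of_real field_simps)
    qed
    also have "\<dots> = (c n)\<^sup>2 *\<^sub>R (LINT v|lborel. ?K * g (\<eta> + c n *\<^sub>R v) * (complex_of_real (2 * pi / (c n)\<^sup>2) * k ((1 / c n) *\<^sub>R (\<eta> - (\<eta> + c n *\<^sub>R v)))))"
      using c0[of n] by (intro lborel_plane_affine) auto
    also have "\<dots> = R n"
      using c0[of n] by (simp add: R_def k_def scaleR_conv_of_real field_simps power2_eq_square flip: integral_mult_right_zero)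
    finally show ?thesis .
  qed
  have "L \<longlonglongrightarrow> (LINT z|lborel. inv_fourier g z * cis (- (z \<bullet> \<eta>)))"
    unfolding L_def
  proof (rule integral_dominated_convergence[where w = "\<lambda>z. cmod (inv_fourier g z)"])
    show "AE z in lborel. (\<lambda>n. inv_fourier g z * cis (- (z \<bullet> \<eta>)) * k (c n *\<^sub>R z)) \<longlonglongrightarrow> inv_fourier g z * cis (- (z \<bullet> \<eta>))"
    proof (rule AE_I2)
      fix z :: "real \<times> real"
      have "(\<lambda>n. k (c n *\<^sub>R z)) \<longlonglongrightarrow> complex_of_real (exp (- (norm (0 *\<^sub>R z))\<^sup>2 / 2))"
        unfolding k_def by (intro tendsto_intros clim) simp
      then show "(\<lambda>n. inv_fourier g z * cis (- (z \<bullet> \<eta>)) * k (c n *\<^sub>R z)) \<longlonglongrightarrow> inv_fourier g z * cis (- (z \<bullet> \<eta>))"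
        using tendsto_mult[OF tendsto_const, of "\<lambda>n. k (c n *\<^sub>R z)" 1] by simp
    qed
    show "AE z in lborel. cmod (inv_fourier g z * cis (- (z \<bullet> \<eta>)) * k (c n *\<^sub>R z)) \<le> cmod (inv_fourier g z)" for n
      using k_le by (intro AE_I2) (simp add: norm_mult mult_left_le)
  qed (use f in auto)
  then have 1: "L \<longlonglongrightarrow> fourier (inv_fourier g) \<eta>" by (simp add: fourier_def)
  have "(\<lambda>n. LINT v|lborel. g (\<eta> + c n *\<^sub>R v) * k v) \<longlonglongrightarrow> (LINT v|lborel. g \<eta> * k v)"
  proof (rule integral_dominated_convergence[where w = "\<lambda>v. B * cmod (k v)"])
    show "AE v in lborel. (\<lambda>n. g (\<eta> + c n *\<^sub>R v) * k v) \<longlonglongrightarrow> g \<eta> * k v"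
    proof (rule AE_I2, rule tendsto_mult[OF _ tendsto_const])
      fix v :: "real \<times> real"
      have "(\<lambda>n. \<eta> + c n *\<^sub>R v) \<longlonglongrightarrow> \<eta> + 0 *\<^sub>R v"
        by (intro tendsto_intros clim)
      then have lim: "(\<lambda>n. \<eta> + c n *\<^sub>R v) \<longlonglongrightarrow> \<eta>" by simp
      show "(\<lambda>n. g (\<eta> + c n *\<^sub>R v)) \<longlonglongrightarrow> g \<eta>"
        by (rule isCont_tendsto_compose[OF _ lim]) (use cont in \<open>simp add: continuous_on_eq_continuous_at del: split_paired_All\<close>)
    qed
    show "AE v in lborel. cmod (g (\<eta> + c n *\<^sub>R v) * k v) \<le> B * cmod (k v)" for n
      using bound by (intro AE_I2) (simp add: norm_mult mult_right_mono)
  qed (use kint in auto)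
  then have "R \<longlonglongrightarrow> complex_of_real (1 / (2 * pi)) * (LINT v|lborel. g \<eta> * k v)"
    unfolding R_def by (rule tendsto_mult[OF tendsto_const])
  also have "complex_of_real (1 / (2 * pi)) * (LINT v|lborel. g \<eta> * k v) = g \<eta>"
    unfolding k_def by (simp add: gaussian_plane(2)[simplified])
  finally have "L \<longlonglongrightarrow> g \<eta>" using LR by presburger
  then show ?thesis using 1 LIMSEQ_unique by blast
qed

section \<open>Polynomials times exponentials of polynomials\<close>

text \<open>Averaging \<open>G'\<close> over the translations \<open>s e\<close> with \<open>0 \<le> s \<le> 1\<close> does not change its integral and yields
\<open>G (\<zeta> + e) - G \<zeta>\<close>, whose integral vanishes by translation invariance. In contrast to an
argument on lines, this asks for no decay of \<open>G\<close> and treats all directions alike.\<close>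
lemma integral_directional_derivative:
  fixes G G' :: "plane_fun" and e :: "real \<times> real"
  assumes G: "integrable lborel G" and G': "integrable lborel G'" and cont: "continuous_on UNIV G'"
    and deriv: "\<And>\<zeta> s. ((\<lambda>s. G (\<zeta> + s *\<^sub>R e)) has_vector_derivative G' (\<zeta> + s *\<^sub>R e)) (at s)"
  shows "(LINT \<zeta>|lborel. G' \<zeta>) = 0"
proof -
  have [measurable]: "G \<in> borel_measurable borel" "G' \<in> borel_measurable borel"
    using G G' by (auto dest: borel_measurable_integrable)
  define F where "F = (\<lambda>s \<zeta>. indicat_real {0..1} s *\<^sub>R G' (\<zeta> + s *\<^sub>R e))"
  have shift: "integrable lborel (\<lambda>\<zeta>. G' (\<zeta> + s *\<^sub>R e))" "(LINT \<zeta>|lborel. G' (\<zeta> + s *\<^sub>R e)) = (LINT \<zeta>|lborel. G' \<zeta>)"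
    "(LINT \<zeta>|lborel. cmod (G' (\<zeta> + s *\<^sub>R e))) = (LINT \<zeta>|lborel. cmod (G' \<zeta>))" for s
    using integrable_plane_affine[OF G', of 1 "s *\<^sub>R e"] lborel_plane_affine[of G' 1 "s *\<^sub>R e"]
      lborel_plane_affine[of "\<lambda>z. cmod (G' z)" 1 "s *\<^sub>R e"] by (simp_all add: add.commute)
  have shiftG: "integrable lborel (\<lambda>\<zeta>. G (\<zeta> + e))" "(LINT \<zeta>|lborel. G (\<zeta> + e)) = (LINT \<zeta>|lborel. G \<zeta>)"
    using integrable_plane_affine[OF G, of 1 e] lborel_plane_affine[of G 1 e] by (simp_all add: add.commute)
  have int: "integrable (lborel \<Otimes>\<^sub>M lborel) (case_prod F)"
  proof (rule lborel_pair.Fubini_integrable)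
    show "case_prod F \<in> borel_measurable (lborel \<Otimes>\<^sub>M lborel)"
      unfolding F_def by measurable
    show "integrable lborel (\<lambda>s. LINT \<zeta>|lborel. norm (case (s, \<zeta>) of (s, \<zeta>) \<Rightarrow> F s \<zeta>))"
      by (simp add: F_def shift)
    show "AE s in lborel. integrable lborel (\<lambda>\<zeta>. case (s, \<zeta>) of (s, \<zeta>) \<Rightarrow> F s \<zeta>)"
      using shift(1) by (simp add: F_def)
  qed
  have "(LINT \<zeta>|lborel. G' \<zeta>) = (LINT s :: real|lborel. indicat_real {0..1} s *\<^sub>R (LINT \<zeta>|lborel. G' \<zeta>))"
    by (subst Bochner_Integration.integral_scaleR_left) simp_all
  also have "\<dots> = (LINT s|lborel. LINT \<zeta>|lborel. F s \<zeta>)"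
    by (simp add: F_def shift)
  also have "\<dots> = (LINT \<zeta>|lborel. LINT s|lborel. F s \<zeta>)"
    using lborel_pair.Fubini_integral[OF int] by simp
  also have "\<dots> = (LINT \<zeta>|lborel. G (\<zeta> + e) - G \<zeta>)"
  proof (intro Bochner_Integration.integral_cong refl)
    fix \<zeta>
    have "(LINT s|lborel. F s \<zeta>) = G (\<zeta> + 1 *\<^sub>R e) - G (\<zeta> + 0 *\<^sub>R e)"
      unfolding F_def
    proof (rule integral_FTC_atLeastAtMost)
      show "continuous_on {0..1} (\<lambda>s. G' (\<zeta> + s *\<^sub>R e))"
        by (intro continuous_on_compose2[OF cont] continuous_intros) auto
    qed (simp_all add: has_vector_derivative_at_within[OF deriv])
    then show "(LINT s|lborel. F s \<zeta>) = G (\<zeta> + e) - G \<zeta>" by simp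
  qed
  also have "\<dots> = 0" using shiftG G by simp
  finally show ?thesis .
qed

text \<open>From \<open>1 + r \<le> exp r\<close> and \<open>k r \<le> k\<^sup>2 / (4 a) + a r\<^sup>2\<close>.\<close>
lemma power_le_exp_square:
  fixes r a :: real
  assumes "r \<ge> 0" "a > 0"
  shows "(1 + r) ^ k \<le> exp ((real k)\<^sup>2 / (4 * a)) * exp (a * r\<^sup>2)"
proof -
  have "(1 + r) ^ k \<le> exp r ^ k"
    using assms by (intro power_mono exp_ge_add_one_self) auto
  also have "\<dots> = exp (real k * r)" by (simp add: exp_of_nat_mult)
  also have "real k * r \<le> (real k)\<^sup>2 / (4 * a) + a * r\<^sup>2"
  proof -
    have "0 \<le> (real k - 2 * a * r)\<^sup>2" by simp
    then show ?thesis using assms by (simp add: field_simps power2_eq_square)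
  qed
  finally show ?thesis by (simp add: exp_add)
qed

text \<open>Polynomials in \<open>\<zeta>\<close> whose coefficients depend on a parameter \<open>p\<close> and are bounded by powers of \<open>\<kappa> p\<close>.
Keeping track of the parameter is what makes the decay estimates below uniform enough to be
integrated over \<open>p\<close>.\<close>
inductive param_poly :: "('p \<Rightarrow> real) \<Rightarrow> ('p \<Rightarrow> plane_fun) \<Rightarrow> bool" for \<kappa> where
  coeff: "(\<And>p. cmod (a p) \<le> C * \<kappa> p ^ k) \<Longrightarrow> param_poly \<kappa> (\<lambda>p \<zeta>. a p)"
| linear: "param_poly \<kappa> (\<lambda>p \<zeta>. complex_of_real (\<zeta> \<bullet> v))"
| add: "param_poly \<kappa> P \<Longrightarrow> param_poly \<kappa> R \<Longrightarrow> param_poly \<kappa> (\<lambda>p \<zeta>. P p \<zeta> + R p \<zeta>)"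
| mult: "param_poly \<kappa> P \<Longrightarrow> param_poly \<kappa> R \<Longrightarrow> param_poly \<kappa> (\<lambda>p \<zeta>. P p \<zeta> * R p \<zeta>)"

lemma param_poly_const: "param_poly \<kappa> (\<lambda>p \<zeta>. c)"
  by (rule coeff[of _ "cmod c" _ 0]) simp

lemma param_poly_fst: "param_poly \<kappa> (\<lambda>p \<zeta>. complex_of_real (fst \<zeta>))"
  and param_poly_snd: "param_poly \<kappa> (\<lambda>p \<zeta>. complex_of_real (snd \<zeta>))"
  using linear[of \<kappa> "(1, 0)"] linear[of \<kappa> "(0, 1)"] by (simp_all add: inner_prod_def)

lemma param_poly_diff:
  assumes "param_poly \<kappa> P" "param_poly \<kappa> R"
  shows "param_poly \<kappa> (\<lambda>p \<zeta>. P p \<zeta> - R p \<zeta>)"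
  using add[OF assms(1) mult[OF param_poly_const[of _ "-1"] assms(2)]] by simp

lemma param_poly_power: "param_poly \<kappa> P \<Longrightarrow> param_poly \<kappa> (\<lambda>p \<zeta>. P p \<zeta> ^ n)"
  by (induction n) (auto intro: mult param_poly_const)

lemma param_poly_differentiable: "param_poly \<kappa> P \<Longrightarrow> P p differentiable (at \<zeta>)"
proof (induction rule: param_poly.induct)
  case (linear v)
  have "((\<lambda>\<zeta>. complex_of_real (\<zeta> \<bullet> v)) has_derivative (\<lambda>h. complex_of_real (h \<bullet> v))) (at \<zeta>)"
    by (auto intro!: derivative_eq_intros)
  then show ?case by (auto simp: differentiable_def)
qed auto

lemma param_poly_bound:
  assumes "param_poly \<kappa> P" and \<kappa>: "\<And>p. \<kappa> p \<ge> 1"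
  shows "\<exists>C k. C \<ge> 0 \<and> (\<forall>p \<zeta>. cmod (P p \<zeta>) \<le> C * (\<kappa> p * (1 + norm \<zeta>)) ^ k)"
  using assms(1)
proof (induction rule: param_poly.induct)
  case (coeff a C k)
  have "cmod (a p) \<le> \<bar>C\<bar> * (\<kappa> p * (1 + norm \<zeta>)) ^ k" for p and \<zeta> :: "real \<times> real"
  proof -
    have "C * \<kappa> p ^ k \<le> \<bar>C\<bar> * (\<kappa> p * (1 + norm \<zeta>)) ^ k"
      using \<kappa>[of p] by (intro mult_mono power_mono) (auto simp: mult_le_cancel_left1)
    with coeff[of p] show ?thesis by linarith
  qed
  then show ?case by (intro exI[of _ "\<bar>C\<bar>"] exI[of _ k]) auto
next
  case (linear v)
  have "cmod (complex_of_real (\<zeta> \<bullet> v)) \<le> norm v * (\<kappa> p * (1 + norm \<zeta>)) ^ 1" for p \<zeta>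
  proof -
    have "\<bar>\<zeta> \<bullet> v\<bar> \<le> norm \<zeta> * norm v" by (rule Cauchy_Schwarz_ineq2)
    also have "\<dots> \<le> (\<kappa> p * (1 + norm \<zeta>)) * norm v"
    proof (rule mult_right_mono)
      have "1 * (1 + norm \<zeta>) \<le> \<kappa> p * (1 + norm \<zeta>)" using \<kappa>[of p] by (intro mult_right_mono) auto
      then show "norm \<zeta> \<le> \<kappa> p * (1 + norm \<zeta>)" by simp
    qed simp
    finally show ?thesis by (simp add: mult_ac)
  qed
  then show ?case by (intro exI[of _ "norm v"] exI[of _ 1]) auto
next
  case (add P R)
  then obtain C k D l where C: "C \<ge> 0" "\<And>p \<zeta>. cmod (P p \<zeta>) \<le> C * (\<kappa> p * (1 + norm \<zeta>)) ^ k"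
    and D: "D \<ge> 0" "\<And>p \<zeta>. cmod (R p \<zeta>) \<le> D * (\<kappa> p * (1 + norm \<zeta>)) ^ l" by metis
  have "cmod (P p \<zeta> + R p \<zeta>) \<le> (C + D) * (\<kappa> p * (1 + norm \<zeta>)) ^ (k + l)" for p \<zeta>
  proof -
    have 1: "1 \<le> \<kappa> p * (1 + norm \<zeta>)" using \<kappa>[of p] mult_mono[of 1 "\<kappa> p" 1 "1 + norm \<zeta>"] by simp
    have "cmod (P p \<zeta> + R p \<zeta>) \<le> C * (\<kappa> p * (1 + norm \<zeta>)) ^ k + D * (\<kappa> p * (1 + norm \<zeta>)) ^ l"
      using C D by (meson add_mono norm_triangle_le)
    also have "\<dots> \<le> C * (\<kappa> p * (1 + norm \<zeta>)) ^ (k + l) + D * (\<kappa> p * (1 + norm \<zeta>)) ^ (k + l)"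
      using 1 C D by (intro add_mono mult_left_mono power_increasing) auto
    finally show ?thesis by (simp add: algebra_simps)
  qed
  with C D show ?case by (intro exI[of _ "C + D"] exI[of _ "k + l"]) auto
next
  case (mult P R)
  then obtain C k D l where C: "C \<ge> 0" "\<And>p \<zeta>. cmod (P p \<zeta>) \<le> C * (\<kappa> p * (1 + norm \<zeta>)) ^ k"
    and D: "D \<ge> 0" "\<And>p \<zeta>. cmod (R p \<zeta>) \<le> D * (\<kappa> p * (1 + norm \<zeta>)) ^ l" by metis
  have "cmod (P p \<zeta> * R p \<zeta>) \<le> (C * D) * (\<kappa> p * (1 + norm \<zeta>)) ^ (k + l)" for p \<zeta>
  proof -
    have "cmod (P p \<zeta> * R p \<zeta>) \<le> (C * (\<kappa> p * (1 + norm \<zeta>)) ^ k) * (D * (\<kappa> p * (1 + norm \<zeta>)) ^ l)"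
      unfolding norm_mult using order_trans[OF norm_ge_zero C(2)[of p \<zeta>]] C(2) D(2)
      by (intro mult_mono) (simp_all del: split_paired_All)
    then show ?thesis by (simp add: power_add mult_ac)
  qed
  with C D show ?case by (intro exI[of _ "C * D"] exI[of _ "k + l"]) auto
qed

lemma param_poly_derivative:
  assumes "param_poly \<kappa> P"
  shows "\<exists>P'. param_poly \<kappa> P' \<and>
    (\<forall>p \<zeta> s. ((\<lambda>s. P p (\<zeta> + s *\<^sub>R e)) has_vector_derivative P' p (\<zeta> + s *\<^sub>R e)) (at s))"
  using assms
proof (induction rule: param_poly.induct)
  case (coeff a C k)
  show ?case by (intro exI[of _ "\<lambda>p \<zeta>. 0"]) (simp add: param_poly_const)
next
  case (linear v)
  have "((\<lambda>s. complex_of_real ((\<zeta> + s *\<^sub>R e) \<bullet> v)) has_vector_derivative complex_of_real (e \<bullet> v)) (at s)" for \<zeta> s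
    unfolding has_vector_derivative_def
    by (auto intro!: derivative_eq_intros simp: scaleR_conv_of_real)
  then show ?case by (intro exI[of _ "\<lambda>p \<zeta>. complex_of_real (e \<bullet> v)"]) (simp add: param_poly_const)
next
  case (add P R)
  then obtain P' R' where "param_poly \<kappa> P'" "param_poly \<kappa> R'"
    "\<And>p \<zeta> s. ((\<lambda>s. P p (\<zeta> + s *\<^sub>R e)) has_vector_derivative P' p (\<zeta> + s *\<^sub>R e)) (at s)"
    "\<And>p \<zeta> s. ((\<lambda>s. R p (\<zeta> + s *\<^sub>R e)) has_vector_derivative R' p (\<zeta> + s *\<^sub>R e)) (at s)" by metis
  then show ?case
    by (intro exI[of _ "\<lambda>p \<zeta>. P' p \<zeta> + R' p \<zeta>"]) (auto intro: param_poly.intros has_vector_derivative_add)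
next
  case (mult P R)
  then obtain P' R' where "param_poly \<kappa> P'" "param_poly \<kappa> R'"
    "\<And>p \<zeta> s. ((\<lambda>s. P p (\<zeta> + s *\<^sub>R e)) has_vector_derivative P' p (\<zeta> + s *\<^sub>R e)) (at s)"
    "\<And>p \<zeta> s. ((\<lambda>s. R p (\<zeta> + s *\<^sub>R e)) has_vector_derivative R' p (\<zeta> + s *\<^sub>R e)) (at s)" by metis
  with mult show ?case
    by (intro exI[of _ "\<lambda>p \<zeta>. P p \<zeta> * R' p \<zeta> + P' p \<zeta> * R p \<zeta>"])
       (auto intro: param_poly.intros has_vector_derivative_mult)
qed

lemma integrable_plane_gaussian:
  assumes "a > 0"
  shows "integrable lborel (\<lambda>z :: real \<times> real. exp (- a * (norm z)\<^sup>2))"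
  using integrable_plane_affine[OF gaussian_plane(1), of "sqrt (2 * a)" 0] assms
  by (simp add: power_mult_distrib)

text \<open>The functions \<open>P exp Q\<close>, where \<open>P\<close> ranges over all polynomials and \<open>Q\<close> is a fixed polynomial whose
real part is at most \<open>- |\<zeta>|\<^sup>2 / 4\<close> up to a constant, form a class that is closed under differentiation.
This replaces the Schwartz space: it contains the data in physical space and the evolved wave
packets in frequency space.\<close>
locale gaussian_family =
  fixes \<kappa> :: "'p \<Rightarrow> real" and Q :: "'p \<Rightarrow> plane_fun" and K :: real
  assumes weight_ge_1: "\<kappa> p \<ge> 1"
    and exponent_poly: "param_poly \<kappa> Q"
    and exponent_bound: "cmod (exp (Q p \<zeta>)) \<le> K * exp (- (norm \<zeta>)\<^sup>2 / 4)"
begin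

definition member :: "('p \<Rightarrow> plane_fun) \<Rightarrow> bool" where
  "member H \<longleftrightarrow> (\<exists>P. param_poly \<kappa> P \<and> H = (\<lambda>p \<zeta>. P p \<zeta> * exp (Q p \<zeta>)))"

lemma K_nonneg: "K \<ge> 0"
  using order_trans[OF norm_ge_zero exponent_bound[of undefined 0]] by simp

lemma member_bound:
  assumes "member H"
  shows "\<exists>C k. C \<ge> 0 \<and> (\<forall>p \<zeta>. (1 + norm \<zeta>) ^ m * cmod (H p \<zeta>) \<le> C * \<kappa> p ^ k * exp (- (1/8) * (norm \<zeta>)\<^sup>2))"
proof -
  from assms obtain P where P: "param_poly \<kappa> P" "H = (\<lambda>p \<zeta>. P p \<zeta> * exp (Q p \<zeta>))"
    by (auto simp: member_def)
  from param_poly_bound[OF P(1) weight_ge_1] obtain C k where C: "C \<ge> 0"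
    "\<And>p \<zeta>. cmod (P p \<zeta>) \<le> C * (\<kappa> p * (1 + norm \<zeta>)) ^ k" by blast
  define D where "D = exp ((real (m + k))\<^sup>2 / (4 * (1/8)))"
  have "(1 + norm \<zeta>) ^ m * cmod (H p \<zeta>) \<le> (C * K * D) * \<kappa> p ^ k * exp (- (1/8) * (norm \<zeta>)\<^sup>2)" for p \<zeta>
  proof -
    have "cmod (H p \<zeta>) \<le> (C * (\<kappa> p * (1 + norm \<zeta>)) ^ k) * (K * exp (- (norm \<zeta>)\<^sup>2 / 4))"
      unfolding P(2) norm_mult
      by (rule mult_mono[OF C(2) exponent_bound order_trans[OF norm_ge_zero C(2)[of p \<zeta>]] norm_ge_zero])
    then have "(1 + norm \<zeta>) ^ m * cmod (H p \<zeta>)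
        \<le> (1 + norm \<zeta>) ^ m * ((C * (\<kappa> p * (1 + norm \<zeta>)) ^ k) * (K * exp (- (norm \<zeta>)\<^sup>2 / 4)))"
      by (intro mult_left_mono) auto
    also have "\<dots> = C * K * \<kappa> p ^ k * (1 + norm \<zeta>) ^ (m + k) * exp (- (norm \<zeta>)\<^sup>2 / 4)"
      by (simp add: power_add power_mult_distrib mult_ac)
    also have "\<dots> \<le> C * K * \<kappa> p ^ k * (D * exp ((1/8) * (norm \<zeta>)\<^sup>2)) * exp (- (norm \<zeta>)\<^sup>2 / 4)"
    proof (intro mult_right_mono mult_left_mono)
      show "(1 + norm \<zeta>) ^ (m + k) \<le> D * exp ((1/8) * (norm \<zeta>)\<^sup>2)"
        unfolding D_def by (rule power_le_exp_square) auto
      show "0 \<le> C * K * \<kappa> p ^ k" using C K_nonneg weight_ge_1[of p] by simp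
    qed simp
    also have "\<dots> = (C * K * D) * \<kappa> p ^ k * (exp ((1/8) * (norm \<zeta>)\<^sup>2) * exp (- (norm \<zeta>)\<^sup>2 / 4))"
      by (simp add: mult_ac)
    also have "exp ((1/8) * (norm \<zeta>)\<^sup>2) * exp (- (norm \<zeta>)\<^sup>2 / 4) = exp (- (1/8) * (norm \<zeta>)\<^sup>2)"
      by (simp only: exp_add[symmetric]) simp
    finally show ?thesis .
  qed
  moreover have "C * K * D \<ge> 0" using C K_nonneg by (simp add: D_def)
  ultimately show ?thesis by blast
qed

lemma member_differentiable: "member H \<Longrightarrow> H p differentiable (at \<zeta>)"
proof -
  assume "member H"
  then obtain P where P: "param_poly \<kappa> P" "H = (\<lambda>p \<zeta>. P p \<zeta> * exp (Q p \<zeta>))"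
    by (auto simp: member_def)
  obtain D where D: "(Q p has_derivative D) (at \<zeta>)"
    using param_poly_differentiable[OF exponent_poly] unfolding differentiable_def by blast
  have "((\<lambda>\<zeta>. exp (Q p \<zeta>)) has_derivative (\<lambda>h. D h * exp (Q p \<zeta>))) (at \<zeta>)"
    using has_derivative_compose[OF D, of exp "(*) (exp (Q p \<zeta>))"] DERIV_exp[of "Q p \<zeta>"]
    by (simp add: has_field_derivative_def mult.commute[of "exp (Q p \<zeta>)"])
  then have "(\<lambda>\<zeta>. exp (Q p \<zeta>)) differentiable (at \<zeta>)" by (auto simp: differentiable_def)
  then show ?thesis unfolding P(2) by (intro differentiable_mult param_poly_differentiable[OF P(1)])
qed

lemma member_continuous: "member H \<Longrightarrow> continuous_on UNIV (H p)"
  by (meson continuous_at_imp_continuous_on differentiable_imp_continuous_within member_differentiable)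

lemma member_integrable:
  assumes H: "member H" shows "integrable lborel (H p)"
proof -
  from member_bound[OF H, of 0] obtain C k where
    C: "\<And>p \<zeta>. cmod (H p \<zeta>) \<le> C * \<kappa> p ^ k * exp (- (1/8) * (norm \<zeta>)\<^sup>2)" by auto
  have [measurable]: "H p \<in> borel_measurable borel"
    by (intro borel_measurable_continuous_onI member_continuous H)
  have "integrable lborel (\<lambda>\<zeta> :: real \<times> real. C * \<kappa> p ^ k * exp (- (1/8) * (norm \<zeta>)\<^sup>2))"
    using integrable_plane_gaussian[of "1/8"] by simp
  then show ?thesis
    by (rule Bochner_Integration.integrable_bound) (use C in \<open>auto intro!: order_trans[OF _ abs_ge_self]\<close>)
qed

lemma member_derivative:
  assumes "member H"
  shows "\<exists>H'. member H' \<and>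
    (\<forall>p \<zeta> s. ((\<lambda>s. H p (\<zeta> + s *\<^sub>R e)) has_vector_derivative H' p (\<zeta> + s *\<^sub>R e)) (at s))"
proof -
  from assms obtain P where P: "param_poly \<kappa> P" "H = (\<lambda>p \<zeta>. P p \<zeta> * exp (Q p \<zeta>))"
    by (auto simp: member_def)
  from param_poly_derivative[OF P(1)] param_poly_derivative[OF exponent_poly]
  obtain P' Q' where PQ: "param_poly \<kappa> P'" "param_poly \<kappa> Q'"
    "\<And>p \<zeta> s. ((\<lambda>s. P p (\<zeta> + s *\<^sub>R e)) has_vector_derivative P' p (\<zeta> + s *\<^sub>R e)) (at s)"
    "\<And>p \<zeta> s. ((\<lambda>s. Q p (\<zeta> + s *\<^sub>R e)) has_vector_derivative Q' p (\<zeta> + s *\<^sub>R e)) (at s)" by metis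
  define H' where "H' = (\<lambda>p \<zeta>. (P p \<zeta> * Q' p \<zeta> + P' p \<zeta>) * exp (Q p \<zeta>))"
  have "member H'" unfolding member_def H'_def using P PQ
    by (intro exI[of _ "\<lambda>p \<zeta>. P p \<zeta> * Q' p \<zeta> + P' p \<zeta>"]) (auto intro: param_poly.intros)
  moreover have "((\<lambda>s. H p (\<zeta> + s *\<^sub>R e)) has_vector_derivative H' p (\<zeta> + s *\<^sub>R e)) (at s)" for p \<zeta> s
  proof -
    have "((\<lambda>s. exp (Q p (\<zeta> + s *\<^sub>R e))) has_vector_derivative Q' p (\<zeta> + s *\<^sub>R e) * exp (Q p (\<zeta> + s *\<^sub>R e))) (at s)"
      using field_vector_diff_chain_at[OF PQ(4)[of p \<zeta> s] DERIV_exp] by (simp add: o_def)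
    from has_vector_derivative_mult[OF PQ(3)[of p \<zeta> s] this]
    show ?thesis unfolding P(2) H'_def by (simp add: algebra_simps)
  qed
  ultimately show ?thesis by blast
qed

lemma member_cmult: "member H \<Longrightarrow> member (\<lambda>p \<zeta>. c * H p \<zeta>)"
  unfolding member_def
proof (elim exE conjE)
  fix P assume P: "param_poly \<kappa> P" "H = (\<lambda>p \<zeta>. P p \<zeta> * exp (Q p \<zeta>))"
  show "\<exists>P. param_poly \<kappa> P \<and> (\<lambda>p \<zeta>. c * H p \<zeta>) = (\<lambda>p \<zeta>. P p \<zeta> * exp (Q p \<zeta>))"
    by (intro exI[of _ "\<lambda>p \<zeta>. c * P p \<zeta>"]) (auto simp: P mult_ac intro!: P mult param_poly_const)
qed

text \<open>Integration by parts: multiplication by \<open>z \<bullet> e\<close> corresponds to \<open>\<i>\<close> times the derivative in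
direction \<open>e\<close>, which does not leave the class.\<close>
lemma member_inv_fourier_mult:
  assumes "member H"
  shows "\<exists>H'. member H' \<and> (\<forall>p z. complex_of_real (z \<bullet> e) * inv_fourier (H p) z = inv_fourier (H' p) z)"
proof -
  from member_derivative[OF assms, of e] obtain H' where H': "member H'"
    "\<And>p \<zeta> s. ((\<lambda>s. H p (\<zeta> + s *\<^sub>R e)) has_vector_derivative H' p (\<zeta> + s *\<^sub>R e)) (at s)" by blast
  have "complex_of_real (z \<bullet> e) * inv_fourier (H p) z = inv_fourier (\<lambda>\<zeta>. \<i> * H' p \<zeta>) z" for p z
  proof -
    let ?c = "\<lambda>\<zeta>. cis (z \<bullet> \<zeta>)"
    have [measurable]: "H p \<in> borel_measurable borel" "H' p \<in> borel_measurable borel"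
      by (intro borel_measurable_continuous_onI member_continuous assms H')+
    have i: "integrable lborel (\<lambda>\<zeta>. H p \<zeta> * ?c \<zeta>)" "integrable lborel (\<lambda>\<zeta>. H' p \<zeta> * ?c \<zeta>)"
      by (rule Bochner_Integration.integrable_bound[OF member_integrable[OF assms, of p]]
               Bochner_Integration.integrable_bound[OF member_integrable[OF H'(1), of p]]; simp add: norm_mult)+
    let ?G' = "\<lambda>\<zeta>. H' p \<zeta> * ?c \<zeta> + \<i> * complex_of_real (z \<bullet> e) * (H p \<zeta> * ?c \<zeta>)"
    have "(LINT \<zeta>|lborel. ?G' \<zeta>) = 0"
    proof (rule integral_directional_derivative)
      show "integrable lborel (\<lambda>\<zeta>. H p \<zeta> * ?c \<zeta>)" "integrable lborel ?G'" using i by simp_all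
      show "continuous_on UNIV ?G'"
        by (intro continuous_intros member_continuous assms H')
      fix \<zeta> s
      have "((\<lambda>s. ?c (\<zeta> + s *\<^sub>R e)) has_vector_derivative \<i> * complex_of_real (z \<bullet> e) * ?c (\<zeta> + s *\<^sub>R e)) (at s)"
      proof -
        have d: "((\<lambda>s. \<i> * complex_of_real (z \<bullet> (\<zeta> + s *\<^sub>R e))) has_vector_derivative \<i> * complex_of_real (z \<bullet> e)) (at s)"
          unfolding has_vector_derivative_def
          by (auto intro!: derivative_eq_intros simp: scaleR_conv_of_real mult_ac)
        show ?thesis using field_vector_diff_chain_at[OF d DERIV_exp] by (simp add: o_def cis_conv_exp)
      qed
      from has_vector_derivative_mult[OF H'(2)[of p \<zeta> s] this]
      show "((\<lambda>s. H p (\<zeta> + s *\<^sub>R e) * ?c (\<zeta> + s *\<^sub>R e)) has_vector_derivative ?G' (\<zeta> + s *\<^sub>R e)) (at s)"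
        by (simp add: algebra_simps)
    qed
    then have "(LINT \<zeta>|lborel. H' p \<zeta> * ?c \<zeta>) = - (\<i> * complex_of_real (z \<bullet> e) * (LINT \<zeta>|lborel. H p \<zeta> * ?c \<zeta>))"
      using i by (simp add: eq_neg_iff_add_eq_0)
    then show ?thesis
      unfolding inv_fourier_def mult.assoc[of \<i>] integral_mult_right_zero by (simp add: algebra_simps)
  qed
  with member_cmult[OF H'(1), of \<i>] show ?thesis by blast
qed

lemma member_inv_fourier_bound:
  assumes H: "member H"
  shows "\<exists>C k. C \<ge> 0 \<and> (\<forall>p z. cmod (inv_fourier (H p) z) \<le> C * \<kappa> p ^ k)"
proof -
  from member_bound[OF H, of 0] obtain C k where
    C: "C \<ge> 0" "\<And>p \<zeta>. cmod (H p \<zeta>) \<le> C * \<kappa> p ^ k * exp (- (1/8) * (norm \<zeta>)\<^sup>2)" unfolding power_0 mult_1 by blast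
  define D where "D = (LINT \<zeta> :: real \<times> real|lborel. exp (- (1/8) * (norm \<zeta>)\<^sup>2))"
  have D0: "D \<ge> 0" unfolding D_def by simp
  have "cmod (inv_fourier (H p) z) \<le> (1 / (2 * pi)\<^sup>2 * (C * D)) * \<kappa> p ^ k" for p z
  proof -
    have "cmod (LINT \<zeta>|lborel. H p \<zeta> * cis (z \<bullet> \<zeta>)) \<le> (LINT \<zeta> :: real \<times> real|lborel. C * \<kappa> p ^ k * exp (- (1/8) * (norm \<zeta>)\<^sup>2))"
    proof (rule order_trans[OF integral_norm_bound integral_mono])
      show "integrable lborel (\<lambda>\<zeta>. cmod (H p \<zeta> * cis (z \<bullet> \<zeta>)))"
        using integrable_norm[OF member_integrable[OF H, of p]] by (simp add: norm_mult)
      show "integrable lborel (\<lambda>\<zeta> :: real \<times> real. C * \<kappa> p ^ k * exp (- (1/8) * (norm \<zeta>)\<^sup>2))"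
        using integrable_plane_gaussian[of "1/8"] by simp
      show "cmod (H p \<zeta> * cis (z \<bullet> \<zeta>)) \<le> C * \<kappa> p ^ k * exp (- (1/8) * (norm \<zeta>)\<^sup>2)" for \<zeta>
        unfolding norm_mult norm_cis mult_1_right by (rule C(2))
    qed
    also have "\<dots> = C * \<kappa> p ^ k * D" unfolding D_def by simp
    finally have "(1 / (2 * pi)\<^sup>2) * cmod (LINT \<zeta>|lborel. H p \<zeta> * cis (z \<bullet> \<zeta>)) \<le> (1 / (2 * pi)\<^sup>2) * (C * \<kappa> p ^ k * D)"
      by (intro mult_left_mono) auto
    then show ?thesis unfolding inv_fourier_def norm_mult norm_of_real by (simp add: mult_ac)
  qed
  moreover have "1 / (2 * pi)\<^sup>2 * (C * D) \<ge> 0" using C D0 by simp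
  ultimately show ?thesis by blast
qed

text \<open>Multiplication by \<open>x\<^sup>2\<close>, \<open>y\<^sup>2\<close> and \<open>x\<^sup>2 y\<^sup>2\<close> gives again inverse transforms of members, which are
bounded.\<close>
theorem member_inv_fourier_decay:
  assumes H: "member H"
  shows "\<exists>C k. C \<ge> 0 \<and> (\<forall>p z. cmod (inv_fourier (H p) z) \<le> C * \<kappa> p ^ k * (1 / (1 + (fst z)\<^sup>2) * (1 / (1 + (snd z)\<^sup>2))))"
proof -
  let ?I = "\<lambda>H p z. inv_fourier (H p) z"
  have sq: "\<exists>G'. member G' \<and> (\<forall>p z. complex_of_real ((z \<bullet> e)\<^sup>2) * ?I G p z = ?I G' p z)" if "member G" for G e
  proof -
    from member_inv_fourier_mult[OF that, of e] obtain G1 where 1: "member G1"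
      "\<And>p z. complex_of_real (z \<bullet> e) * ?I G p z = ?I G1 p z" by blast
    from member_inv_fourier_mult[OF 1(1), of e] obtain G2 where 2: "member G2"
      "\<And>p z. complex_of_real (z \<bullet> e) * ?I G1 p z = ?I G2 p z" by blast
    show ?thesis using 2(1) by (intro exI[of _ G2]) (simp add: power2_eq_square mult.assoc 1(2) 2(2))
  qed
  from sq[OF H, of "(1, 0)"] obtain A where A: "member A" "\<And>p z. complex_of_real ((fst z)\<^sup>2) * ?I H p z = ?I A p z"
    by (auto simp: inner_prod_def)
  from sq[OF H, of "(0, 1)"] obtain B where B: "member B" "\<And>p z. complex_of_real ((snd z)\<^sup>2) * ?I H p z = ?I B p z"
    by (auto simp: inner_prod_def)
  from sq[OF A(1), of "(0, 1)"] obtain E where E: "member E" "\<And>p z. complex_of_real ((snd z)\<^sup>2) * ?I A p z = ?I E p z"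
    by (auto simp: inner_prod_def)
  obtain c1 k1 c2 k2 c3 k3 c4 k4 where c: "c1 \<ge> 0" "\<And>p z. cmod (?I H p z) \<le> c1 * \<kappa> p ^ k1"
    "c2 \<ge> 0" "\<And>p z. cmod (?I A p z) \<le> c2 * \<kappa> p ^ k2"
    "c3 \<ge> 0" "\<And>p z. cmod (?I B p z) \<le> c3 * \<kappa> p ^ k3"
    "c4 \<ge> 0" "\<And>p z. cmod (?I E p z) \<le> c4 * \<kappa> p ^ k4"
    using member_inv_fourier_bound[OF H] member_inv_fourier_bound[OF A(1)] member_inv_fourier_bound[OF B(1)]
      member_inv_fourier_bound[OF E(1)] by metis
  let ?k = "k1 + k2 + k3 + k4" and ?C = "c1 + c2 + c3 + c4"
  have "cmod (?I H p z) \<le> ?C * \<kappa> p ^ ?k * (1 / (1 + (fst z)\<^sup>2) * (1 / (1 + (snd z)\<^sup>2)))" for p z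
  proof -
    have up: "c * \<kappa> p ^ k \<le> c * \<kappa> p ^ ?k" if "c \<ge> 0" "k \<le> ?k" for c k
      using that weight_ge_1[of p] by (intro mult_left_mono power_increasing) auto
    have "(1 + (fst z)\<^sup>2) * (1 + (snd z)\<^sup>2) * cmod (?I H p z)
       = cmod (?I H p z) + (fst z)\<^sup>2 * cmod (?I H p z) + (snd z)\<^sup>2 * cmod (?I H p z) + (snd z)\<^sup>2 * ((fst z)\<^sup>2 * cmod (?I H p z))"
      by (simp add: algebra_simps)
    also have "\<dots> = cmod (?I H p z) + cmod (?I A p z) + cmod (?I B p z) + cmod (?I E p z)"
      unfolding E(2)[symmetric] B(2)[symmetric] A(2)[symmetric] norm_mult norm_of_real by simp
    also have "\<dots> \<le> c1 * \<kappa> p ^ ?k + c2 * \<kappa> p ^ ?k + c3 * \<kappa> p ^ ?k + c4 * \<kappa> p ^ ?k"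
      by (intro add_mono order_trans[OF c(2) up] order_trans[OF c(4) up] order_trans[OF c(6) up]
          order_trans[OF c(8) up]) (use c in simp_all)
    also have "\<dots> = ?C * \<kappa> p ^ ?k" by (simp add: algebra_simps)
    finally have "(1 + (fst z)\<^sup>2) * (1 + (snd z)\<^sup>2) * cmod (?I H p z) \<le> ?C * \<kappa> p ^ ?k" .
    moreover have "0 < (1 + (fst z)\<^sup>2) * (1 + (snd z)\<^sup>2)" by (intro mult_pos_pos) (auto simp: add_pos_nonneg)
    ultimately have "cmod (?I H p z) \<le> ?C * \<kappa> p ^ ?k / ((1 + (fst z)\<^sup>2) * (1 + (snd z)\<^sup>2))"
      by (subst pos_le_divide_eq) (simp_all add: mult.commute)
    then show ?thesis by simp
  qed
  moreover have "?C \<ge> 0" using c by simp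
  ultimately show ?thesis by blast
qed

lemma member_dx_dy:
  assumes "member H"
  shows "\<exists>H'. member H' \<and> (\<forall>p. dx (H p) = H' p)" "\<exists>H'. member H' \<and> (\<forall>p. dy (H p) = H' p)"
proof -
  from member_derivative[OF assms, of "(1, 0)"] obtain A where A: "member A"
    "\<And>p \<zeta> s. ((\<lambda>s. H p (\<zeta> + s *\<^sub>R (1, 0))) has_vector_derivative A p (\<zeta> + s *\<^sub>R (1, 0))) (at s)" by blast
  have "dx (H p) = A p" for p
  proof (rule ext, clarify)
    fix x y show "dx (H p) (x, y) = A p (x, y)"
      using A(2)[of p "(0, y)" x] by (simp add: dx_def vector_derivative_at)
  qed
  with A show "\<exists>H'. member H' \<and> (\<forall>p. dx (H p) = H' p)" by blast
  from member_derivative[OF assms, of "(0, 1)"] obtain A where A: "member A"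
    "\<And>p \<zeta> s. ((\<lambda>s. H p (\<zeta> + s *\<^sub>R (0, 1))) has_vector_derivative A p (\<zeta> + s *\<^sub>R (0, 1))) (at s)" by blast
  have "dy (H p) = A p" for p
  proof (rule ext, clarify)
    fix x y show "dy (H p) (x, y) = A p (x, y)"
      using A(2)[of p "(x, 0)" y] by (simp add: dy_def vector_derivative_at)
  qed
  with A show "\<exists>H'. member H' \<and> (\<forall>p. dy (H p) = H' p)" by blast
qed

theorem member_schwartz:
  assumes "member H" shows "schwartz (H p)"
proof -
  have "\<exists>H'. member H' \<and> (dx ^^ a) ((dy ^^ b) (H p)) = H' p" for a b
  proof (induction a)
    case 0
    show ?case
    proof (induction b)
      case 0 show ?case using assms by auto
    next
      case (Suc b)
      then obtain H' where "member H'" "(dy ^^ b) (H p) = H' p" by auto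
      with member_dx_dy(2)[of H'] show ?case by auto
    qed
  next
    case (Suc a)
    then obtain H' where "member H'" "(dx ^^ a) ((dy ^^ b) (H p)) = H' p" by auto
    with member_dx_dy(1)[of H'] show ?case by auto
  qed
  then have m: "\<exists>H'. member H' \<and> (dx ^^ a) ((dy ^^ b) (H p)) = H' p" for a b by blast
  show ?thesis unfolding schwartz_def
  proof (intro conjI allI)
    fix a b
    show "(dx ^^ a) ((dy ^^ b) (H p)) differentiable_on UNIV"
      using m[of a b] member_differentiable by (auto simp: differentiable_on_def)
    fix k
    from m[of a b] obtain H' where H': "member H'" "(dx ^^ a) ((dy ^^ b) (H p)) = H' p" by auto
    from member_bound[OF H'(1), of k] obtain C l where
      C: "C \<ge> 0" "\<And>p \<zeta>. (1 + norm \<zeta>) ^ k * cmod (H' p \<zeta>) \<le> C * \<kappa> p ^ l * exp (- (1/8) * (norm \<zeta>)\<^sup>2)" by blast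
    have "C * \<kappa> p ^ l * exp (- (1/8) * (norm \<zeta>)\<^sup>2) \<le> C * \<kappa> p ^ l" for \<zeta> :: "real \<times> real"
      using C(1) weight_ge_1[of p] by (intro mult_right_le_one_le) auto
    then show "\<exists>B. \<forall>z. (1 + norm z) ^ k * cmod ((dx ^^ a) ((dy ^^ b) (H p)) z) \<le> B"
      unfolding H'(2) using C(2) by (meson order_trans)
  qed
qed

end

section \<open>Calculus of the inverse Fourier transform\<close>

lemma borel_measurable_plane[measurable]:
  "cnj \<in> borel_measurable borel"
  "fst \<in> borel_measurable (borel :: (real \<times> real) measure)"
  "snd \<in> borel_measurable (borel :: (real \<times> real) measure)"
  by (intro borel_measurable_continuous_onI continuous_intros)+

lemma integrable_convolution_pair:
  fixes f g :: "'a::euclidean_space \<Rightarrow> complex"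
  assumes f: "integrable lborel f" and g: "integrable lborel g"
  shows "integrable (lborel \<Otimes>\<^sub>M lborel) (\<lambda>(\<beta>, \<omega>). f (\<omega> + c *\<^sub>R \<beta>) * g \<beta>)"
proof (rule lborel_pair.Fubini_integrable)
  have [measurable]: "f \<in> borel_measurable borel" "g \<in> borel_measurable borel"
    using f g by (auto dest: borel_measurable_integrable)
  have shift: "integrable lborel (\<lambda>\<omega>. f (\<omega> + a))" for a
    using integrable_plane_affine[OF f, of 1 a] by (simp add: add.commute)
  have eq: "(LINT \<omega>|lborel. cmod (f (\<omega> + a))) = (LINT \<omega>|lborel. cmod (f \<omega>))" for a
    using lborel_distr_plus[of a] integral_distr[of "(+) a" lborel borel "\<lambda>x. cmod (f x)"]
    by (simp add: add.commute)
  show "(\<lambda>(\<beta>, \<omega>). f (\<omega> + c *\<^sub>R \<beta>) * g \<beta>) \<in> borel_measurable (lborel \<Otimes>\<^sub>M lborel)"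
    by measurable
  show "integrable lborel (\<lambda>\<beta>. LINT \<omega>|lborel. norm (case (\<beta>, \<omega>) of (\<beta>, \<omega>) \<Rightarrow> f (\<omega> + c *\<^sub>R \<beta>) * g \<beta>))"
    using integrable_norm[OF g] by (simp add: norm_mult eq)
  show "AE \<beta> in lborel. integrable lborel (\<lambda>\<omega>. case (\<beta>, \<omega>) of (\<beta>, \<omega>) \<Rightarrow> f (\<omega> + c *\<^sub>R \<beta>) * g \<beta>)"
    using shift by simp
qed

text \<open>The function whose inverse transform is the product of the inverse transform of \<open>f\<close> and the
conjugate of that of \<open>g\<close>.\<close>
definition correlation :: "plane_fun \<Rightarrow> plane_fun \<Rightarrow> plane_fun" where
  "correlation f g \<omega> = complex_of_real (1 / (2 * pi)\<^sup>2) * (LINT \<beta>|lborel. f (\<omega> + \<beta>) * cnj (g \<beta>))"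

lemma integrable_correlation:
  assumes "integrable lborel f" "integrable lborel g"
  shows "integrable lborel (correlation f g)"
  using lborel_pair.integrable_snd[OF integrable_convolution_pair[of f "\<lambda>\<beta>. cnj (g \<beta>)" 1]] assms
  by (simp add: correlation_def[abs_def])

lemma inv_fourier_mult_cnj:
  assumes f: "integrable lborel f" and g: "integrable lborel g"
  shows "inv_fourier f z * cnj (inv_fourier g z) = inv_fourier (correlation f g) z"
proof -
  let ?K = "complex_of_real (1 / (2 * pi)\<^sup>2)"
  have [measurable]: "f \<in> borel_measurable borel" "g \<in> borel_measurable borel"
    using f g by (auto dest: borel_measurable_integrable)
  define F G where "F = (\<lambda>\<zeta>. f \<zeta> * cis (z \<bullet> \<zeta>))" and "G = (\<lambda>\<beta>. cnj (g \<beta> * cis (z \<bullet> \<beta>)))"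
  have iF: "integrable lborel F"
    unfolding F_def by (rule Bochner_Integration.integrable_bound[OF f]) (auto simp: norm_mult)
  have iG: "integrable lborel G"
    unfolding G_def by (rule Bochner_Integration.integrable_bound[OF g]) (auto simp: norm_mult)
  have [measurable]: "F \<in> borel_measurable borel" using iF by (auto dest: borel_measurable_integrable)
  have "inv_fourier f z * cnj (inv_fourier g z) = ?K * ?K * ((LINT \<beta>|lborel. G \<beta>) * (LINT \<zeta>|lborel. F \<zeta>))"
  proof -
    have "cnj ?K = ?K" by (rule complex_cnj_complex_of_real)
    moreover have "(LINT \<beta>|lborel. G \<beta>) = cnj (LINT \<beta>|lborel. g \<beta> * cis (z \<bullet> \<beta>))"
      unfolding G_def by (rule Bochner_Integration.integral_cnj)
    ultimately show ?thesis
      unfolding inv_fourier_def F_def complex_cnj_mult by (simp only: mult_ac)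
  qed
  also have "(LINT \<beta>|lborel. G \<beta>) * (LINT \<zeta>|lborel. F \<zeta>) = (LINT \<beta>|lborel. LINT \<omega>|lborel. F (\<omega> + \<beta>) * G \<beta>)"
  proof -
    have "(LINT \<omega>|lborel. F (\<omega> + \<beta>)) = (LINT \<zeta>|lborel. F \<zeta>)" for \<beta>
      using lborel_plane_affine[of F 1 \<beta>] by (simp add: add.commute)
    then show ?thesis by (simp add: mult.commute)
  qed
  also have "\<dots> = (LINT \<omega>|lborel. LINT \<beta>|lborel. F (\<omega> + \<beta>) * G \<beta>)"
    using lborel_pair.Fubini_integral[OF integrable_convolution_pair[OF iF iG, of 1]] by simp
  also have "?K * ?K * \<dots> = ?K * (LINT \<omega>|lborel. correlation f g \<omega> * cis (z \<bullet> \<omega>))"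
  proof -
    have "F (\<omega> + \<beta>) * G \<beta> = f (\<omega> + \<beta>) * cnj (g \<beta>) * cis (z \<bullet> \<omega>)" for \<omega> \<beta>
      by (simp add: F_def G_def inner_add_right cis_mult[symmetric] cis_cnj cis_inverse mult_ac
          flip: cis_inverse)
    then have "correlation f g \<omega> * cis (z \<bullet> \<omega>) = ?K * (LINT \<beta>|lborel. F (\<omega> + \<beta>) * G \<beta>)" for \<omega>
      unfolding correlation_def mult.assoc[of ?K] integral_mult_left_zero[symmetric] by simp
    then show ?thesis by (simp add: mult.assoc)
  qed
  finally show ?thesis unfolding inv_fourier_def .
qed

text \<open>Only one of the two factors is given as an inverse transform, so that the inversion formula is not
needed for the product.\<close>
lemma fourier_mult_inv_fourier:
  assumes f: "integrable lborel f" and h: "integrable lborel h"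
  shows "fourier (\<lambda>z. f z * inv_fourier h z) \<eta>
    = complex_of_real (1 / (2 * pi)\<^sup>2) * (LINT \<omega>|lborel. h \<omega> * fourier f (\<eta> - \<omega>))"
proof -
  let ?K = "complex_of_real (1 / (2 * pi)\<^sup>2)"
  have [measurable]: "f \<in> borel_measurable borel" "h \<in> borel_measurable borel"
    using f h by (auto dest: borel_measurable_integrable)
  have split: "cis (- (z \<bullet> (\<eta> - \<omega>))) = cis (- (z \<bullet> \<eta>)) * cis (z \<bullet> \<omega>)" for z \<omega> :: "real \<times> real"
    by (simp add: cis_mult inner_diff_right)
  have "fourier (\<lambda>z. f z * inv_fourier h z) \<eta>
     = (LINT z|lborel. LINT \<omega>|lborel. ?K * (f z * (h \<omega> * cis (- (z \<bullet> (\<eta> - \<omega>))))))"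
    unfolding fourier_def inv_fourier_def
    by (intro Bochner_Integration.integral_cong refl)
       (simp add: split mult_ac flip: integral_mult_right_zero integral_mult_left_zero)
  also have "\<dots> = (LINT \<omega>|lborel. LINT z|lborel. ?K * (f z * (h \<omega> * cis (- (z \<bullet> (\<eta> - \<omega>))))))"
  proof (rule integral_swap_bound)
    show "integrable lborel (\<lambda>z. cmod (?K * f z))" "integrable lborel (\<lambda>\<omega>. cmod (h \<omega>))"
      using f h by simp_all
  qed (simp_all add: norm_mult norm_divide split_beta')
  also have "\<dots> = (LINT \<omega>|lborel. ?K * (h \<omega> * fourier f (\<eta> - \<omega>)))"
    unfolding fourier_def
    by (intro Bochner_Integration.integral_cong refl)
       (simp add: mult_ac flip: integral_mult_right_zero)
  finally show ?thesis by simp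
qed

lemma inv_fourier_convolution:
  assumes w: "integrable lborel w" and V: "integrable lborel V"
    and [measurable]: "e \<in> borel_measurable borel" and e: "\<And>\<eta>. cmod (e \<eta>) \<le> 1"
  shows "inv_fourier (\<lambda>\<eta>. e \<eta> * (c * (LINT \<omega>|lborel. w \<omega> * V (\<eta> - \<omega>)))) z
    = c * (LINT \<omega>|lborel. w \<omega> * inv_fourier (\<lambda>\<eta>. e \<eta> * V (\<eta> - \<omega>)) z)"
proof -
  let ?K = "complex_of_real (1 / (2 * pi)\<^sup>2)"
  have [measurable]: "w \<in> borel_measurable borel" "V \<in> borel_measurable borel"
    using w V by (auto dest: borel_measurable_integrable)
  have int: "integrable (lborel \<Otimes>\<^sub>M lborel) (\<lambda>(\<omega>, \<eta>). w \<omega> * (e \<eta> * V (\<eta> - \<omega>) * cis (z \<bullet> \<eta>)))"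
  proof (rule Bochner_Integration.integrable_bound[OF integrable_convolution_pair[OF V w, of "-1"]])
    show "AE x in lborel \<Otimes>\<^sub>M lborel. cmod (case x of (\<omega>, \<eta>) \<Rightarrow> w \<omega> * (e \<eta> * V (\<eta> - \<omega>) * cis (z \<bullet> \<eta>)))
      \<le> cmod (case x of (\<beta>, \<omega>) \<Rightarrow> V (\<omega> + - 1 *\<^sub>R \<beta>) * w \<beta>)"
    proof (rule AE_I2, clarsimp simp: norm_mult)
      fix a b a' b' :: real
      show "cmod (w (a, b)) * (cmod (e (a', b')) * cmod (V (a' - a, b' - b))) \<le> cmod (V (a' - a, b' - b)) * cmod (w (a, b))"
        using mult_right_mono[OF e[of "(a', b')"], of "cmod (V (a' - a, b' - b)) * cmod (w (a, b))"]
        by (simp add: mult_ac)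
    qed
  qed measurable
  have "inv_fourier (\<lambda>\<eta>. e \<eta> * (c * (LINT \<omega>|lborel. w \<omega> * V (\<eta> - \<omega>)))) z
     = ?K * c * (LINT \<eta>|lborel. LINT \<omega>|lborel. w \<omega> * (e \<eta> * V (\<eta> - \<omega>) * cis (z \<bullet> \<eta>)))"
  proof -
    have eq: "e \<eta> * (c * (LINT \<omega>|lborel. w \<omega> * V (\<eta> - \<omega>))) * cis (z \<bullet> \<eta>)
      = c * (LINT \<omega>|lborel. w \<omega> * (e \<eta> * V (\<eta> - \<omega>) * cis (z \<bullet> \<eta>)))" for \<eta>
    proof -
      have "(LINT \<omega>|lborel. w \<omega> * (e \<eta> * V (\<eta> - \<omega>) * cis (z \<bullet> \<eta>)))
         = (LINT \<omega>|lborel. (e \<eta> * cis (z \<bullet> \<eta>)) * (w \<omega> * V (\<eta> - \<omega>)))"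
        by (simp add: mult_ac)
      then show ?thesis by simp
    qed
    show ?thesis unfolding inv_fourier_def eq integral_mult_right_zero by (simp only: mult.assoc)
  qed
  also have "(LINT \<eta>|lborel. LINT \<omega>|lborel. w \<omega> * (e \<eta> * V (\<eta> - \<omega>) * cis (z \<bullet> \<eta>)))
     = (LINT \<omega>|lborel. LINT \<eta>|lborel. w \<omega> * (e \<eta> * V (\<eta> - \<omega>) * cis (z \<bullet> \<eta>)))"
    by (rule lborel_pair.Fubini_integral[OF int])
  also have "\<dots> = (LINT \<omega>|lborel. w \<omega> * (LINT \<eta>|lborel. e \<eta> * V (\<eta> - \<omega>) * cis (z \<bullet> \<eta>)))"
    by simp
  also have "?K * c * \<dots> = c * (LINT \<omega>|lborel. ?K * (w \<omega> * (LINT \<eta>|lborel. e \<eta> * V (\<eta> - \<omega>) * cis (z \<bullet> \<eta>))))"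
    by (simp add: mult_ac)
  finally show ?thesis unfolding inv_fourier_def by (simp add: mult.left_commute)
qed

text \<open>Differentiation under the integral sign. The remainder \<open>cis \<theta> - 1 - \<i> \<theta>\<close> with \<open>\<theta> = d \<xi>\<close> is at most
\<open>2 |\<theta>|\<close>, which after division by \<open>d\<close> gives an integrable bound, and at most \<open>\<theta>\<^sup>2 / 2\<close>, which gives
the pointwise limit \<open>0\<close>.\<close>
lemma inv_fourier_has_x_derivative:
  assumes h: "integrable lborel h" and xh: "integrable lborel (\<lambda>\<zeta>. complex_of_real (fst \<zeta>) * h \<zeta>)"
  shows "((\<lambda>x. inv_fourier h (x, y)) has_vector_derivative
    inv_fourier (\<lambda>\<zeta>. \<i> * complex_of_real (fst \<zeta>) * h \<zeta>) (x, y)) (at x)"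
proof -
  let ?K = "complex_of_real (1 / (2 * pi)\<^sup>2)"
  let ?D = "inv_fourier (\<lambda>\<zeta>. \<i> * complex_of_real (fst \<zeta>) * h \<zeta>) (x, y)"
  have [measurable]: "h \<in> borel_measurable borel"
    using h by (auto dest: borel_measurable_integrable)
  define q where "q = (\<lambda>d \<zeta>. h \<zeta> * cis ((x, y) \<bullet> \<zeta>) * ((cis (d * fst \<zeta>) - 1 - \<i> * complex_of_real (d * fst \<zeta>)) / complex_of_real d))"
  have split: "cis ((x + d, y) \<bullet> \<zeta>) = cis ((x, y) \<bullet> \<zeta>) * cis (d * fst \<zeta>)" for d \<zeta>
    by (cases \<zeta>) (simp add: cis_mult algebra_simps)
  have ih: "integrable lborel (\<lambda>\<zeta>. h \<zeta> * cis (z \<bullet> \<zeta>))" for z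
    by (rule Bochner_Integration.integrable_bound[OF h]) (auto simp: norm_mult)
  have ixh: "integrable lborel (\<lambda>\<zeta>. \<i> * complex_of_real (fst \<zeta>) * h \<zeta> * cis (z \<bullet> \<zeta>))" for z
    by (rule Bochner_Integration.integrable_bound[OF xh]) (auto simp: norm_mult)
  have quot: "((inv_fourier h (x + d, y) - inv_fourier h (x, y)) - d *\<^sub>R ?D) / complex_of_real d
      = ?K * (LINT \<zeta>|lborel. q d \<zeta>)" if "d \<noteq> 0" for d
  proof -
    have "(LINT \<zeta>|lborel. q d \<zeta>) = (LINT \<zeta>|lborel. (h \<zeta> * cis ((x + d, y) \<bullet> \<zeta>) - h \<zeta> * cis ((x, y) \<bullet> \<zeta>)
        - complex_of_real d * (\<i> * complex_of_real (fst \<zeta>) * h \<zeta> * cis ((x, y) \<bullet> \<zeta>))) / complex_of_real d)"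
      unfolding q_def split by (intro Bochner_Integration.integral_cong refl) (simp add: field_simps)
    also have "\<dots> = ((LINT \<zeta>|lborel. h \<zeta> * cis ((x + d, y) \<bullet> \<zeta>)) - (LINT \<zeta>|lborel. h \<zeta> * cis ((x, y) \<bullet> \<zeta>))
        - complex_of_real d * (LINT \<zeta>|lborel. \<i> * complex_of_real (fst \<zeta>) * h \<zeta> * cis ((x, y) \<bullet> \<zeta>))) / complex_of_real d"
      by (simp only: integral_divide_zero Bochner_Integration.integral_diff ih ixh integrable_mult_right
          Bochner_Integration.integrable_diff integral_mult_right_zero)
    finally have q: "(LINT \<zeta>|lborel. q d \<zeta>) = \<dots>" .
    show ?thesis
    proof -
      have "(K * P - K * R - complex_of_real d * (K * S)) / complex_of_real d
          = K * ((P - R - complex_of_real d * S) / complex_of_real d)" for K P R S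
        by (simp add: algebra_simps diff_divide_distrib)
      then show ?thesis unfolding inv_fourier_def scaleR_conv_of_real q .
    qed
  qed
  have lim: "((\<lambda>x'. ?K * (LINT \<zeta>|lborel. q (x' - x) \<zeta>)) \<longlongrightarrow> 0) (at x)"
    unfolding tendsto_at_iff_sequentially
  proof (intro allI impI)
    fix X :: "nat \<Rightarrow> real" assume X: "\<forall>i. X i \<in> UNIV - {x}" "X \<longlonglongrightarrow> x"
    then have X0: "X i - x \<noteq> 0" for i by simp
    have Xl: "(\<lambda>i. X i - x) \<longlonglongrightarrow> 0" using X(2) by (simp add: LIM_zero)
    have "(\<lambda>i. LINT \<zeta>|lborel. q (X i - x) \<zeta>) \<longlonglongrightarrow> (LINT \<zeta> :: real \<times> real|lborel. 0)"
    proof (rule integral_dominated_convergence[where w = "\<lambda>\<zeta>. 2 * cmod (complex_of_real (fst \<zeta>) * h \<zeta>)"])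
      show "integrable lborel (\<lambda>\<zeta>. 2 * cmod (complex_of_real (fst \<zeta>) * h \<zeta>))" using xh by simp
      show "q (X i - x) \<in> borel_measurable lborel" for i unfolding q_def by measurable
      show "AE \<zeta> in lborel. cmod (q (X i - x) \<zeta>) \<le> 2 * cmod (complex_of_real (fst \<zeta>) * h \<zeta>)" for i
      proof (rule AE_I2)
        fix \<zeta> :: "real \<times> real"
        have "cmod (cis ((X i - x) * fst \<zeta>) - 1 - \<i> * complex_of_real ((X i - x) * fst \<zeta>)) \<le> 2 * \<bar>(X i - x) * fst \<zeta>\<bar>"
          using iexp_approx2[of "(X i - x) * fst \<zeta>" 1] by (simp add: cis_conv_exp algebra_simps)
        then have "cmod ((cis ((X i - x) * fst \<zeta>) - 1 - \<i> * complex_of_real ((X i - x) * fst \<zeta>)) / complex_of_real (X i - x)) \<le> 2 * \<bar>fst \<zeta>\<bar>"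
          using X0[of i] unfolding norm_divide norm_of_real by (simp add: divide_le_eq abs_mult mult_ac)
        then have "cmod (h \<zeta>) * cmod ((cis ((X i - x) * fst \<zeta>) - 1 - \<i> * complex_of_real ((X i - x) * fst \<zeta>)) / complex_of_real (X i - x)) \<le> cmod (h \<zeta>) * (2 * \<bar>fst \<zeta>\<bar>)"
          by (intro mult_left_mono) auto
        then show "cmod (q (X i - x) \<zeta>) \<le> 2 * cmod (complex_of_real (fst \<zeta>) * h \<zeta>)"
          unfolding q_def norm_mult norm_cis by (simp add: mult_ac)
      qed
      show "AE \<zeta> in lborel. (\<lambda>i. q (X i - x) \<zeta>) \<longlonglongrightarrow> 0"
      proof (rule AE_I2)
        fix \<zeta> :: "real \<times> real"
        have "cmod (q (X i - x) \<zeta>) \<le> cmod (h \<zeta>) * (fst \<zeta>)\<^sup>2 / 2 * \<bar>X i - x\<bar>" for i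
        proof -
          have "cmod (cis ((X i - x) * fst \<zeta>) - 1 - \<i> * complex_of_real ((X i - x) * fst \<zeta>)) \<le> \<bar>(X i - x) * fst \<zeta>\<bar>\<^sup>2 / 2"
            using iexp_approx1[of "(X i - x) * fst \<zeta>" 1] by (simp add: cis_conv_exp algebra_simps power2_eq_square)
          then have "cmod ((cis ((X i - x) * fst \<zeta>) - 1 - \<i> * complex_of_real ((X i - x) * fst \<zeta>)) / complex_of_real (X i - x)) \<le> \<bar>X i - x\<bar> * (fst \<zeta>)\<^sup>2 / 2"
            using X0[of i] unfolding norm_divide norm_of_real by (simp add: divide_le_eq abs_mult power2_eq_square mult_ac)
          then have "cmod (h \<zeta>) * cmod ((cis ((X i - x) * fst \<zeta>) - 1 - \<i> * complex_of_real ((X i - x) * fst \<zeta>)) / complex_of_real (X i - x)) \<le> cmod (h \<zeta>) * (\<bar>X i - x\<bar> * (fst \<zeta>)\<^sup>2 / 2)"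
            by (intro mult_left_mono) auto
          then show ?thesis unfolding q_def norm_mult norm_cis by (simp add: mult_ac)
        qed
        moreover have "(\<lambda>i. cmod (h \<zeta>) * (fst \<zeta>)\<^sup>2 / 2 * \<bar>X i - x\<bar>) \<longlonglongrightarrow> 0"
          using tendsto_mult_right_zero[OF tendsto_rabs_zero[OF Xl]] by blast
        ultimately show "(\<lambda>i. q (X i - x) \<zeta>) \<longlonglongrightarrow> 0"
          by (intro Lim_null_comparison[of "\<lambda>i. q (X i - x) \<zeta>" "\<lambda>i. cmod (h \<zeta>) * (fst \<zeta>)\<^sup>2 / 2 * \<bar>X i - x\<bar>"]
              always_eventually allI)
      qed
    qed simp
    then have "(\<lambda>i. ?K * (LINT \<zeta>|lborel. q (X i - x) \<zeta>)) \<longlonglongrightarrow> ?K * 0"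
      by (intro tendsto_mult tendsto_const) simp
    then show "((\<lambda>x'. ?K * (LINT \<zeta>|lborel. q (x' - x) \<zeta>)) \<circ> X) \<longlonglongrightarrow> 0" by (simp add: o_def)
  qed
  have "((\<lambda>x'. cmod ((inv_fourier h (x', y) - inv_fourier h (x, y)) - (x' - x) *\<^sub>R ?D) / norm (x' - x)) \<longlongrightarrow> 0) (at x)"
  proof (rule Lim_transform_eventually[OF tendsto_norm_zero[OF lim]])
    show "\<forall>\<^sub>F x' in at x. cmod (?K * (LINT \<zeta>|lborel. q (x' - x) \<zeta>))
        = cmod ((inv_fourier h (x', y) - inv_fourier h (x, y)) - (x' - x) *\<^sub>R ?D) / norm (x' - x)"
      unfolding eventually_at_filter
    proof (intro always_eventually allI impI)
      fix x' assume "x' \<noteq> x"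
      then have d: "x' - x \<noteq> 0" and e: "x + (x' - x) = x'" by simp_all
      from quot[OF d] show "cmod (?K * (LINT \<zeta>|lborel. q (x' - x) \<zeta>))
        = cmod ((inv_fourier h (x', y) - inv_fourier h (x, y)) - (x' - x) *\<^sub>R ?D) / norm (x' - x)"
        unfolding e by (simp only: norm_divide norm_of_real real_norm_def flip: quot[OF d, unfolded e])
    qed
  qed
  then show ?thesis
    unfolding has_vector_derivative_def has_derivative_iff_norm
    by (auto intro: bounded_linear_scaleR_left)
qed

lemma dx_inv_fourier:
  assumes "integrable lborel h" "integrable lborel (\<lambda>\<zeta>. complex_of_real (fst \<zeta>) * h \<zeta>)"
  shows "dx (inv_fourier h) = inv_fourier (\<lambda>\<zeta>. \<i> * complex_of_real (fst \<zeta>) * h \<zeta>)"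
    and "dx (\<lambda>w. cnj (inv_fourier h w)) z = cnj (dx (inv_fourier h) z)"
proof -
  note d = inv_fourier_has_x_derivative[OF assms]
  show "dx (inv_fourier h) = inv_fourier (\<lambda>\<zeta>. \<i> * complex_of_real (fst \<zeta>) * h \<zeta>)"
    by (rule ext) (auto simp: dx_def split_beta' vector_derivative_at[OF d])
  show "dx (\<lambda>w. cnj (inv_fourier h w)) z = cnj (dx (inv_fourier h) z)"
    by (cases z) (simp add: dx_def vector_derivative_at[OF d] vector_derivative_at[OF has_vector_derivative_cnj[OF d]])
qed

lemma inv_fourier_translate:
  assumes [measurable]: "h \<in> borel_measurable borel"
  shows "inv_fourier (\<lambda>\<eta>. h (\<eta> - \<omega>)) z = cis (z \<bullet> \<omega>) * inv_fourier h z"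
  unfolding inv_fourier_def
  using lborel_plane_affine[of "\<lambda>\<eta>. h (\<eta> - \<omega>) * cis (z \<bullet> \<eta>)" 1 \<omega>]
  by (simp add: inner_add_right cis_mult[symmetric] mult.left_commute[of _ "cis (z \<bullet> \<omega>)"]
      mult.commute[of _ "cis (z \<bullet> \<omega>)"])

lemma fourier_modulate: "fourier (\<lambda>z. cis (z \<bullet> \<omega>) * f z) \<eta> = fourier f (\<eta> - \<omega>)"
  unfolding fourier_def
  by (intro Bochner_Integration.integral_cong refl) (simp add: inner_diff_right cis_mult mult_ac)

lemma integrable_plane_decay:
  "integrable lborel (\<lambda>z :: real \<times> real. 1 / (1 + (fst z)\<^sup>2) * (1 / (1 + (snd z)\<^sup>2)))"
proof -
  have 1: "integrable lborel (\<lambda>x :: real. complex_of_real (1 / (1 + x\<^sup>2)))"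
    using integrable_inverse_1_plus_square
    by (simp add: set_integrable_def einterval_eq_UNIV inverse_eq_divide complex_of_real_integrable_eq del: of_real_divide)
  from integrable_norm[OF plane_integral_tensor(1)[OF 1 1]] show ?thesis
    by (simp only: norm_mult norm_of_real) (simp add: abs_of_nonneg add_nonneg_nonneg)
qed

lemma integrable_poly_gaussian:
  assumes a: "a > 0"
  shows "integrable lborel (\<lambda>z :: real \<times> real. (1 + norm z) ^ k * exp (- a * (norm z)\<^sup>2))"
proof (rule Bochner_Integration.integrable_bound)
  let ?C = "exp ((real k)\<^sup>2 / (4 * (a / 2)))"
  show "integrable lborel (\<lambda>z :: real \<times> real. ?C * exp (- (a / 2) * (norm z)\<^sup>2))"
    using integrable_plane_gaussian[of "a / 2"] a by simp
  show "AE z :: real \<times> real in lborel. norm ((1 + norm z) ^ k * exp (- a * (norm z)\<^sup>2)) \<le> norm (?C * exp (- (a / 2) * (norm z)\<^sup>2))"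
  proof (rule AE_I2)
    fix z :: "real \<times> real"
    have "(1 + norm z) ^ k * exp (- a * (norm z)\<^sup>2) \<le> ?C * exp (a / 2 * (norm z)\<^sup>2) * exp (- a * (norm z)\<^sup>2)"
      using a by (intro mult_right_mono power_le_exp_square) auto
    also have "\<dots> = ?C * exp (- (a / 2) * (norm z)\<^sup>2)"
      by (simp only: mult.assoc exp_add[symmetric]) (simp add: algebra_simps)
    finally show "norm ((1 + norm z) ^ k * exp (- a * (norm z)\<^sup>2)) \<le> norm (?C * exp (- (a / 2) * (norm z)\<^sup>2))"
      by (simp add: abs_mult)
  qed
qed measurable

lemma integrable_sqrt_singularity_gaussian:
  assumes a: "a > 0"
  shows "integrable lborel (\<lambda>x :: real. \<bar>x\<bar> powr (- 1/2) * exp (- a * x\<^sup>2))"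
proof -
  have 0: "integrable lborel (\<lambda>x :: real. exp (- a * x\<^sup>2))"
  proof -
    have "integrable lborel (\<lambda>x :: real. norm (complex_of_real (exp (- x\<^sup>2 / 2))))"
      by (rule integrable_norm[OF gaussian_fourier_line(1)])
    then have "integrable lborel (\<lambda>x :: real. exp (- x\<^sup>2 / 2))" by (simp only: norm_of_real abs_exp_cancel)
    from lborel_integrable_real_affine[OF this, of "sqrt (2 * a)" 0] a
    show ?thesis by (simp add: power_mult_distrib)
  qed
  have "(\<lambda>x :: real. x powr (- 1/2)) integrable_on {0..1}"
    using has_integral_powr_from_0[of "- 1/2" 1] by (auto simp: integrable_on_def)
  then have "(\<lambda>x :: real. x powr (- 1/2)) absolutely_integrable_on {0..1}"
    by (rule nonnegative_absolutely_integrable_1) auto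
  then have 1: "integrable lborel (\<lambda>x :: real. indicator {0..1} x * x powr (- 1/2))"
    by (simp add: set_integrable_def integrable_completion)
  have 2: "integrable lborel (\<lambda>x :: real. indicator {0..1} (- x) * (- x) powr (- 1/2))"
    using lborel_integrable_real_affine[OF 1, of "-1" 0] by simp
  show ?thesis
  proof (rule Bochner_Integration.integrable_bound[OF Bochner_Integration.integrable_add[OF Bochner_Integration.integrable_add[OF 1 2] 0]], measurable, rule AE_I2)
    fix x :: real
    have "\<bar>x\<bar> powr (- 1/2) * exp (- a * x\<^sup>2) \<le> indicator {0..1} x * x powr (- 1/2) + indicator {0..1} (- x) * (- x) powr (- 1/2) + exp (- a * x\<^sup>2)"
    proof (cases "\<bar>x\<bar> \<le> 1")
      case True
      have "\<bar>x\<bar> powr (- 1/2) * exp (- a * x\<^sup>2) \<le> \<bar>x\<bar> powr (- 1/2)"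
        using a by (intro mult_left_le) auto
      also have "\<dots> \<le> indicator {0..1} x * x powr (- 1/2) + indicator {0..1} (- x) * (- x) powr (- 1/2)"
        using True by (cases "x \<ge> 0") (auto simp: indicator_def abs_if)
      finally show ?thesis by (simp add: add_increasing2)
    next
      case False
      then have "\<bar>x\<bar> powr (- 1/2) \<le> 1 powr (-1/2)" by (intro powr_mono2') auto
      then have "\<bar>x\<bar> powr (- 1/2) * exp (- a * x\<^sup>2) \<le> exp (- a * x\<^sup>2)"
        by (intro mult_left_le_one_le) auto
      moreover have "0 \<le> indicator {0..1} x * x powr (- 1/2)" "0 \<le> indicator {0..1} (- x) * (- x) powr (- 1/2)"
        by simp_all
      ultimately show ?thesis by linarith
    qed
    then show "norm (\<bar>x\<bar> powr (- 1/2) * exp (- a * x\<^sup>2)) \<le> norm (indicator {0..1} x * x powr (- 1/2) + indicator {0..1} (- x) * (- x) powr (- 1/2) + exp (- a * x\<^sup>2))"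
      by simp
  qed
qed

text \<open>By the inequality of arithmetic and geometric means, \<open>1 / |z| \<le> |x|\<^sup>-\<^sup>1\<^sup>/\<^sup>2 |y|\<^sup>-\<^sup>1\<^sup>/\<^sup>2\<close>, a product of
integrable singularities.\<close>
lemma integrable_inverse_norm_gaussian:
  assumes a: "a > 0"
  shows "integrable lborel (\<lambda>z :: real \<times> real. inverse (norm z) * exp (- a * (norm z)\<^sup>2))"
proof -
  let ?f = "\<lambda>x :: real. complex_of_real (\<bar>x\<bar> powr (- 1/2) * exp (- a * x\<^sup>2))"
  have f: "integrable lborel ?f"
    unfolding complex_of_real_integrable_eq by (rule integrable_sqrt_singularity_gaussian[OF a])
  have [measurable]: "(\<lambda>z :: real \<times> real. inverse (norm z) * exp (- a * (norm z)\<^sup>2)) \<in> borel_measurable borel" by measurable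
  have ae: "AE z :: real \<times> real in lborel. fst z \<noteq> 0 \<and> snd z \<noteq> 0"
  proof -
    have "AE z in lborel \<Otimes>\<^sub>M lborel. fst z \<noteq> (0::real) \<and> snd z \<noteq> (0::real)"
    proof (subst lborel_pair.AE_pair_iff[symmetric])
      show "AE x in lborel. AE y in lborel. x \<noteq> (0::real) \<and> y \<noteq> (0::real)"
        using AE_lborel_singleton[of "0::real"]
      proof eventually_elim
        case (elim x)
        show ?case using AE_lborel_singleton[of "0::real"] by eventually_elim (use elim in simp)
      qed
    qed measurable
    then show ?thesis unfolding lborel_prod .
  qed
  show ?thesis
  proof (rule Bochner_Integration.integrable_bound[OF integrable_norm[OF plane_integral_tensor(1)[OF f f]]])
    show "AE z in lborel. norm (inverse (norm z) * exp (- a * (norm z)\<^sup>2)) \<le> norm (norm (?f (fst z) * ?f (snd z)))"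
      using ae
    proof eventually_elim
      case (elim z)
      have "\<bar>fst z\<bar> * \<bar>snd z\<bar> \<le> (norm z)\<^sup>2"
      proof -
        have "0 \<le> (\<bar>fst z\<bar> - \<bar>snd z\<bar>)\<^sup>2" by simp
        then have "2 * (\<bar>fst z\<bar> * \<bar>snd z\<bar>) \<le> (norm z)\<^sup>2" by (simp add: norm_plane_sq power2_diff)
        moreover have "0 \<le> \<bar>fst z\<bar> * \<bar>snd z\<bar>" by simp
        ultimately show ?thesis by linarith
      qed
      then have "((norm z)\<^sup>2) powr (- 1/2) \<le> (\<bar>fst z\<bar> * \<bar>snd z\<bar>) powr (- 1/2)"
        using elim by (intro powr_mono2') (auto simp: zero_less_mult_iff)
      moreover have "((norm z)\<^sup>2) powr (- 1/2) = inverse (norm z)"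
        using powr_minus[of "(norm z)\<^sup>2" "1/2"] by (simp add: powr_half_sqrt)
      ultimately have "inverse (norm z) \<le> \<bar>fst z\<bar> powr (- 1/2) * \<bar>snd z\<bar> powr (- 1/2)"
        by (simp add: powr_mult)
      then have "inverse (norm z) * exp (- a * (norm z)\<^sup>2) \<le> (\<bar>fst z\<bar> powr (- 1/2) * \<bar>snd z\<bar> powr (- 1/2)) * exp (- a * (norm z)\<^sup>2)"
        by (intro mult_right_mono) auto
      moreover have "exp (- a * (norm z)\<^sup>2) = exp (- a * (fst z)\<^sup>2) * exp (- a * (snd z)\<^sup>2)"
        by (simp add: norm_plane_sq exp_add[symmetric] algebra_simps)
      ultimately have "inverse (norm z) * exp (- a * (norm z)\<^sup>2)
          \<le> (\<bar>fst z\<bar> powr (- 1/2) * exp (- a * (fst z)\<^sup>2)) * (\<bar>snd z\<bar> powr (- 1/2) * exp (- a * (snd z)\<^sup>2))"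
        by (simp only: mult_ac)
      then show ?case unfolding norm_mult norm_of_real by simp
    qed
  qed simp
qed

section \<open>Wave packets\<close>

definition dispersion :: "real \<times> real \<Rightarrow> real" where
  "dispersion \<zeta> = fst \<zeta> ^ 3 / 16 - (fst \<zeta>)\<^sup>2 / 8 + fst \<zeta> / 2 + (snd \<zeta>)\<^sup>2 / 4 - 3/8 * fst \<zeta> * (snd \<zeta>)\<^sup>2"

definition packet :: "real \<Rightarrow> real \<times> real \<Rightarrow> real" where
  "packet N \<zeta> = exp (- (norm (\<zeta> - (N, 0)))\<^sup>2 / 2)"

text \<open>The Fourier transform at time \<open>t\<close> of the linear solution with the data \<open>datum N\<close>, see
\<open>picard1_datum\<close> and \<open>fourier_inv_fourier_wave\<close>.\<close>
definition wave :: "real \<Rightarrow> real \<Rightarrow> plane_fun" where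
  "wave N t \<zeta> = cis (- (t * dispersion \<zeta>)) * complex_of_real (packet N \<zeta>)"

definition datum :: "real \<Rightarrow> plane_fun" where
  "datum N z = complex_of_real (1 / (2 * pi)) * cis (N * fst z) * complex_of_real (exp (- (norm z)\<^sup>2 / 2))"

lemma dysthe_symbol_dispersion: "dysthe_symbol \<zeta> = \<i> * complex_of_real (dispersion \<zeta>)"
  by (cases \<zeta>) (simp add: dysthe_symbol_closed dispersion_def)

lemma dysthe_flow_eq: "dysthe_flow t f = inv_fourier (\<lambda>\<zeta>. cis (- (t * dispersion \<zeta>)) * fourier f \<zeta>)"
  by (simp add: dysthe_flow_def multiplier_def dysthe_symbol_dispersion cis_conv_exp mult_ac)

lemma dispersion_measurable[measurable]: "dispersion \<in> borel_measurable borel"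
  unfolding dispersion_def[abs_def] by measurable

lemma packet_measurable[measurable]: "packet N \<in> borel_measurable borel"
  unfolding packet_def[abs_def] by measurable

lemma wave_measurable[measurable]:
  assumes [measurable]: "f \<in> borel_measurable M" "g \<in> borel_measurable M"
  shows "(\<lambda>x. wave N (f x) (g x)) \<in> borel_measurable M"
  unfolding wave_def by measurable

lemma packet_pos: "packet N \<zeta> > 0" and packet_le_1: "packet N \<zeta> \<le> 1"
  by (auto simp: packet_def)

lemma norm_wave: "cmod (wave N t \<zeta>) = packet N \<zeta>"
  using packet_pos[of N \<zeta>] by (simp add: wave_def norm_mult)

lemma fourier_datum: "fourier (datum N) \<zeta> = complex_of_real (packet N \<zeta>)"
proof -
  have "fourier (datum N) \<zeta> = complex_of_real (1 / (2 * pi)) *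
      (LINT z|lborel. complex_of_real (exp (- (norm z)\<^sup>2 / 2)) * cis (- (z \<bullet> (\<zeta> - (N, 0)))))"
    unfolding fourier_def integral_mult_right_zero[symmetric] datum_def
    by (intro Bochner_Integration.integral_cong refl)
       (simp add: inner_diff_right cis_mult inner_prod_def algebra_simps)
  then show ?thesis unfolding gaussian_fourier_plane by (simp add: packet_def)
qed

lemma picard1_datum: "picard1 (datum N) t = inv_fourier (wave N t)"
  by (simp add: picard1_def dysthe_flow_eq fourier_datum wave_def[abs_def])

lemma norm_sq_param_poly: "param_poly \<kappa> (\<lambda>p \<zeta>. complex_of_real ((norm \<zeta>)\<^sup>2))"
  unfolding norm_plane_sq of_real_add of_real_power
  by (intro param_poly.add param_poly_power param_poly_fst param_poly_snd)

text \<open>The datum is a Gaussian family with trivial parameter.\<close>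
lemma schwartz_datum: "schwartz (datum N)"
proof -
  let ?Q = "\<lambda>(p :: unit) z :: real \<times> real. (\<i> * complex_of_real N) * complex_of_real (fst z) - (1/2) * complex_of_real ((norm z)\<^sup>2)"
  interpret gaussian_family "\<lambda>_ :: unit. 1" ?Q 1
  proof
    show "param_poly (\<lambda>_. 1) ?Q"
      by (intro param_poly_diff param_poly.mult param_poly_const param_poly_fst norm_sq_param_poly)
  qed (simp_all add: norm_exp_eq_Re)
  have "member (\<lambda>p z. complex_of_real (1 / (2 * pi)) * exp (?Q p z))"
    unfolding member_def by (intro exI[of _ "\<lambda>p z. complex_of_real (1 / (2 * pi))"]) (simp add: param_poly_const)
  moreover have "datum N = (\<lambda>z. complex_of_real (1 / (2 * pi)) * exp (?Q () z))"
    by (rule ext) (simp add: datum_def cis_conv_exp mult_exp_exp exp_of_real[symmetric] mult_ac del: exp_of_real)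
  ultimately show ?thesis using member_schwartz by simp
qed

text \<open>The flow over the time \<open>a\<close> multiplies the translate \<open>wave N b (\<eta> - \<omega>)\<close> of a wave packet by
\<open>cis (- a dispersion \<eta>)\<close>. The twisted wave is this product as a function of \<open>\<eta> - \<omega>\<close>. After this
translation the Gaussian factor is independent of the parameters \<open>(a, b, \<omega>)\<close>, which now enter
polynomially only.\<close>
definition twisted_exponent :: "real \<Rightarrow> real \<times> real \<times> (real \<times> real) \<Rightarrow> plane_fun" where
  "twisted_exponent N = (\<lambda>(a, b, \<omega>) \<eta>. - \<i> * complex_of_real a * complex_of_real (dispersion (\<eta> + \<omega>))
     - \<i> * complex_of_real b * complex_of_real (dispersion \<eta>) - (1/2) * complex_of_real ((norm (\<eta> - (N, 0)))\<^sup>2))"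

definition twist_weight :: "real \<times> real \<times> (real \<times> real) \<Rightarrow> real" where
  "twist_weight = (\<lambda>(a, b, \<omega>). 1 + \<bar>a\<bar> + \<bar>b\<bar> + norm \<omega>)"

definition twisted_wave :: "real \<Rightarrow> real \<times> real \<times> (real \<times> real) \<Rightarrow> plane_fun" where
  "twisted_wave N p \<eta> = exp (twisted_exponent N p \<eta>)"

lemma twisted_wave_eq:
  "twisted_wave N (a, b, \<omega>) \<eta> = cis (- (a * dispersion (\<eta> + \<omega>))) * wave N b \<eta>"
proof -
  have "twisted_exponent N (a, b, \<omega>) \<eta> = \<i> * complex_of_real (- (a * dispersion (\<eta> + \<omega>)))
      + (\<i> * complex_of_real (- (b * dispersion \<eta>)) + complex_of_real (- (norm (\<eta> - (N, 0)))\<^sup>2 / 2))"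
    by (simp add: twisted_exponent_def algebra_simps)
  then show ?thesis
    by (simp only: twisted_wave_def exp_add cis_conv_exp wave_def packet_def exp_of_real)
qed

lemma norm_twisted_wave: "cmod (twisted_wave N p \<eta>) = packet N \<eta>"
  by (cases p) (simp add: twisted_wave_eq norm_mult norm_wave)

lemma param_poly_parameter:
  "(\<And>p. \<bar>a p\<bar> \<le> \<kappa> p) \<Longrightarrow> param_poly \<kappa> (\<lambda>p \<zeta>. complex_of_real (a p))"
  by (rule param_poly.coeff[of _ 1 _ 1]) simp

lemma abs_fst_le_norm: "\<bar>fst \<zeta>\<bar> \<le> norm \<zeta>" and abs_snd_le_norm: "\<bar>snd \<zeta>\<bar> \<le> norm \<zeta>" for \<zeta> :: "real \<times> real"
  using norm_fst_le[of "fst \<zeta>" "snd \<zeta>"] norm_snd_le[of "snd \<zeta>" "fst \<zeta>"] by simp_all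

text \<open>Moving the centre of the Gaussian to the origin costs a constant that depends on \<open>N\<close>; this is
harmless, since the decay estimates are used with \<open>N\<close> fixed.\<close>
lemma packet_le: "packet N \<zeta> \<le> exp (N\<^sup>2 / 2) * exp (- (norm \<zeta>)\<^sup>2 / 4)"
proof -
  have "0 \<le> (norm (\<zeta> - 2 *\<^sub>R (N, 0)))\<^sup>2" by simp
  then have "(norm \<zeta>)\<^sup>2 \<le> 2 * (norm (\<zeta> - (N, 0)))\<^sup>2 + 2 * N\<^sup>2"
    unfolding norm_plane_sq by (simp add: power2_eq_square algebra_simps)
  then show ?thesis by (simp add: packet_def mult_exp_exp)
qed

interpretation twisted: gaussian_family twist_weight "twisted_exponent N" "exp (N\<^sup>2 / 2)" for N
proof
  fix p show "1 \<le> twist_weight p" by (simp add: twist_weight_def split_beta')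
next
  have a: "param_poly twist_weight (\<lambda>p \<zeta>. complex_of_real (fst p))"
    and b: "param_poly twist_weight (\<lambda>p \<zeta>. complex_of_real (fst (snd p)))"
    and \<omega>1: "param_poly twist_weight (\<lambda>p \<zeta>. complex_of_real (fst (snd (snd p))))"
    and \<omega>2: "param_poly twist_weight (\<lambda>p \<zeta>. complex_of_real (snd (snd (snd p))))"
    by (rule param_poly_parameter, simp add: twist_weight_def split_beta' add_increasing add_increasing2 abs_fst_le_norm abs_snd_le_norm)+
  have d: "param_poly twist_weight (\<lambda>p \<zeta>. X p \<zeta> ^ 3 / 16 - (X p \<zeta>)\<^sup>2 / 8 + X p \<zeta> / 2 + (Y p \<zeta>)\<^sup>2 / 4 - 3/8 * X p \<zeta> * (Y p \<zeta>)\<^sup>2)"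
    if "param_poly twist_weight X" "param_poly twist_weight Y" for X Y
    unfolding divide_inverse using that
    by (intro param_poly.add param_poly_diff param_poly.mult param_poly_power param_poly_const)
  have disp: "complex_of_real (dispersion \<zeta>) = complex_of_real (fst \<zeta>) ^ 3 / 16 - (complex_of_real (fst \<zeta>))\<^sup>2 / 8 + complex_of_real (fst \<zeta>) / 2
     + (complex_of_real (snd \<zeta>))\<^sup>2 / 4 - 3/8 * complex_of_real (fst \<zeta>) * (complex_of_real (snd \<zeta>))\<^sup>2" for \<zeta>
    by (simp add: dispersion_def)
  show "param_poly twist_weight (twisted_exponent N)"
    unfolding twisted_exponent_def split_beta' disp norm_plane_sq fst_add snd_add fst_diff snd_diff fst_conv snd_conv of_real_add of_real_diff of_real_power
    by (intro param_poly_diff param_poly.add param_poly.mult param_poly_power d a b \<omega>1 \<omega>2 param_poly_const param_poly_fst param_poly_snd)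
next
  fix p \<zeta>
  show "cmod (exp (twisted_exponent N p \<zeta>)) \<le> exp (N\<^sup>2 / 2) * exp (- (norm \<zeta>)\<^sup>2 / 4)"
    using packet_le[of N \<zeta>] norm_twisted_wave[of N p \<zeta>] unfolding twisted_wave_def by simp
qed

lemma twisted_wave_member: "twisted.member N (twisted_wave N)"
  unfolding twisted.member_def twisted_wave_def
  by (intro exI[of _ "\<lambda>p \<zeta>. 1"]) (simp add: param_poly_const)

lemma twisted_wave_decay:
  obtains C k where "C \<ge> 0" "\<And>p z. cmod (inv_fourier (twisted_wave N p) z)
    \<le> C * twist_weight p ^ k * (1 / (1 + (fst z)\<^sup>2) * (1 / (1 + (snd z)\<^sup>2)))"
  using twisted.member_inv_fourier_decay[OF twisted_wave_member] by metis

lemma twisted_wave_integrable: "integrable lborel (twisted_wave N p)"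
  by (rule twisted.member_integrable[OF twisted_wave_member])

lemma twisted_wave_inv_integrable: "integrable lborel (inv_fourier (twisted_wave N p))"
proof -
  obtain C k where C: "C \<ge> 0" "\<And>p z. cmod (inv_fourier (twisted_wave N p) z)
    \<le> C * twist_weight p ^ k * (1 / (1 + (fst z)\<^sup>2) * (1 / (1 + (snd z)\<^sup>2)))" using twisted_wave_decay by blast
  show ?thesis
  proof (rule Bochner_Integration.integrable_bound[OF integrable_mult_right[OF integrable_plane_decay, of "C * twist_weight p ^ k"]])
    show "inv_fourier (twisted_wave N p) \<in> borel_measurable lborel"
      using inv_fourier_measurable[of "twisted_wave N p"] twisted_wave_integrable[of N p]
      by (auto dest: borel_measurable_integrable)
    show "AE z in lborel. cmod (inv_fourier (twisted_wave N p) z) \<le> norm (C * twist_weight p ^ k * (1 / (1 + (fst z)\<^sup>2) * (1 / (1 + (snd z)\<^sup>2))))"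
      using C(2) by (intro AE_I2) (metis abs_ge_self order_trans real_norm_def)
  qed
qed

lemma fourier_inv_twisted_wave: "fourier (inv_fourier (twisted_wave N p)) = twisted_wave N p"
  by (rule ext, rule fourier_inv_fourier[OF twisted_wave_integrable, of _ _ 1])
     (simp_all add: norm_twisted_wave packet_le_1 twisted.member_continuous[OF twisted_wave_member] twisted_wave_inv_integrable)

lemma wave_eq_twisted: "wave N t = twisted_wave N (0, t, 0)"
  by (rule ext) (simp add: twisted_wave_eq)

lemma wave_integrable: "integrable lborel (wave N t)"
  and inv_fourier_wave_integrable: "integrable lborel (inv_fourier (wave N t))"
  and fourier_inv_fourier_wave: "fourier (inv_fourier (wave N t)) = wave N t"
  unfolding wave_eq_twisted by (rule twisted_wave_integrable twisted_wave_inv_integrable fourier_inv_twisted_wave)+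

section \<open>The nonlinearity of a wave packet\<close>

text \<open>The symbol of the form that is left of \<open>dysthe_N\<close> when one undifferentiated factor \<open>u\<^sub>1\<close> is split
off: \<open>\<omega> + \<beta>\<close> and \<open>\<beta>\<close> are the frequencies of the other factor and of the conjugated one, and \<open>\<omega>\<close> is
the frequency of their product.\<close>
definition interaction :: "real \<times> real \<Rightarrow> real \<times> real \<Rightarrow> complex" where
  "interaction \<omega> \<beta> = - (\<i>/2) - (3/2) * (\<i> * complex_of_real (fst (\<omega> + \<beta>))) + (1/4) * (\<i> * complex_of_real (fst \<beta>))
     - (\<i>/2) * complex_of_real ((fst \<omega>)\<^sup>2 * inverse (norm \<omega>))"

text \<open>The Fourier transform of the function by which \<open>u\<^sub>1(t)\<close> is multiplied in \<open>dysthe_N\<close>, see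
\<open>dysthe_N_picard1_datum\<close>.\<close>
definition potential :: "real \<Rightarrow> real \<Rightarrow> plane_fun" where
  "potential N t \<omega> = complex_of_real (1 / (2 * pi)\<^sup>2)
     * (LINT \<beta>|lborel. interaction \<omega> \<beta> * (wave N t (\<omega> + \<beta>) * cnj (wave N t \<beta>)))"

lemma interaction_measurable[measurable]:
  assumes [measurable]: "f \<in> borel_measurable M" "g \<in> borel_measurable M"
  shows "(\<lambda>x. interaction (f x) (g x)) \<in> borel_measurable M"
  unfolding interaction_def by measurable

lemma potential_measurable[measurable]:
  assumes [measurable]: "f \<in> borel_measurable M" "g \<in> borel_measurable M"
  shows "(\<lambda>x. potential N (f x) (g x)) \<in> borel_measurable M"
proof -
  have "(\<lambda>x. complex_of_real (1 / (2 * pi)\<^sup>2)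
     * (LINT \<beta>|lborel. interaction (snd x) \<beta> * (wave N (fst x) (snd x + \<beta>) * cnj (wave N (fst x) \<beta>)))) \<in> borel_measurable (borel \<Otimes>\<^sub>M borel)"
    by measurable
  then have [measurable]: "(\<lambda>x. potential N (fst x) (snd x)) \<in> borel_measurable (borel \<Otimes>\<^sub>M borel)"
    by (simp add: potential_def)
  have "(\<lambda>x. potential N (fst (f x, g x)) (snd (f x, g x))) \<in> borel_measurable M"
    by measurable
  then show ?thesis by simp
qed

text \<open>The product of two packets decays in the difference \<open>\<omega>\<close> of their frequencies, with a constant that
does not depend on \<open>N\<close>.\<close>
lemma packet_product:
  "packet N (\<omega> + \<beta>) * packet N \<beta> \<le> exp (- (1/8) * (norm \<omega>)\<^sup>2) * exp (- (1/4) * (norm (\<beta> - (N, 0)))\<^sup>2)"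
proof -
  \<comment> \<open>parallelogram law for \<open>\<omega> + \<beta> - (N, 0)\<close> and \<open>\<beta> - (N, 0)\<close>, whose difference is \<open>\<omega>\<close>\<close>
  have "0 \<le> (norm (\<omega> + 2 *\<^sub>R (\<beta> - (N, 0))))\<^sup>2" "0 \<le> (norm (\<omega> + \<beta> - (N, 0)))\<^sup>2" by simp_all
  then have "(norm \<omega>)\<^sup>2 / 8 + (norm (\<beta> - (N, 0)))\<^sup>2 / 4 \<le> (norm (\<omega> + \<beta> - (N, 0)))\<^sup>2 / 2 + (norm (\<beta> - (N, 0)))\<^sup>2 / 2"
    unfolding norm_plane_sq by (simp add: power2_eq_square field_simps)
  then show ?thesis by (simp add: packet_def mult_exp_exp)
qed

text \<open>The symbol of the nonlocal term is bounded by the frequency difference, hence is of size \<open>1\<close> in the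
interaction of packets.\<close>
lemma abs_sq_over_norm_le: "\<bar>(fst \<omega>)\<^sup>2 * inverse (norm \<omega>)\<bar> \<le> norm \<omega>" for \<omega> :: "real \<times> real"
proof (cases "\<omega> = 0")
  case False
  have "(fst \<omega>)\<^sup>2 \<le> norm \<omega> * norm \<omega>" using norm_plane_sq[of \<omega>] by (simp add: power2_eq_square)
  with False show ?thesis by (simp add: divide_inverse[symmetric] divide_le_eq)
qed simp

lemma interaction_bound:
  "cmod (interaction \<omega> \<beta>) \<le> (2 + 2 * \<bar>N\<bar>) * ((1 + norm \<omega>) * (1 + norm (\<beta> - (N, 0))))"
proof -
  let ?b = "norm (\<beta> - (N, 0))"
  have b: "\<bar>fst \<beta>\<bar> \<le> \<bar>N\<bar> + ?b" using abs_fst_le_norm[of "\<beta> - (N, 0)"] by simp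
  have \<omega>: "\<bar>fst \<omega>\<bar> \<le> norm \<omega>" by (rule abs_fst_le_norm)
  have "cmod (interaction \<omega> \<beta>) \<le> cmod (- (\<i>/2)) + cmod ((3/2) * (\<i> * complex_of_real (fst (\<omega> + \<beta>)))) + cmod ((1/4) * (\<i> * complex_of_real (fst \<beta>)))
     + cmod ((\<i>/2) * complex_of_real ((fst \<omega>)\<^sup>2 * inverse (norm \<omega>)))"
    unfolding interaction_def
    by (intro norm_triangle_le_diff norm_triangle_le add_mono order_refl)
  also have "\<dots> = 1/2 + 3/2 * \<bar>fst \<omega> + fst \<beta>\<bar> + 1/4 * \<bar>fst \<beta>\<bar> + 1/2 * \<bar>(fst \<omega>)\<^sup>2 * inverse (norm \<omega>)\<bar>"
    by (simp only: norm_minus_cancel norm_mult norm_divide norm_ii norm_of_real fst_add norm_numeral norm_one)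
  also have "\<dots> \<le> 1/2 + 2 * norm \<omega> + 7/4 * (\<bar>N\<bar> + ?b)"
  proof -
    have "1/2 + 3/2 * p + 1/4 * r + 1/2 * s \<le> 1/2 + 2 * n + 7/4 * M"
      if "p \<le> q + r" "q \<le> n" "r \<le> M" "s \<le> n" for p q r s n M :: real
      using that by linarith
    from this[OF abs_triangle_ineq \<omega> b abs_sq_over_norm_le] show ?thesis .
  qed
  also have "\<dots> \<le> (2 + 2 * \<bar>N\<bar>) * ((1 + norm \<omega>) * (1 + ?b))"
  proof -
    have "1/2 + 2 * n + 7/4 * (M + b) \<le> (2 + 2 * M) * ((1 + n) * (1 + b))"
      if "n \<ge> 0" "M \<ge> 0" "b \<ge> 0" for n M b :: real
    proof -
      have "(2 + 2 * M) * ((1 + n) * (1 + b)) - (1/2 + 2 * n + 7/4 * (M + b))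
          = 3/2 + M/4 + b/4 + 2 * (n * b) + 2 * (M * n) + 2 * (M * b) + 2 * (M * (n * b))"
        by (simp add: field_simps)
      also have "\<dots> \<ge> 0"
        by (intro add_nonneg_nonneg mult_nonneg_nonneg) (use that in simp_all)
      finally show ?thesis by (simp only: diff_ge_0_iff_ge)
    qed
    then show ?thesis by simp
  qed
  finally show ?thesis .
qed

lemma integrable_poly_gaussian_shift:
  assumes "a > 0"
  shows "integrable lborel (\<lambda>z :: real \<times> real. (1 + norm (z - c)) ^ k * exp (- a * (norm (z - c))\<^sup>2))"
  using integrable_plane_affine[OF integrable_poly_gaussian[OF assms, of k], of 1 "- c"] by simp

definition carrier_gaussian :: "real \<Rightarrow> real \<times> real \<Rightarrow> real" where
  "carrier_gaussian N \<beta> = (1 + norm (\<beta> - (N, 0))) * exp (- (1/4) * (norm (\<beta> - (N, 0)))\<^sup>2)"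

lemma carrier_gaussian_integrable: "integrable lborel (carrier_gaussian N)"
  unfolding carrier_gaussian_def[abs_def] using integrable_poly_gaussian_shift[of "1/4" "(N, 0)" 1] by simp

lemma pair_product_bound:
  assumes m: "cmod m \<le> C * ((1 + norm \<omega>) * (1 + norm (\<beta> - (N, 0))))"
  shows "cmod (m * (wave N t (\<omega> + \<beta>) * cnj (wave N t \<beta>)))
    \<le> (C * ((1 + norm \<omega>) * exp (- (1/8) * (norm \<omega>)\<^sup>2))) * carrier_gaussian N \<beta>"
proof -
  have "cmod (m * (wave N t (\<omega> + \<beta>) * cnj (wave N t \<beta>))) = cmod m * (packet N (\<omega> + \<beta>) * packet N \<beta>)"
    by (simp add: norm_mult norm_wave)
  also have "\<dots> \<le> (C * ((1 + norm \<omega>) * (1 + norm (\<beta> - (N, 0))))) * (exp (- (1/8) * (norm \<omega>)\<^sup>2) * exp (- (1/4) * (norm (\<beta> - (N, 0)))\<^sup>2))"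
    using packet_pos[of N] less_imp_le
    by (intro mult_mono m packet_product order_trans[OF norm_ge_zero m]) (simp add: less_imp_le)
  finally show ?thesis by (simp add: carrier_gaussian_def mult_ac)
qed

lemma pair_product_integrable:
  assumes [measurable]: "m \<in> borel_measurable borel"
    and m: "\<And>\<beta>. cmod (m \<beta>) \<le> C * ((1 + norm \<omega>) * (1 + norm (\<beta> - (N, 0))))"
  shows "integrable lborel (\<lambda>\<beta>. m \<beta> * (wave N t (\<omega> + \<beta>) * cnj (wave N t \<beta>)))"
proof (rule Bochner_Integration.integrable_bound)
  let ?c = "C * ((1 + norm \<omega>) * exp (- (1/8) * (norm \<omega>)\<^sup>2))"
  show "integrable lborel (\<lambda>\<beta>. ?c * carrier_gaussian N \<beta>)" by (rule integrable_mult_right[OF carrier_gaussian_integrable])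
  show "AE \<beta> in lborel. cmod (m \<beta> * (wave N t (\<omega> + \<beta>) * cnj (wave N t \<beta>))) \<le> norm (?c * carrier_gaussian N \<beta>)"
    unfolding real_norm_def by (intro AE_I2 order_trans[OF pair_product_bound[OF m] abs_ge_self])
qed measurable

lemma pair_product_integral_bound:
  assumes [measurable]: "m \<in> borel_measurable borel"
    and m: "\<And>\<beta>. cmod (m \<beta>) \<le> C * ((1 + norm \<omega>) * (1 + norm (\<beta> - (N, 0))))"
  shows "cmod (complex_of_real (1 / (2 * pi)\<^sup>2) * (LINT \<beta>|lborel. m \<beta> * (wave N t (\<omega> + \<beta>) * cnj (wave N t \<beta>))))
    \<le> (1 / (2 * pi)\<^sup>2 * (C * (LINT \<beta>|lborel. carrier_gaussian N \<beta>))) * ((1 + norm \<omega>) * exp (- (1/8) * (norm \<omega>)\<^sup>2))"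
proof -
  have "cmod (LINT \<beta>|lborel. m \<beta> * (wave N t (\<omega> + \<beta>) * cnj (wave N t \<beta>)))
      \<le> (LINT \<beta>|lborel. (C * ((1 + norm \<omega>) * exp (- (1/8) * (norm \<omega>)\<^sup>2))) * carrier_gaussian N \<beta>)"
    by (rule order_trans[OF integral_norm_bound integral_mono])
       (use pair_product_integrable[OF assms] carrier_gaussian_integrable pair_product_bound[OF m] in \<open>auto intro: integrable_norm\<close>)
  then have "1 / (2 * pi)\<^sup>2 * cmod (LINT \<beta>|lborel. m \<beta> * (wave N t (\<omega> + \<beta>) * cnj (wave N t \<beta>)))
      \<le> 1 / (2 * pi)\<^sup>2 * ((C * ((1 + norm \<omega>) * exp (- (1/8) * (norm \<omega>)\<^sup>2))) * (LINT \<beta>|lborel. carrier_gaussian N \<beta>))"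
    by (intro mult_left_mono) simp_all
  then show ?thesis unfolding norm_mult norm_of_real by (simp add: mult_ac)
qed

lemma potential_bound:
  obtains C where "C \<ge> 0" "\<And>t \<omega>. cmod (potential N t \<omega>) \<le> C * ((1 + norm \<omega>) * exp (- (1/8) * (norm \<omega>)\<^sup>2))"
proof (rule that)
  show "0 \<le> 1 / (2 * pi)\<^sup>2 * ((2 + 2 * \<bar>N\<bar>) * (LINT \<beta>|lborel. carrier_gaussian N \<beta>))"
    by (intro mult_nonneg_nonneg integral_nonneg) (simp_all add: carrier_gaussian_def)
  show "cmod (potential N t \<omega>) \<le> 1 / (2 * pi)\<^sup>2 * ((2 + 2 * \<bar>N\<bar>) * (LINT \<beta>|lborel. carrier_gaussian N \<beta>)) * ((1 + norm \<omega>) * exp (- (1/8) * (norm \<omega>)\<^sup>2))" for t \<omega>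
    unfolding potential_def by (rule pair_product_integral_bound[OF _ interaction_bound]) measurable
qed

lemma potential_integrable: "integrable lborel (potential N t)"
proof -
  obtain C where C: "\<And>t \<omega>. cmod (potential N t \<omega>) \<le> C * ((1 + norm \<omega>) * exp (- (1/8) * (norm \<omega>)\<^sup>2))"
    using potential_bound by blast
  show ?thesis
    by (rule Bochner_Integration.integrable_bound[OF integrable_mult_right[OF integrable_poly_gaussian[of "1/8" 1], of C]])
       (use order_trans[OF C abs_ge_self] in auto)
qed

definition x_wave :: "real \<Rightarrow> real \<Rightarrow> plane_fun" where
  "x_wave N t \<zeta> = \<i> * complex_of_real (fst \<zeta>) * wave N t \<zeta>"

lemma fst_wave_integrable: "integrable lborel (\<lambda>\<zeta>. complex_of_real (fst \<zeta>) * wave N t \<zeta>)"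
proof (rule Bochner_Integration.integrable_bound[OF integrable_mult_right[OF carrier_gaussian_integrable, of "1 + \<bar>N\<bar>" N]])
  show "AE \<zeta> in lborel. cmod (complex_of_real (fst \<zeta>) * wave N t \<zeta>) \<le> norm ((1 + \<bar>N\<bar>) * carrier_gaussian N \<zeta>)"
  proof (rule AE_I2)
    fix \<zeta> :: "real \<times> real"
    let ?b = "norm (\<zeta> - (N, 0))"
    have "\<bar>fst \<zeta>\<bar> \<le> \<bar>N\<bar> + ?b" using abs_fst_le_norm[of "\<zeta> - (N, 0)"] by simp
    also have "\<dots> \<le> (1 + \<bar>N\<bar>) * (1 + ?b)" by (simp add: algebra_simps add_nonneg_nonneg)
    finally have "\<bar>fst \<zeta>\<bar> * packet N \<zeta> \<le> ((1 + \<bar>N\<bar>) * (1 + ?b)) * exp (- (1/4) * ?b\<^sup>2)"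
      by (intro mult_mono) (auto simp: packet_def)
    then show "cmod (complex_of_real (fst \<zeta>) * wave N t \<zeta>) \<le> norm ((1 + \<bar>N\<bar>) * carrier_gaussian N \<zeta>)"
      by (simp add: norm_mult norm_wave carrier_gaussian_def mult_ac)
  qed
qed measurable

lemma x_wave_integrable: "integrable lborel (x_wave N t)"
  unfolding x_wave_def[abs_def] mult.assoc by (rule integrable_mult_right[OF fst_wave_integrable])

lemma potential_eq_correlations:
  "potential N t \<omega> = - (\<i>/2) * correlation (wave N t) (wave N t) \<omega> - (3/2) * correlation (x_wave N t) (wave N t) \<omega>
     - (1/4) * correlation (wave N t) (x_wave N t) \<omega>
     - (\<i>/2) * complex_of_real ((fst \<omega>)\<^sup>2 * inverse (norm \<omega>)) * correlation (wave N t) (wave N t) \<omega>"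
proof -
  let ?K = "complex_of_real (1 / (2 * pi)\<^sup>2)"
  define U where "U = (\<lambda>\<beta>. wave N t (\<omega> + \<beta>) * cnj (wave N t \<beta>))"
  have bounds: "cmod 1 \<le> (1 + \<bar>N\<bar>) * ((1 + norm \<omega>) * (1 + norm (\<beta> - (N, 0))))"
    "cmod (\<i> * complex_of_real (fst (\<omega> + \<beta>))) \<le> (1 + \<bar>N\<bar>) * ((1 + norm \<omega>) * (1 + norm (\<beta> - (N, 0))))"
    "cmod (\<i> * complex_of_real (fst \<beta>)) \<le> (1 + \<bar>N\<bar>) * ((1 + norm \<omega>) * (1 + norm (\<beta> - (N, 0))))" for \<beta>
  proof -
    let ?b = "norm (\<beta> - (N, 0))"
    have b: "\<bar>fst \<beta>\<bar> \<le> \<bar>N\<bar> + ?b" using abs_fst_le_norm[of "\<beta> - (N, 0)"] by simp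
    have w: "\<bar>fst \<omega>\<bar> \<le> norm \<omega>" by (rule abs_fst_le_norm)
    have nn: "0 \<le> norm \<omega> * ?b" "0 \<le> \<bar>N\<bar> * norm \<omega>" "0 \<le> \<bar>N\<bar> * ?b" "0 \<le> \<bar>N\<bar> * (norm \<omega> * ?b)" by simp_all
    have e: "(1 + \<bar>N\<bar>) * ((1 + norm \<omega>) * (1 + ?b)) = 1 + norm \<omega> + ?b + norm \<omega> * ?b
      + \<bar>N\<bar> + \<bar>N\<bar> * norm \<omega> + \<bar>N\<bar> * ?b + \<bar>N\<bar> * (norm \<omega> * ?b)"
      by (simp add: algebra_simps)
    note facts = b w nn norm_ge_zero[of \<omega>] norm_ge_zero[of "\<beta> - (N, 0)"] abs_ge_zero[of N]
    show "cmod 1 \<le> (1 + \<bar>N\<bar>) * ((1 + norm \<omega>) * (1 + ?b))" unfolding e using facts by simp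
    show "cmod (\<i> * complex_of_real (fst (\<omega> + \<beta>))) \<le> (1 + \<bar>N\<bar>) * ((1 + norm \<omega>) * (1 + ?b))"
      unfolding e norm_mult norm_of_real norm_ii fst_add mult_1 using facts by linarith
    show "cmod (\<i> * complex_of_real (fst \<beta>)) \<le> (1 + \<bar>N\<bar>) * ((1 + norm \<omega>) * (1 + ?b))"
      unfolding e norm_mult norm_of_real norm_ii mult_1 using facts by linarith
  qed
  have i1: "integrable lborel (\<lambda>\<beta>. 1 * U \<beta>)" unfolding U_def by (rule pair_product_integrable[OF _ bounds(1)]) simp
  have i2: "integrable lborel (\<lambda>\<beta>. \<i> * complex_of_real (fst (\<omega> + \<beta>)) * U \<beta>)"
    unfolding U_def by (rule pair_product_integrable[OF _ bounds(2)]) measurable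
  have i3: "integrable lborel (\<lambda>\<beta>. \<i> * complex_of_real (fst \<beta>) * U \<beta>)"
    unfolding U_def by (rule pair_product_integrable[OF _ bounds(3)]) measurable
  let ?c = "complex_of_real ((fst \<omega>)\<^sup>2 * inverse (norm \<omega>))"
  have "(LINT \<beta>|lborel. interaction \<omega> \<beta> * U \<beta>)
     = (LINT \<beta>|lborel. - (\<i>/2) * (1 * U \<beta>) - (3/2) * (\<i> * complex_of_real (fst (\<omega> + \<beta>)) * U \<beta>)
         + (1/4) * (\<i> * complex_of_real (fst \<beta>) * U \<beta>) - ((\<i>/2) * ?c) * (1 * U \<beta>))"
    unfolding interaction_def by (intro Bochner_Integration.integral_cong refl) (simp add: algebra_simps)
  also have "\<dots> = - (\<i>/2) * (LINT \<beta>|lborel. 1 * U \<beta>) - (3/2) * (LINT \<beta>|lborel. \<i> * complex_of_real (fst (\<omega> + \<beta>)) * U \<beta>)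
         + (1/4) * (LINT \<beta>|lborel. \<i> * complex_of_real (fst \<beta>) * U \<beta>) - ((\<i>/2) * ?c) * (LINT \<beta>|lborel. 1 * U \<beta>)"
    by (simp only: Bochner_Integration.integral_add Bochner_Integration.integral_diff Bochner_Integration.integrable_diff
        Bochner_Integration.integrable_add integrable_mult_right[OF i1] integrable_mult_right[OF i2] integrable_mult_right[OF i3]
        integral_mult_right_zero)
  finally have main: "(LINT \<beta>|lborel. interaction \<omega> \<beta> * U \<beta>) = \<dots>" .
  have c1: "correlation (wave N t) (wave N t) \<omega> = ?K * (LINT \<beta>|lborel. 1 * U \<beta>)"
    by (simp add: correlation_def U_def)
  have c2: "correlation (x_wave N t) (wave N t) \<omega> = ?K * (LINT \<beta>|lborel. \<i> * complex_of_real (fst (\<omega> + \<beta>)) * U \<beta>)"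
    unfolding correlation_def U_def x_wave_def by (simp add: mult.assoc)
  have "wave N t (\<omega> + \<beta>) * cnj (x_wave N t \<beta>) = - 1 * (\<i> * complex_of_real (fst \<beta>) * U \<beta>)" for \<beta>
    by (simp add: x_wave_def U_def)
  then have "correlation (wave N t) (x_wave N t) \<omega> = ?K * (LINT \<beta>|lborel. - 1 * (\<i> * complex_of_real (fst \<beta>) * U \<beta>))"
    unfolding correlation_def by presburger
  then have c3: "correlation (wave N t) (x_wave N t) \<omega> = - (?K * (LINT \<beta>|lborel. \<i> * complex_of_real (fst \<beta>) * U \<beta>))"
    unfolding integral_mult_right_zero by simp
  show ?thesis
  proof -
    have "K * (- (\<i>/2) * I1 - (3/2) * I2 + (1/4) * I3 - ((\<i>/2) * c) * I1)
      = - (\<i>/2) * (K * I1) - (3/2) * (K * I2) - (1/4) * (- (K * I3)) - (\<i>/2) * c * (K * I1)" for K I1 I2 I3 c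
      by (simp add: algebra_simps)
    moreover have "wave N t (\<omega> + \<beta>) * cnj (wave N t \<beta>) = U \<beta>" for \<beta> by (simp add: U_def)
    ultimately show ?thesis unfolding c1 c2 c3 potential_def by (simp only: main)
  qed
qed

text \<open>One factor of \<open>|u|\<^sup>2 = u cnj u\<close> is transformed, and the other one is written as the inverse transform
of the reflected conjugate of the wave.\<close>
lemma fourier_density:
  "fourier (\<lambda>z. complex_of_real ((cmod (inv_fourier (wave N t) z))\<^sup>2)) = correlation (wave N t) (wave N t)"
proof
  fix \<eta> :: "real \<times> real"
  let ?U = "wave N t" and ?K = "complex_of_real (1 / (2 * pi)\<^sup>2)"
  let ?V = "\<lambda>\<zeta>. cnj (?U (- \<zeta>))"
  have iV: "integrable lborel ?V"
    using integrable_plane_affine[OF wave_integrable[of N t], of "-1" 0] by simp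
  have "cnj (inv_fourier ?U z) = inv_fourier ?V z" for z
  proof -
    have "inv_fourier ?V z = ?K * (LINT \<zeta>|lborel. cnj (?U \<zeta> * cis (z \<bullet> \<zeta>)))"
      unfolding inv_fourier_def
      using lborel_plane_affine[of "\<lambda>\<zeta>. ?V \<zeta> * cis (z \<bullet> \<zeta>)" "-1" 0] by (simp add: cis_cnj)
    then show ?thesis
      unfolding inv_fourier_def complex_cnj_mult Bochner_Integration.integral_cnj[symmetric] by simp
  qed
  then have "complex_of_real ((cmod (inv_fourier ?U z))\<^sup>2) = inv_fourier ?U z * inv_fourier ?V z" for z
    using complex_norm_square[of "inv_fourier ?U z"] by simp
  then have "fourier (\<lambda>z. complex_of_real ((cmod (inv_fourier ?U z))\<^sup>2)) \<eta> = ?K * (LINT \<omega>|lborel. ?V \<omega> * ?U (\<eta> - \<omega>))"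
    using fourier_mult_inv_fourier[OF inv_fourier_wave_integrable iV, of N t \<eta>] by (simp add: fourier_inv_fourier_wave)
  also have "(LINT \<omega>|lborel. ?V \<omega> * ?U (\<eta> - \<omega>)) = (LINT \<beta>|lborel. ?U (\<eta> + \<beta>) * cnj (?U \<beta>))"
    using lborel_plane_affine[of "\<lambda>\<omega>. ?V \<omega> * ?U (\<eta> - \<omega>)" "-1" 0] by (simp add: mult.commute)
  finally show "fourier (\<lambda>z. complex_of_real ((cmod (inv_fourier ?U z))\<^sup>2)) \<eta> = correlation ?U ?U \<eta>"
    by (simp add: correlation_def)
qed

lemma density_correlation_bound:
  obtains C where "C \<ge> 0" "\<And>\<omega>. cmod (correlation (wave N t) (wave N t) \<omega>) \<le> C * ((1 + norm \<omega>) * exp (- (1/8) * (norm \<omega>)\<^sup>2))"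
proof (rule that)
  let ?C = "1 / (2 * pi)\<^sup>2 * (1 * (LINT \<beta>|lborel. carrier_gaussian N \<beta>))"
  show "0 \<le> ?C" by (intro mult_nonneg_nonneg integral_nonneg) (simp_all add: carrier_gaussian_def)
  show "cmod (correlation (wave N t) (wave N t) \<omega>) \<le> ?C * ((1 + norm \<omega>) * exp (- (1/8) * (norm \<omega>)\<^sup>2))" for \<omega>
  proof -
    have "cmod 1 \<le> 1 * ((1 + norm \<omega>) * (1 + norm (\<beta> - (N, 0))))" for \<beta>
      using mult_mono[of 1 "1 + norm \<omega>" 1 "1 + norm (\<beta> - (N, 0))"] by simp
    from pair_product_integral_bound[OF _ this, of t] show ?thesis
      unfolding correlation_def mult_1_left by simp
  qed
qed

text \<open>The integrability that is needed to differentiate the nonlocal term twice in \<open>x\<close>: the singularity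
\<open>1 / |\<omega>|\<close> is integrable in two dimensions, and each derivative contributes a factor \<open>\<xi>\<close> that removes
it.\<close>
lemma inv_norm_correlation_integrable:
  assumes h_def: "h = (\<lambda>\<omega>. complex_of_real (inverse (norm \<omega>)) * correlation (wave N t) (wave N t) \<omega>)"
  shows "integrable lborel h" "integrable lborel (\<lambda>\<omega>. complex_of_real (fst \<omega>) * h \<omega>)"
    "integrable lborel (\<lambda>\<omega>. complex_of_real (fst \<omega>) * (\<i> * complex_of_real (fst \<omega>) * h \<omega>))"
proof -
  let ?c = "correlation (wave N t) (wave N t)"
  obtain C where C: "C \<ge> 0" "\<And>\<omega>. cmod (?c \<omega>) \<le> C * ((1 + norm \<omega>) * exp (- (1/8) * (norm \<omega>)\<^sup>2))"
    using density_correlation_bound by blast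
  have ci: "integrable lborel ?c" by (rule integrable_correlation[OF wave_integrable wave_integrable])
  then have [measurable]: "?c \<in> borel_measurable borel" by (auto dest: borel_measurable_integrable)
  have [measurable]: "h \<in> borel_measurable borel" unfolding h_def by measurable
  let ?e = "\<lambda>\<omega> :: real \<times> real. exp (- (1/8) * (norm \<omega>)\<^sup>2)"
  have e1: "integrable lborel (\<lambda>\<omega>. C * (inverse (norm \<omega>) * ?e \<omega> + ?e \<omega>))"
    by (intro integrable_mult_right Bochner_Integration.integrable_add integrable_inverse_norm_gaussian integrable_plane_gaussian) simp_all
  show "integrable lborel h"
  proof (rule Bochner_Integration.integrable_bound[OF e1])
    show "AE \<omega> in lborel. cmod (h \<omega>) \<le> norm (C * (inverse (norm \<omega>) * ?e \<omega> + ?e \<omega>))"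
    proof (rule AE_I2)
      fix \<omega> :: "real \<times> real"
      have "cmod (h \<omega>) \<le> inverse (norm \<omega>) * (C * ((1 + norm \<omega>) * ?e \<omega>))"
        unfolding h_def norm_mult norm_of_real using C(2)[of \<omega>] by (simp add: mult_left_mono)
      also have "\<dots> = C * ((inverse (norm \<omega>) + inverse (norm \<omega>) * norm \<omega>) * ?e \<omega>)" by (simp add: algebra_simps)
      also have "\<dots> \<le> C * ((inverse (norm \<omega>) + 1) * ?e \<omega>)"
        using C(1) by (intro mult_left_mono mult_right_mono add_left_mono) (cases "\<omega> = 0"; simp)+
      also have "\<dots> \<le> norm (C * (inverse (norm \<omega>) * ?e \<omega> + ?e \<omega>))" by (simp add: algebra_simps)
      finally show "cmod (h \<omega>) \<le> norm (C * (inverse (norm \<omega>) * ?e \<omega> + ?e \<omega>))" .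
    qed
  qed simp
  have le: "\<bar>fst \<omega>\<bar> * inverse (norm \<omega>) \<le> 1" for \<omega> :: "real \<times> real"
    using abs_fst_le_norm[of \<omega>] by (cases "\<omega> = 0") (simp_all add: divide_inverse[symmetric])
  show "integrable lborel (\<lambda>\<omega>. complex_of_real (fst \<omega>) * h \<omega>)"
  proof (rule Bochner_Integration.integrable_bound[OF ci])
    show "AE \<omega> in lborel. cmod (complex_of_real (fst \<omega>) * h \<omega>) \<le> cmod (?c \<omega>)"
    proof (rule AE_I2)
      fix \<omega> show "cmod (complex_of_real (fst \<omega>) * h \<omega>) \<le> cmod (?c \<omega>)"
        using mult_right_mono[OF le[of \<omega>], of "cmod (?c \<omega>)"] by (simp add: h_def norm_mult norm_inverse mult.assoc)
    qed
  qed measurable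
  show "integrable lborel (\<lambda>\<omega>. complex_of_real (fst \<omega>) * (\<i> * complex_of_real (fst \<omega>) * h \<omega>))"
  proof (rule Bochner_Integration.integrable_bound[OF integrable_mult_right[OF integrable_poly_gaussian[of "1/8" 2], of C]])
    show "AE \<omega> in lborel. cmod (complex_of_real (fst \<omega>) * (\<i> * complex_of_real (fst \<omega>) * h \<omega>)) \<le> norm (C * ((1 + norm \<omega>) ^ 2 * ?e \<omega>))"
    proof (rule AE_I2)
      fix \<omega> :: "real \<times> real"
      have "cmod (complex_of_real (fst \<omega>) * (\<i> * complex_of_real (fst \<omega>) * h \<omega>)) = \<bar>(fst \<omega>)\<^sup>2 * inverse (norm \<omega>)\<bar> * cmod (?c \<omega>)"
        by (simp add: h_def norm_mult norm_inverse power2_eq_square abs_mult mult.assoc[symmetric])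
      also have "\<dots> \<le> (1 + norm \<omega>) * (C * ((1 + norm \<omega>) * ?e \<omega>))"
        using abs_sq_over_norm_le[of \<omega>] by (intro mult_mono C) auto
      also have "\<dots> \<le> norm (C * ((1 + norm \<omega>) ^ 2 * ?e \<omega>))"
        by (simp add: power2_eq_square algebra_simps)
      finally show "cmod (complex_of_real (fst \<omega>) * (\<i> * complex_of_real (fst \<omega>) * h \<omega>)) \<le> norm (C * ((1 + norm \<omega>) ^ 2 * ?e \<omega>))" .
    qed
  qed (simp, measurable)
qed

lemma inv_fourier_cmult: "inv_fourier (\<lambda>\<zeta>. c * f \<zeta>) z = c * inv_fourier f z"
  unfolding inv_fourier_def mult.assoc integral_mult_right_zero by (simp add: mult.left_commute)

lemma inv_fourier_diff:
  assumes "integrable lborel f" "integrable lborel g"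
  shows "inv_fourier (\<lambda>\<zeta>. f \<zeta> - g \<zeta>) z = inv_fourier f z - inv_fourier g z"
proof -
  have i: "integrable lborel (\<lambda>\<zeta>. h \<zeta> * cis (z \<bullet> \<zeta>))" if h: "integrable lborel h" for h :: plane_fun
  proof (rule Bochner_Integration.integrable_bound[OF h])
    have [measurable]: "h \<in> borel_measurable borel" using h by (auto dest: borel_measurable_integrable)
    show "(\<lambda>\<zeta>. h \<zeta> * cis (z \<bullet> \<zeta>)) \<in> borel_measurable lborel" by measurable
  qed (simp add: norm_mult)
  show ?thesis
    unfolding inv_fourier_def left_diff_distrib Bochner_Integration.integral_diff[OF i[OF assms(1)] i[OF assms(2)]]
    by (rule right_diff_distrib)
qed

text \<open>All terms of \<open>dysthe_N\<close> contain \<open>u\<^sub>1\<close> itself as a factor; the remaining factor is a sum of products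
of the form treated by \<open>inv_fourier_mult_cnj\<close>, and of the nonlocal term.\<close>
lemma dysthe_N_picard1_datum:
  "dysthe_N (picard1 (datum N) t) z = inv_fourier (wave N t) z * inv_fourier (potential N t) z"
proof -
  let ?U = "wave N t" and ?X = "x_wave N t" and ?c = "correlation (wave N t) (wave N t)"
  define u where "u = inv_fourier ?U"
  define h where "h = (\<lambda>\<omega>. complex_of_real (inverse (norm \<omega>)) * ?c \<omega>)"
  note hi = inv_norm_correlation_integrable[OF h_def]
  have dxu: "dx u = inv_fourier ?X"
    unfolding u_def dx_inv_fourier(1)[OF wave_integrable fst_wave_integrable] x_wave_def[abs_def] ..
  have dxcu: "dx (\<lambda>w. cnj (u w)) z = cnj (inv_fourier ?X z)"
    using dx_inv_fourier(2)[OF wave_integrable fst_wave_integrable, of N t z] dxu by (simp add: u_def)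
  have powr_norm: "((fst \<zeta>)\<^sup>2 + (snd \<zeta>)\<^sup>2) powr (- 1/2) = inverse (norm \<zeta>)" for \<zeta> :: "real \<times> real"
    unfolding norm_plane_sq[symmetric] using powr_minus[of "(norm \<zeta>)\<^sup>2" "1/2"]
    by (simp add: powr_half_sqrt)
  have "inv_abs_grad (\<lambda>w. complex_of_real ((cmod (u w))\<^sup>2)) = inv_fourier h"
    unfolding inv_abs_grad_def multiplier_def u_def fourier_density h_def split_beta' powr_norm ..
  moreover have "(dx ^^ 2) (inv_fourier h) = inv_fourier (\<lambda>\<zeta>. \<i> * complex_of_real (fst \<zeta>) * (\<i> * complex_of_real (fst \<zeta>) * h \<zeta>))"
  proof -
    have i: "integrable lborel (\<lambda>\<zeta>. \<i> * complex_of_real (fst \<zeta>) * h \<zeta>)"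
      unfolding mult.assoc by (rule integrable_mult_right[OF hi(2)])
    show ?thesis
      by (simp add: numeral_2_eq_2 dx_inv_fourier(1)[OF hi(1) hi(2)] dx_inv_fourier(1)[OF i hi(3)])
  qed
  ultimately have nonlocal: "(dx ^^ 2) (inv_abs_grad (\<lambda>w. complex_of_real ((cmod (u w))\<^sup>2))) z
      = inv_fourier (\<lambda>\<zeta>. \<i> * complex_of_real (fst \<zeta>) * (\<i> * complex_of_real (fst \<zeta>) * h \<zeta>)) z"
    by simp
  define g where "g = (\<lambda>\<zeta>. complex_of_real ((fst \<zeta>)\<^sup>2 * inverse (norm \<zeta>)) * ?c \<zeta>)"
  have gh: "\<i> * complex_of_real (fst \<zeta>) * (\<i> * complex_of_real (fst \<zeta>) * h \<zeta>) = - 1 * g \<zeta>" for \<zeta>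
    by (simp add: g_def h_def power2_eq_square mult_ac)
  have gi: "integrable lborel g"
  proof -
    have "g = (\<lambda>\<zeta>. - \<i> * (complex_of_real (fst \<zeta>) * (\<i> * complex_of_real (fst \<zeta>) * h \<zeta>)))"
      by (rule ext) (simp add: g_def h_def power2_eq_square mult_ac)
    then show ?thesis using integrable_mult_right[OF hi(3), of "- \<i>"] by simp
  qed
  have ci: "integrable lborel ?c" "integrable lborel (correlation ?X ?U)" "integrable lborel (correlation ?U ?X)"
    by (intro integrable_correlation wave_integrable x_wave_integrable)+
  have "potential N t = (\<lambda>\<omega>. - (\<i>/2) * ?c \<omega> - (3/2) * correlation ?X ?U \<omega> - (1/4) * correlation ?U ?X \<omega> - (\<i>/2) * g \<omega>)"
    by (rule ext) (simp add: potential_eq_correlations g_def mult.assoc)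
  then have "inv_fourier (potential N t) z = - (\<i>/2) * inv_fourier ?c z - (3/2) * inv_fourier (correlation ?X ?U) z
     - (1/4) * inv_fourier (correlation ?U ?X) z - (\<i>/2) * inv_fourier g z"
    using ci gi by (simp only: inv_fourier_diff inv_fourier_cmult integrable_mult_right Bochner_Integration.integrable_diff)
  also have "\<dots> = - (\<i>/2) * (u z * cnj (u z)) - (3/2) * (inv_fourier ?X z * cnj (u z))
     - (1/4) * (u z * cnj (inv_fourier ?X z)) - (\<i>/2) * inv_fourier g z"
    unfolding u_def inv_fourier_mult_cnj[OF wave_integrable wave_integrable, symmetric]
      inv_fourier_mult_cnj[OF x_wave_integrable wave_integrable, symmetric]
      inv_fourier_mult_cnj[OF wave_integrable x_wave_integrable, symmetric] ..
  finally have pot: "inv_fourier (potential N t) z = \<dots>" .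
  show ?thesis
    unfolding dysthe_N_def picard1_datum u_def[symmetric] nonlocal
    unfolding pot dxcu dxu gh inv_fourier_cmult complex_norm_square
    by (simp add: algebra_simps power2_eq_square)
qed

text \<open>The dependence on the output frequency sits in the twisted wave alone; the singular potential
enters only as a weight in \<open>\<omega>\<close>.\<close>
lemma dysthe_flow_dysthe_N:
  "dysthe_flow a (dysthe_N (picard1 (datum N) b)) z = complex_of_real (1 / (2 * pi)\<^sup>2)
     * (LINT \<omega>|lborel. potential N b \<omega> * (cis (z \<bullet> \<omega>) * inv_fourier (twisted_wave N (a, b, \<omega>)) z))"
proof -
  let ?K = "complex_of_real (1 / (2 * pi)\<^sup>2)" and ?e = "\<lambda>\<eta>. cis (- (a * dispersion \<eta>))"
  have "fourier (dysthe_N (picard1 (datum N) b)) \<eta> = ?K * (LINT \<omega>|lborel. potential N b \<omega> * wave N b (\<eta> - \<omega>))" for \<eta>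
    using fourier_mult_inv_fourier[OF inv_fourier_wave_integrable potential_integrable, of N b N b \<eta>]
    by (simp add: dysthe_N_picard1_datum[abs_def] fourier_inv_fourier_wave)
  then have "dysthe_flow a (dysthe_N (picard1 (datum N) b)) z
     = inv_fourier (\<lambda>\<eta>. ?e \<eta> * (?K * (LINT \<omega>|lborel. potential N b \<omega> * wave N b (\<eta> - \<omega>)))) z"
    by (simp add: dysthe_flow_eq)
  also have "\<dots> = ?K * (LINT \<omega>|lborel. potential N b \<omega> * inv_fourier (\<lambda>\<eta>. ?e \<eta> * wave N b (\<eta> - \<omega>)) z)"
    by (rule inv_fourier_convolution[OF potential_integrable wave_integrable]) simp_all
  also have "\<dots> = ?K * (LINT \<omega>|lborel. potential N b \<omega> * (cis (z \<bullet> \<omega>) * inv_fourier (twisted_wave N (a, b, \<omega>)) z))"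
  proof -
    have "?e \<eta> * wave N b (\<eta> - \<omega>) = twisted_wave N (a, b, \<omega>) (\<eta> - \<omega>)" for \<eta> \<omega>
      by (simp add: twisted_wave_eq)
    moreover have "twisted_wave N p \<in> borel_measurable borel" for p
      using twisted_wave_integrable[of N p] by (auto dest: borel_measurable_integrable)
    ultimately show ?thesis by (simp add: inv_fourier_translate)
  qed
  finally show ?thesis .
qed

section \<open>The Fourier transform of the cubic term\<close>

lemma slab_integral:
  fixes w :: "'a::euclidean_space \<Rightarrow> real"
  assumes w: "integrable lborel w" and t: "0 \<le> t"
  shows "integrable lborel (\<lambda>p :: real \<times> 'a. indicat_real {0..t} (fst p) * w (snd p))"
    and "(LINT p :: real \<times> 'a|lborel. indicat_real {0..t} (fst p) * w (snd p)) = t * (LINT \<omega>|lborel. w \<omega>)"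
proof -
  have [measurable]: "w \<in> borel_measurable borel" using w by (auto dest: borel_measurable_integrable)
  have i0: "integrable lborel (indicat_real {0..t})" using t by (intro integrable_real_indicator) simp_all
  have i: "integrable (lborel \<Otimes>\<^sub>M lborel) (\<lambda>(x, y). indicat_real {0..t} x * w y)"
    by (rule integrable_pair_bound[of _ "indicat_real {0..t}" "\<lambda>y. \<bar>w y\<bar>"]) (use w i0 in \<open>simp_all add: abs_mult\<close>)
  then show "integrable lborel (\<lambda>p :: real \<times> 'a. indicat_real {0..t} (fst p) * w (snd p))"
    by (simp add: lborel_prod split_beta')
  show "(LINT p :: real \<times> 'a|lborel. indicat_real {0..t} (fst p) * w (snd p)) = t * (LINT \<omega>|lborel. w \<omega>)"
    using lborel_pair.integral_fst[OF i] t by (simp add: lborel_prod split_beta')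
qed

lemma inv_twisted_wave_measurable[measurable]:
  assumes [measurable]: "a \<in> borel_measurable M" "b \<in> borel_measurable M" "c \<in> borel_measurable M" "z \<in> borel_measurable M"
  shows "(\<lambda>x. inv_fourier (twisted_wave N (a x, b x, c x)) (z x)) \<in> borel_measurable M"
proof -
  have [measurable]: "(\<lambda>x :: real \<times> real \<times> (real \<times> real) \<times> (real \<times> real).
      inv_fourier (twisted_wave N (fst x, fst (snd x), fst (snd (snd x)))) (snd (snd (snd x))))
      \<in> borel_measurable (borel \<Otimes>\<^sub>M borel \<Otimes>\<^sub>M borel \<Otimes>\<^sub>M borel)"
    unfolding inv_fourier_def twisted_wave_eq by measurable
  have "(\<lambda>x. inv_fourier (twisted_wave N (fst (a x, b x, c x, z x), fst (snd (a x, b x, c x, z x)), fst (snd (snd (a x, b x, c x, z x)))))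
      (snd (snd (snd (a x, b x, c x, z x))))) \<in> borel_measurable M"
    by measurable
  then show ?thesis by simp
qed

text \<open>By \<open>dysthe_flow_dysthe_N\<close>, \<open>u\<^sub>3(t, z)\<close> is an integral over \<open>p = (t', \<omega>)\<close> of functions of \<open>z\<close> with the
integrable bound \<open>1 / ((1 + x\<^sup>2) (1 + y\<^sup>2))\<close>, times an integrable function of \<open>p\<close>. Hence the Fourier
transform may be taken under the integral over \<open>p\<close>, where the inversion formula applies.\<close>
theorem fourier_picard3_datum:
  assumes t: "0 \<le> t"
  shows "fourier (picard3 (datum N) t) \<eta> = complex_of_real (1 / (2 * pi)\<^sup>2)
    * (LINT p|lborel. indicat_real {0..t} (fst p) *\<^sub>R
        (potential N (fst p) (snd p) * twisted_wave N (t - fst p, fst p, snd p) (\<eta> - snd p)))"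
proof -
  let ?K = "complex_of_real (1 / (2 * pi)\<^sup>2)"
  let ?d = "\<lambda>z :: real \<times> real. 1 / (1 + (fst z)\<^sup>2) * (1 / (1 + (snd z)\<^sup>2))"
  obtain C k where C: "C \<ge> 0" "\<And>p z. cmod (inv_fourier (twisted_wave N p) z) \<le> C * twist_weight p ^ k * ?d z"
    using twisted_wave_decay by blast
  obtain D where D: "D \<ge> 0" "\<And>t \<omega>. cmod (potential N t \<omega>) \<le> D * ((1 + norm \<omega>) * exp (- (1/8) * (norm \<omega>)\<^sup>2))"
    using potential_bound by blast
  define w where "w = (\<lambda>\<omega> :: real \<times> real. (D * C * (1 + t) ^ k) * ((1 + norm \<omega>) ^ (k + 1) * exp (- (1/8) * (norm \<omega>)\<^sup>2)))"
  define B where "B = (\<lambda>p :: real \<times> real \<times> real. indicat_real {0..t} (fst p) * w (snd p))"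
  have "integrable lborel w"
    unfolding w_def by (intro integrable_mult_right integrable_poly_gaussian) simp
  then have B: "integrable lborel B" unfolding B_def by (rule slab_integral(1)[OF _ t])
  \<comment> \<open>up to a constant factor, the integrand of \<open>u\<^sub>3(t, z)\<close> as a function of \<open>p = (t', \<omega>)\<close>\<close>
  define \<Phi> where "\<Phi> = (\<lambda>z p. indicat_real {0..t} (fst p) *\<^sub>R (potential N (fst p) (snd p)
      * (cis (z \<bullet> snd p) * inv_fourier (twisted_wave N (t - fst p, fst p, snd p)) z)))"
  have \<Phi>_le: "cmod (\<Phi> z p) \<le> ?d z * B p" for z p
  proof (cases "fst p \<in> {0..t}")
    case True
    have d0: "0 \<le> ?d z" by simp
    have tw: "twist_weight (t - fst p, fst p, snd p) \<le> (1 + t) * (1 + norm (snd p))"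
      using True t by (cases p) (simp add: twist_weight_def algebra_simps)
    have tw0: "0 \<le> twist_weight (t - fst p, fst p, snd p)" by (cases p) (simp add: twist_weight_def)
    have "cmod (\<Phi> z p) = cmod (potential N (fst p) (snd p)) * cmod (inv_fourier (twisted_wave N (t - fst p, fst p, snd p)) z)"
      using True by (simp add: \<Phi>_def norm_mult)
    also have "\<dots> \<le> (D * ((1 + norm (snd p)) * exp (- (1/8) * (norm (snd p))\<^sup>2))) * (C * twist_weight (t - fst p, fst p, snd p) ^ k * ?d z)"
      by (rule mult_mono[OF D(2) C(2) order_trans[OF norm_ge_zero D(2)] norm_ge_zero])
    also have "\<dots> \<le> (D * ((1 + norm (snd p)) * exp (- (1/8) * (norm (snd p))\<^sup>2))) * (C * ((1 + t) * (1 + norm (snd p))) ^ k * ?d z)"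
      using D(1) C(1) d0 tw tw0 by (intro mult_left_mono mult_right_mono power_mono) auto
    also have "\<dots> = ?d z * B p"
      using True by (simp add: B_def w_def power_mult_distrib mult_ac)
    finally show ?thesis .
  next
    case False
    then show ?thesis by (simp add: \<Phi>_def B_def)
  qed
  have \<Phi>_meas: "case_prod \<Phi> \<in> borel_measurable (lborel \<Otimes>\<^sub>M lborel)"
  proof -
    have "case_prod \<Phi> \<in> borel_measurable (lborel \<Otimes>\<^sub>M (lborel \<Otimes>\<^sub>M lborel))"
      unfolding \<Phi>_def split_beta' by measurable
    then show ?thesis by (simp only: lborel_prod)
  qed
  have \<Phi>_int: "integrable lborel (\<Phi> z)" for z
  proof (rule Bochner_Integration.integrable_bound[OF integrable_mult_right[OF B, of "?d z"]])
    show "\<Phi> z \<in> borel_measurable lborel"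
      using measurable_compose[OF measurable_Pair1'[of z lborel lborel] \<Phi>_meas] by simp
    show "AE p in lborel. cmod (\<Phi> z p) \<le> norm (?d z * B p)"
      unfolding real_norm_def by (intro AE_I2 order_trans[OF \<Phi>_le abs_ge_self])
  qed
  have u3: "picard3 (datum N) t z = ?K * (LINT p|lborel. \<Phi> z p)" for z
  proof -
    have "(LINT p|lborel. \<Phi> z p) = (LINT t'|lborel. LINT \<omega>|lborel. \<Phi> z (t', \<omega>))"
      using lborel_pair.integral_fst'[of "\<Phi> z"] \<Phi>_int[of z] by (simp add: lborel_prod)
    then show ?thesis
      unfolding picard3_def set_lebesgue_integral_def dysthe_flow_dysthe_N \<Phi>_def
      by (simp add: integral_mult_right_zero[symmetric] del: integral_mult_right_zero)
  qed
  have "fourier (picard3 (datum N) t) \<eta> = ?K * (LINT z|lborel. LINT p|lborel. \<Phi> z p * cis (- (z \<bullet> \<eta>)))"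
    unfolding fourier_def u3 by (simp add: mult.assoc)
  also have "(LINT z|lborel. LINT p|lborel. \<Phi> z p * cis (- (z \<bullet> \<eta>))) = (LINT p|lborel. LINT z|lborel. \<Phi> z p * cis (- (z \<bullet> \<eta>)))"
  proof (rule integral_swap_bound[OF _ integrable_plane_decay B])
    show "(\<lambda>(z, p). \<Phi> z p * cis (- (z \<bullet> \<eta>))) \<in> borel_measurable (lborel \<Otimes>\<^sub>M lborel)"
      using \<Phi>_meas by (simp add: split_beta')
    show "cmod (\<Phi> z p * cis (- (z \<bullet> \<eta>))) \<le> ?d z * B p" for z p
      using \<Phi>_le[of z p] by (simp add: norm_mult)
  qed
  also have "\<dots> = (LINT p|lborel. indicat_real {0..t} (fst p) *\<^sub>R
        (potential N (fst p) (snd p) * twisted_wave N (t - fst p, fst p, snd p) (\<eta> - snd p)))"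
  proof (intro Bochner_Integration.integral_cong refl)
    fix p :: "real \<times> real \<times> real"
    let ?f = "inv_fourier (twisted_wave N (t - fst p, fst p, snd p))"
    have "(LINT z|lborel. \<Phi> z p * cis (- (z \<bullet> \<eta>)))
        = (LINT z|lborel. (complex_of_real (indicat_real {0..t} (fst p)) * potential N (fst p) (snd p)) * (cis (z \<bullet> snd p) * ?f z * cis (- (z \<bullet> \<eta>))))"
      by (simp add: \<Phi>_def scaleR_conv_of_real mult.assoc)
    also have "\<dots> = complex_of_real (indicat_real {0..t} (fst p)) * potential N (fst p) (snd p) * fourier (\<lambda>z. cis (z \<bullet> snd p) * ?f z) \<eta>"
      unfolding integral_mult_right_zero fourier_def ..
    also have "\<dots> = indicat_real {0..t} (fst p) *\<^sub>R
        (potential N (fst p) (snd p) * twisted_wave N (t - fst p, fst p, snd p) (\<eta> - snd p))"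
      by (simp add: fourier_modulate fourier_inv_twisted_wave scaleR_conv_of_real mult.assoc)
    finally show "(LINT z|lborel. \<Phi> z p * cis (- (z \<bullet> \<eta>))) = \<dots>" .
  qed
  finally show ?thesis .
qed

section \<open>Absence of oscillation on short time scales\<close>

text \<open>The part of \<open>dispersion ((N, 0) + v)\<close> of order at least two in \<open>v\<close>; it is of size \<open>N\<close>.\<close>
definition phase_remainder :: "real \<Rightarrow> real \<times> real \<Rightarrow> real" where
  "phase_remainder N v = N * (3/16 * (fst v)\<^sup>2 - 3/8 * (snd v)\<^sup>2)
     + (fst v ^ 3 / 16 - (fst v)\<^sup>2 / 8 + (snd v)\<^sup>2 / 4 - 3/8 * fst v * (snd v)\<^sup>2)"

lemma dispersion_expand:
  "dispersion ((N, 0) + v) = dispersion (N, 0) + (3/16 * N\<^sup>2 - N/4 + 1/2) * fst v + phase_remainder N v"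
  by (simp add: dispersion_def phase_remainder_def power2_eq_square power3_eq_cube field_simps)

lemma phase_remainder_bound:
  assumes N: "N \<ge> 1"
  shows "\<bar>phase_remainder N v\<bar> \<le> 2 * N * (1 + norm v) ^ 3"
proof -
  define n where "n = 1 + norm v"
  have n: "n \<ge> 1" by (simp add: n_def)
  have x: "\<bar>fst v\<bar> \<le> n" and y: "\<bar>snd v\<bar> \<le> n"
    using abs_fst_le_norm[of v] abs_snd_le_norm[of v] by (simp_all add: n_def)
  have n23: "n\<^sup>2 \<le> n ^ 3" using n by (intro power_increasing) auto
  have x2: "(fst v)\<^sup>2 \<le> n ^ 3" "0 \<le> (fst v)\<^sup>2" using power_mono[OF x, of 2] n23 by simp_all
  have y2: "(snd v)\<^sup>2 \<le> n ^ 3" "0 \<le> (snd v)\<^sup>2" using power_mono[OF y, of 2] n23 by simp_all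
  have x3: "\<bar>fst v ^ 3\<bar> \<le> n ^ 3" using power_mono[OF x, of 3] by (simp add: power_abs)
  have xy: "\<bar>fst v * (snd v)\<^sup>2\<bar> \<le> n ^ 3"
  proof -
    have "\<bar>fst v\<bar> * (\<bar>snd v\<bar>)\<^sup>2 \<le> n * n\<^sup>2" using n by (intro mult_mono x power_mono y) auto
    then show ?thesis by (simp add: abs_mult power2_eq_square power3_eq_cube)
  qed
  have q: "\<bar>3/16 * (fst v)\<^sup>2 - 3/8 * (snd v)\<^sup>2\<bar> \<le> 3/8 * n ^ 3" unfolding abs_le_iff using x2 y2 by linarith
  have "\<bar>phase_remainder N v\<bar> \<le> \<bar>N * (3/16 * (fst v)\<^sup>2 - 3/8 * (snd v)\<^sup>2)\<bar>
      + \<bar>fst v ^ 3 / 16 - (fst v)\<^sup>2 / 8 + (snd v)\<^sup>2 / 4 - 3/8 * (fst v * (snd v)\<^sup>2)\<bar>"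
    unfolding phase_remainder_def using abs_triangle_ineq by (simp add: mult.assoc)
  also have "\<dots> \<le> N * (3/8 * n ^ 3) + n ^ 3"
  proof (rule add_mono)
    show "\<bar>N * (3/16 * (fst v)\<^sup>2 - 3/8 * (snd v)\<^sup>2)\<bar> \<le> N * (3/8 * n ^ 3)"
      using q N by (simp add: abs_mult mult_left_mono)
    show "\<bar>fst v ^ 3 / 16 - (fst v)\<^sup>2 / 8 + (snd v)\<^sup>2 / 4 - 3/8 * (fst v * (snd v)\<^sup>2)\<bar> \<le> n ^ 3"
      using x2 y2 x3 xy unfolding abs_le_iff by linarith
  qed
  also have "\<dots> \<le> 2 * N * n ^ 3"
  proof -
    have "1 * n ^ 3 \<le> N * n ^ 3" using N n by (intro mult_right_mono) auto
    moreover have "0 \<le> N * n ^ 3" using N n by simp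
    ultimately show ?thesis by (simp add: mult.assoc)
  qed
  finally show ?thesis by (simp add: n_def)
qed

text \<open>The phase of the cubic interaction, for the frequencies \<open>\<theta>\<close>, \<open>\<theta> - \<omega>\<close>, \<open>\<omega> + b\<close> and \<open>b\<close> relative to
the carrier frequency \<open>(N, 0)\<close>.\<close>
definition resonance :: "real \<Rightarrow> real \<times> real \<Rightarrow> real \<times> real \<Rightarrow> real \<times> real \<Rightarrow> real" where
  "resonance N \<theta> \<omega> b = dispersion ((N, 0) + \<theta>) - dispersion ((N, 0) + (\<theta> - \<omega>))
     - dispersion ((N, 0) + (\<omega> + b)) + dispersion ((N, 0) + b)"

definition poly_weight :: "real \<times> real \<Rightarrow> real \<times> real \<Rightarrow> real" where
  "poly_weight \<omega> b = (1 + norm \<omega>) * (1 + norm b)"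

lemma poly_weight_ge_1: "1 \<le> poly_weight \<omega> b"
  using mult_mono[of 1 "1 + norm \<omega>" 1 "1 + norm b"] by (simp add: poly_weight_def)

text \<open>The constant and linear parts of the dispersion relation at \<open>(N, 0)\<close>, which are of size \<open>N\<^sup>3\<close> and
\<open>N\<^sup>2\<close>, cancel because \<open>\<theta> - (\<theta> - \<omega>) - (\<omega> + b) + b = 0\<close>.\<close>
lemma resonance_bound:
  assumes N: "N \<ge> 1" and \<theta>: "norm \<theta> \<le> 1"
  shows "\<bar>resonance N \<theta> \<omega> b\<bar> \<le> 64 * N * poly_weight \<omega> b ^ 3"
proof -
  have e: "resonance N \<theta> \<omega> b = phase_remainder N \<theta> - phase_remainder N (\<theta> - \<omega>)
      - phase_remainder N (\<omega> + b) + phase_remainder N b"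
    unfolding resonance_def dispersion_expand by (simp add: field_simps)
  have c: "poly_weight \<omega> b = 1 + norm \<omega> + norm b + norm \<omega> * norm b" by (simp add: poly_weight_def algebra_simps)
  have nn: "0 \<le> norm \<omega> * norm b" by simp
  \<comment> \<open>each of the four relative frequencies \<open>v\<close> has \<open>1 + |v|\<close> at most twice the weight\<close>
  have small: "\<bar>phase_remainder N v\<bar> \<le> 16 * N * poly_weight \<omega> b ^ 3" if "1 + norm v \<le> 2 * poly_weight \<omega> b" for v
  proof -
    have "\<bar>phase_remainder N v\<bar> \<le> 2 * N * (1 + norm v) ^ 3" by (rule phase_remainder_bound[OF N])
    also have "\<dots> \<le> 2 * N * (2 * poly_weight \<omega> b) ^ 3"
      using N that by (intro mult_left_mono power_mono) auto
    finally show ?thesis by (simp add: power_mult_distrib)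
  qed
  have "\<bar>phase_remainder N \<theta>\<bar> \<le> 16 * N * poly_weight \<omega> b ^ 3"
    by (rule small) (use \<theta> poly_weight_ge_1[of \<omega> b] in linarith)
  moreover have "\<bar>phase_remainder N (\<theta> - \<omega>)\<bar> \<le> 16 * N * poly_weight \<omega> b ^ 3"
    using norm_triangle_ineq4[of \<theta> \<omega>] \<theta> nn c norm_ge_zero[of b] norm_ge_zero[of \<omega>] by (intro small) linarith
  moreover have "\<bar>phase_remainder N (\<omega> + b)\<bar> \<le> 16 * N * poly_weight \<omega> b ^ 3"
    using norm_triangle_ineq[of \<omega> b] nn c norm_ge_zero[of b] norm_ge_zero[of \<omega>] by (intro small) linarith
  moreover have "\<bar>phase_remainder N b\<bar> \<le> 16 * N * poly_weight \<omega> b ^ 3"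
    using nn c norm_ge_zero[of b] norm_ge_zero[of \<omega>] by (intro small) linarith
  ultimately show ?thesis unfolding e by linarith
qed

lemma cis_minus_one_bound: "cmod (cis x - 1) \<le> \<bar>x\<bar>"
  using iexp_approx1[of x 0] by (simp add: cis_conv_exp)

text \<open>The derivative falls on a factor of frequency near \<open>N\<close> in both terms with a derivative, so
\<open>- (3/2) \<i> N + (1/4) \<i> N\<close> is the leading part of the interaction.\<close>
lemma interaction_near_carrier:
  "cmod (interaction \<omega> ((N, 0) + b) + (5/4) * \<i> * complex_of_real N) \<le> 2 * poly_weight \<omega> b"
proof -
  let ?q = "(fst \<omega>)\<^sup>2 * inverse (norm \<omega>)"
  have "interaction \<omega> ((N, 0) + b) + (5/4) * \<i> * complex_of_real N
     = \<i> * complex_of_real (- 1/2 - 3/2 * fst \<omega> - 5/4 * fst b - 1/2 * ?q)"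
    by (simp add: interaction_def algebra_simps)
  then have "cmod (interaction \<omega> ((N, 0) + b) + (5/4) * \<i> * complex_of_real N)
      = \<bar>- 1/2 - 3/2 * fst \<omega> - 5/4 * fst b - 1/2 * ?q\<bar>"
    by (simp only: norm_mult norm_ii norm_of_real mult_1)
  also have "\<dots> \<le> 1/2 + 3/2 * norm \<omega> + 5/4 * norm b + 1/2 * norm \<omega>"
  proof -
    have "\<bar>- 1/2 - 3/2 * p - 5/4 * q - 1/2 * r\<bar> \<le> 1/2 + 3/2 * n + 5/4 * m + 1/2 * n"
      if "\<bar>p\<bar> \<le> n" "\<bar>q\<bar> \<le> m" "\<bar>r\<bar> \<le> n" for p q r n m :: real
      using that by linarith
    from this[OF abs_fst_le_norm abs_fst_le_norm abs_sq_over_norm_le] show ?thesis .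
  qed
  also have "\<dots> \<le> 2 * poly_weight \<omega> b"
  proof -
    have "poly_weight \<omega> b = 1 + norm \<omega> + norm b + norm \<omega> * norm b" by (simp add: poly_weight_def algebra_simps)
    moreover have "0 \<le> norm \<omega> * norm b" by simp
    ultimately show ?thesis using norm_ge_zero[of b] by linarith
  qed
  finally show ?thesis .
qed

text \<open>The integrand is replaced by its leading part at an expense that is small compared to \<open>N\<close> as soon as
\<open>t\<close> is small compared to \<open>1 / N\<close>.\<close>
lemma integrand_near_carrier:
  assumes N: "N \<ge> 1" and \<theta>: "norm \<theta> \<le> 1" and t': "0 \<le> t'" "t' \<le> t"
  shows "cmod (interaction \<omega> ((N, 0) + b) * cis (t' * resonance N \<theta> \<omega> b) + (5/4) * \<i> * complex_of_real N)
     \<le> (2 + 80 * N\<^sup>2 * t) * poly_weight \<omega> b ^ 3"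
proof -
  let ?I = "interaction \<omega> ((N, 0) + b)" and ?c = "cis (t' * resonance N \<theta> \<omega> b)" and ?L = "(5/4) * \<i> * complex_of_real N"
  have "x * c + l = (x + l) * c - l * (c - 1)" for x c l :: complex by (simp add: algebra_simps)
  then have "?I * ?c + ?L = (?I + ?L) * ?c - ?L * (?c - 1)" .
  then have "cmod (?I * ?c + ?L) \<le> cmod (?I + ?L) + 5/4 * N * cmod (?c - 1)"
    using norm_triangle_ineq4[of "(?I + ?L) * ?c" "?L * (?c - 1)"] N by (simp add: norm_mult)
  also have "\<dots> \<le> 2 * poly_weight \<omega> b ^ 3 + 5/4 * N * (t * (64 * N * poly_weight \<omega> b ^ 3))"
  proof (intro add_mono mult_left_mono)
    have "2 * poly_weight \<omega> b \<le> 2 * poly_weight \<omega> b ^ 3"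
      using power_increasing[of 1 3 "poly_weight \<omega> b"] poly_weight_ge_1[of \<omega> b] by simp
    then show "cmod (?I + ?L) \<le> 2 * poly_weight \<omega> b ^ 3" using interaction_near_carrier[of \<omega> N b] by linarith
    have "\<bar>t' * resonance N \<theta> \<omega> b\<bar> \<le> t * (64 * N * poly_weight \<omega> b ^ 3)"
      unfolding abs_mult using t' resonance_bound[OF N \<theta>] by (intro mult_mono) auto
    then show "cmod (?c - 1) \<le> t * (64 * N * poly_weight \<omega> b ^ 3)"
      using cis_minus_one_bound[of "t' * resonance N \<theta> \<omega> b"] by linarith
  qed (use N in simp)
  also have "\<dots> = (2 + 80 * N\<^sup>2 * t) * poly_weight \<omega> b ^ 3" by (simp add: algebra_simps power2_eq_square)
  finally show ?thesis .
qed

text \<open>The three packets of the interaction, with frequencies relative to \<open>(N, 0)\<close>. No \<open>N\<close> is left, which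
makes the constants of the lower bound uniform in \<open>N\<close>.\<close>
definition packet_triple :: "real \<times> real \<Rightarrow> real \<times> real \<Rightarrow> real \<times> real \<Rightarrow> real" where
  "packet_triple \<theta> \<omega> b = packet 0 (\<theta> - \<omega>) * (packet 0 (\<omega> + b) * packet 0 b)"

lemma packet_carrier: "packet N ((N, 0) + v) = packet 0 v"
  by (simp add: packet_def zero_prod_def[symmetric])

text \<open>The formula of \<open>fourier_picard3_datum\<close> with all frequencies relative to \<open>(N, 0)\<close>. The unimodular
factor on the left completes the phases of the four waves to the resonance function.\<close>
lemma fourier_picard3_datum_carrier:
  assumes t: "0 \<le> t"
  shows "cis (t * dispersion ((N, 0) + \<theta>)) * fourier (picard3 (datum N) t) ((N, 0) + \<theta>)
    = complex_of_real (1 / (2 * pi)\<^sup>2) * (complex_of_real (1 / (2 * pi)\<^sup>2) *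
      (LINT p|lborel. indicat_real {0..t} (fst p) *\<^sub>R (LINT b|lborel.
         interaction (snd p) ((N, 0) + b) * cis (fst p * resonance N \<theta> (snd p) b) * complex_of_real (packet_triple \<theta> (snd p) b))))"
proof -
  let ?K = "complex_of_real (1 / (2 * pi)\<^sup>2)" and ?c = "(N, 0) :: real \<times> real"
  have inner: "cis (t * dispersion (?c + \<theta>)) * (potential N t' \<omega> * twisted_wave N (t - t', t', \<omega>) (?c + \<theta> - \<omega>))
     = ?K * (LINT b|lborel. interaction \<omega> (?c + b) * cis (t' * resonance N \<theta> \<omega> b) * complex_of_real (packet_triple \<theta> \<omega> b))" for t' \<omega>
  proof -
    let ?T = "cis (t * dispersion (?c + \<theta>)) * twisted_wave N (t - t', t', \<omega>) (?c + \<theta> - \<omega>)"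
    have "potential N t' \<omega> = ?K * (LINT b|lborel. interaction \<omega> (?c + b) * (wave N t' (\<omega> + (?c + b)) * cnj (wave N t' (?c + b))))"
      unfolding potential_def
      using lborel_plane_affine[of "\<lambda>\<beta>. interaction \<omega> \<beta> * (wave N t' (\<omega> + \<beta>) * cnj (wave N t' \<beta>))" 1 ?c] by simp
    then have start: "cis (t * dispersion (?c + \<theta>)) * (potential N t' \<omega> * twisted_wave N (t - t', t', \<omega>) (?c + \<theta> - \<omega>))
      = ?K * (LINT b|lborel. ?T * (interaction \<omega> (?c + b) * (wave N t' (\<omega> + (?c + b)) * cnj (wave N t' (?c + b)))))"
      unfolding integral_mult_right_zero by (simp only: mult_ac)
    have "?T * (interaction \<omega> (?c + b) * (wave N t' (\<omega> + (?c + b)) * cnj (wave N t' (?c + b))))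
       = interaction \<omega> (?c + b) * cis (t' * resonance N \<theta> \<omega> b) * complex_of_real (packet_triple \<theta> \<omega> b)" for b
    proof -
      have a: "?c + \<theta> - \<omega> + \<omega> = ?c + \<theta>" "?c + \<theta> - \<omega> = ?c + (\<theta> - \<omega>)" "\<omega> + (?c + b) = ?c + (\<omega> + b)"
        by (simp_all add: algebra_simps)
      have "t * A + (- ((t - t') * A) + (- (t' * B) + (- (t' * C) + t' * D))) = t' * (A - B - C + D)" for A B C D :: real
        by (simp add: algebra_simps)
      then have ph: "cis (t * A) * (cis (- ((t - t') * A)) * (cis (- (t' * B)) * (cis (- (t' * C)) * cis (t' * D))))
          = cis (t' * (A - B - C + D))" for A B C D :: real
        unfolding cis_mult by simp
      show ?thesis
        unfolding twisted_wave_eq wave_def a packet_carrier resonance_def packet_triple_def ph[symmetric]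
          complex_cnj_mult complex_cnj_complex_of_real cis_cnj of_real_mult
        by (simp add: mult_ac)
    qed
    then show ?thesis unfolding start by (simp only:)
  qed
  have "cis (t * dispersion (?c + \<theta>)) * fourier (picard3 (datum N) t) (?c + \<theta>)
    = ?K * (LINT p|lborel. indicat_real {0..t} (fst p) *\<^sub>R (cis (t * dispersion (?c + \<theta>)) *
        (potential N (fst p) (snd p) * twisted_wave N (t - fst p, fst p, snd p) (?c + \<theta> - snd p))))"
    unfolding fourier_picard3_datum[OF t] by (simp add: mult_ac flip: integral_mult_right_zero)
  also have "\<dots> = ?K * (?K * (LINT p|lborel. indicat_real {0..t} (fst p) *\<^sub>R (LINT b|lborel.
         interaction (snd p) (?c + b) * cis (fst p * resonance N \<theta> (snd p) b) * complex_of_real (packet_triple \<theta> (snd p) b))))"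
    unfolding inner by (simp add: scaleR_conv_of_real mult.left_commute flip: integral_mult_right_zero)
  finally show ?thesis .
qed

definition weighted_gaussian :: "real \<Rightarrow> real \<times> real \<Rightarrow> real" where
  "weighted_gaussian a v = (1 + norm v) ^ 3 * exp (- a * (norm v)\<^sup>2)"

lemma weighted_gaussian_integrable: "a > 0 \<Longrightarrow> integrable lborel (weighted_gaussian a)"
  unfolding weighted_gaussian_def[abs_def] by (rule integrable_poly_gaussian)

lemma packet_triple_upper: "poly_weight \<omega> b ^ 3 * packet_triple \<theta> \<omega> b \<le> weighted_gaussian (1/8) \<omega> * weighted_gaussian (1/4) b"
proof -
  have "packet_triple \<theta> \<omega> b \<le> exp (- (1/8) * (norm \<omega>)\<^sup>2) * exp (- (1/4) * (norm b)\<^sup>2)"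
    unfolding packet_triple_def
  proof (rule order_trans[OF mult_left_le_one_le])
    show "packet 0 (\<omega> + b) * packet 0 b \<le> exp (- (1/8) * (norm \<omega>)\<^sup>2) * exp (- (1/4) * (norm b)\<^sup>2)"
      using packet_product[of 0 \<omega> b] by (simp add: zero_prod_def[symmetric])
  qed (simp_all add: packet_le_1 packet_pos less_imp_le)
  then have "poly_weight \<omega> b ^ 3 * packet_triple \<theta> \<omega> b \<le> poly_weight \<omega> b ^ 3 * (exp (- (1/8) * (norm \<omega>)\<^sup>2) * exp (- (1/4) * (norm b)\<^sup>2))"
    using poly_weight_ge_1[of \<omega> b] by (intro mult_left_mono) auto
  then show ?thesis by (simp add: weighted_gaussian_def poly_weight_def power_mult_distrib mult_ac)
qed

lemma packet_triple_lower:
  assumes "norm \<theta> \<le> 1"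
  shows "exp (- 1) * exp (- 2 * (norm \<omega>)\<^sup>2) * exp (- (3/2) * (norm b)\<^sup>2) \<le> packet_triple \<theta> \<omega> b"
proof -
  have sq: "(norm (u + v))\<^sup>2 \<le> 2 * (norm u)\<^sup>2 + 2 * (norm v)\<^sup>2" for u v :: "real \<times> real"
  proof -
    have "0 \<le> (norm (u - v))\<^sup>2" by simp
    then show ?thesis unfolding norm_plane_sq by (simp add: power2_eq_square algebra_simps)
  qed
  have "(norm \<theta>)\<^sup>2 \<le> 1" using assms by (simp add: power_le_one)
  then have "- 1 + (- 2 * (norm \<omega>)\<^sup>2) + (- (3/2) * (norm b)\<^sup>2)
     \<le> - (norm (\<theta> - \<omega>))\<^sup>2 / 2 + (- (norm (\<omega> + b))\<^sup>2 / 2 + - (norm b)\<^sup>2 / 2)"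
    using sq[of \<theta> "- \<omega>"] sq[of \<omega> b] by simp
  then show ?thesis
    by (simp add: packet_triple_def packet_def zero_prod_def[symmetric] exp_add[symmetric] mult_exp_exp)
qed

lemma packet_triple_pos: "0 < packet_triple \<theta> \<omega> b"
  by (simp add: packet_triple_def packet_pos)

lemma gaussian_plane_pos:
  assumes a: "a > 0" shows "0 < (LINT z :: real \<times> real|lborel. exp (- a * (norm z)\<^sup>2))"
proof -
  have "(LINT z :: real \<times> real|lborel. exp (- (norm z)\<^sup>2 / 2)) = 2 * pi"
    using gaussian_plane(2) by (simp flip: of_real_exp) (metis integral_complex_of_real of_real_eq_iff of_real_mult of_real_numeral)
  moreover have "(LINT z :: real \<times> real|lborel. exp (- (norm z)\<^sup>2 / 2))
      = (sqrt (2 * a))\<^sup>2 *\<^sub>R (LINT z :: real \<times> real|lborel. exp (- (norm (0 + sqrt (2 * a) *\<^sub>R z))\<^sup>2 / 2))"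
    by (rule lborel_plane_affine) (use a in simp_all)
  ultimately have "0 < 2 * a * (LINT z :: real \<times> real|lborel. exp (- a * (norm z)\<^sup>2))"
    using a by (simp add: power_mult_distrib)
  then show ?thesis using a by (simp add: zero_less_mult_iff)
qed

section \<open>The lower bound and the conclusion\<close>

lemma packet_triple_measurable[measurable]:
  assumes [measurable]: "f \<in> borel_measurable M" "g \<in> borel_measurable M"
  shows "(\<lambda>x. packet_triple \<theta> (f x) (g x)) \<in> borel_measurable M"
  unfolding packet_triple_def by measurable

lemma resonance_measurable[measurable]:
  assumes [measurable]: "f \<in> borel_measurable M" "g \<in> borel_measurable M"
  shows "(\<lambda>x. resonance N \<theta> (f x) (g x)) \<in> borel_measurable M"
  unfolding resonance_def by measurable

lemma packet_triple_le: "packet_triple \<theta> \<omega> b \<le> weighted_gaussian (1/8) \<omega> * weighted_gaussian (1/4) b"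
proof -
  have "1 * packet_triple \<theta> \<omega> b \<le> poly_weight \<omega> b ^ 3 * packet_triple \<theta> \<omega> b"
    using packet_triple_pos[of \<theta> \<omega> b] poly_weight_ge_1[of \<omega> b] by (intro mult_right_mono one_le_power) auto
  also have "\<dots> \<le> weighted_gaussian (1/8) \<omega> * weighted_gaussian (1/4) b" by (rule packet_triple_upper)
  finally show ?thesis by simp
qed

lemma packet_triple_integrable: "integrable lborel (packet_triple \<theta> \<omega>)"
proof (rule Bochner_Integration.integrable_bound[OF integrable_mult_right[OF weighted_gaussian_integrable[of "1/4"], of "weighted_gaussian (1/8) \<omega>"]])
  show "AE b in lborel. norm (packet_triple \<theta> \<omega> b) \<le> norm (weighted_gaussian (1/8) \<omega> * weighted_gaussian (1/4) b)"
    using packet_triple_pos[of \<theta> \<omega>] order_trans[OF packet_triple_le abs_ge_self]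
    by (intro AE_I2) (simp only: real_norm_def abs_of_pos)
qed (simp, measurable)

text \<open>With the interaction and the phase replaced by their leading parts, the integral of
\<open>fourier_picard3_datum_carrier\<close> is \<open>- (5/4) \<i> N t\<close> times the integral of \<open>packet_triple\<close>. The latter
is at least \<open>A0 > 0\<close>, and \<open>integrand_near_carrier\<close> bounds the error.\<close>
theorem fourier_picard3_lower_bound:
  obtains A0 A1 where "A0 > 0" "A1 \<ge> 0"
    "\<And>N t \<theta>. N \<ge> 1 \<Longrightarrow> t \<ge> 0 \<Longrightarrow> norm \<theta> \<le> 1 \<Longrightarrow>
      (1 / (2 * pi)\<^sup>2)\<^sup>2 * (t * (5/4 * N * A0 - (2 + 80 * N\<^sup>2 * t) * A1)) \<le> cmod (fourier (picard3 (datum N) t) ((N, 0) + \<theta>))"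
proof (rule that)
  define G where "G = (LINT b :: real \<times> real|lborel. exp (- (3/2) * (norm b)\<^sup>2))"
  define G2 where "G2 = (LINT b :: real \<times> real|lborel. exp (- 2 * (norm b)\<^sup>2))"
  define H where "H = (LINT \<omega>|lborel. weighted_gaussian (1/8) \<omega>)"
  define B where "B = (LINT b|lborel. weighted_gaussian (1/4) b)"
  show "exp (- 1) * G * G2 > 0"
    using gaussian_plane_pos[of "3/2"] gaussian_plane_pos[of 2] by (simp add: G_def G2_def)
  have HB: "H \<ge> 0" "B \<ge> 0" unfolding H_def B_def weighted_gaussian_def by (simp_all add: integral_nonneg)
  then show "B * H \<ge> 0" by simp
  fix N t :: real and \<theta> :: "real \<times> real" assume N: "N \<ge> 1" and t: "t \<ge> 0" and \<theta>: "norm \<theta> \<le> 1"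
  define D where "D = 2 + 80 * N\<^sup>2 * t"
  define L where "L = (5/4) * \<i> * complex_of_real N"
  define E where "E = (\<lambda>p b. interaction (snd p) ((N, 0) + b) * cis (fst p * resonance N \<theta> (snd p) b) * complex_of_real (packet_triple \<theta> (snd p) b))"
  define J where "J = (\<lambda>\<omega>. LINT b|lborel. packet_triple \<theta> \<omega> b)"
  have D0: "D \<ge> 0" using t by (simp add: D_def)
  have L: "cmod L = 5/4 * N" using N by (simp add: L_def norm_mult)
  have hi: "integrable lborel (weighted_gaussian (1/8))" "integrable lborel (weighted_gaussian (1/4))" by (simp_all add: weighted_gaussian_integrable)
  have h0: "0 \<le> weighted_gaussian a v" for a v by (simp add: weighted_gaussian_def)
  have E_meas[measurable]: "(\<lambda>x. E (f x) (g x)) \<in> borel_measurable M"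
    if [measurable]: "f \<in> M \<rightarrow>\<^sub>M borel \<Otimes>\<^sub>M borel" "g \<in> borel_measurable M" for f g M
    unfolding E_def by measurable
  have pt: "cmod (E p b + L * complex_of_real (packet_triple \<theta> (snd p) b)) \<le> D * weighted_gaussian (1/8) (snd p) * weighted_gaussian (1/4) b" if p: "fst p \<in> {0..t}" for p b
  proof -
    have "E p b + L * complex_of_real (packet_triple \<theta> (snd p) b)
       = (interaction (snd p) ((N, 0) + b) * cis (fst p * resonance N \<theta> (snd p) b) + L) * complex_of_real (packet_triple \<theta> (snd p) b)"
      by (simp add: E_def algebra_simps)
    then have "cmod (E p b + L * complex_of_real (packet_triple \<theta> (snd p) b))
       = cmod (interaction (snd p) ((N, 0) + b) * cis (fst p * resonance N \<theta> (snd p) b) + L) * packet_triple \<theta> (snd p) b"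
      using packet_triple_pos[of \<theta> "snd p" b] by (simp add: norm_mult)
    also have "\<dots> \<le> (D * poly_weight (snd p) b ^ 3) * packet_triple \<theta> (snd p) b"
      unfolding L_def D_def using packet_triple_pos[of \<theta> "snd p" b] p
      by (intro mult_right_mono integrand_near_carrier N \<theta>) auto
    also have "\<dots> \<le> D * (weighted_gaussian (1/8) (snd p) * weighted_gaussian (1/4) b)"
      using mult_left_mono[OF packet_triple_upper D0] by (simp add: mult.assoc)
    finally show ?thesis by (simp add: mult.assoc)
  qed
  have E_int: "integrable lborel (E p)" if p: "fst p \<in> {0..t}" for p
  proof -
    have "integrable lborel (\<lambda>b. E p b + L * complex_of_real (packet_triple \<theta> (snd p) b))"
    proof (rule Bochner_Integration.integrable_bound[OF integrable_mult_right[OF hi(2), of "D * weighted_gaussian (1/8) (snd p)"]])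
      show "AE b in lborel. cmod (E p b + L * complex_of_real (packet_triple \<theta> (snd p) b)) \<le> norm (D * weighted_gaussian (1/8) (snd p) * weighted_gaussian (1/4) b)"
        unfolding real_norm_def by (intro AE_I2 order_trans[OF pt[OF p] abs_ge_self])
      show "(\<lambda>b. E p b + L * complex_of_real (packet_triple \<theta> (snd p) b)) \<in> borel_measurable lborel"
        unfolding E_def by measurable
    qed
    moreover have "integrable lborel (\<lambda>b. L * complex_of_real (packet_triple \<theta> (snd p) b))"
      using packet_triple_integrable[of \<theta> "snd p"] by (intro integrable_mult_right) (simp add: complex_of_real_integrable_eq)
    ultimately have "integrable lborel (\<lambda>b. E p b + L * complex_of_real (packet_triple \<theta> (snd p) b) - L * complex_of_real (packet_triple \<theta> (snd p) b))"
      by (rule Bochner_Integration.integrable_diff)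
    then show ?thesis by simp
  qed
  have inner: "cmod ((LINT b|lborel. E p b) + L * complex_of_real (J (snd p))) \<le> (D * B) * weighted_gaussian (1/8) (snd p)" if p: "fst p \<in> {0..t}" for p
  proof -
    have ti: "integrable lborel (\<lambda>b. L * complex_of_real (packet_triple \<theta> (snd p) b))"
      using packet_triple_integrable[of \<theta> "snd p"] by (intro integrable_mult_right) (simp add: complex_of_real_integrable_eq)
    have "(LINT b|lborel. E p b) + L * complex_of_real (J (snd p)) = (LINT b|lborel. E p b + L * complex_of_real (packet_triple \<theta> (snd p) b))"
      unfolding Bochner_Integration.integral_add[OF E_int[OF p] ti] by (simp add: J_def)
    also have "cmod \<dots> \<le> (LINT b|lborel. D * weighted_gaussian (1/8) (snd p) * weighted_gaussian (1/4) b)"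
      by (rule order_trans[OF integral_norm_bound integral_mono])
         (use pt[OF p] in \<open>auto intro!: integrable_norm Bochner_Integration.integrable_add E_int p ti integrable_mult_right hi\<close>)
    finally show ?thesis by (simp add: B_def mult_ac)
  qed
  have J0: "0 \<le> J \<omega>" for \<omega>
    unfolding J_def using packet_triple_pos[of \<theta> \<omega>] by (intro integral_nonneg_AE AE_I2) (simp add: less_imp_le)
  have J_up: "J \<omega> \<le> B * weighted_gaussian (1/8) \<omega>" for \<omega>
  proof -
    have "J \<omega> \<le> (LINT b|lborel. weighted_gaussian (1/8) \<omega> * weighted_gaussian (1/4) b)"
      unfolding J_def
      by (rule integral_mono) (use packet_triple_integrable packet_triple_le hi in auto)
    then show ?thesis by (simp add: B_def mult.commute)
  qed
  have J_low: "exp (- 1) * G * exp (- 2 * (norm \<omega>)\<^sup>2) \<le> J \<omega>" for \<omega>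
  proof -
    have "(LINT b|lborel. (exp (- 1) * exp (- 2 * (norm \<omega>)\<^sup>2)) * exp (- (3/2) * (norm (b :: real \<times> real))\<^sup>2)) \<le> J \<omega>"
      unfolding J_def
    proof (rule integral_mono)
      show "integrable lborel (\<lambda>b :: real \<times> real. (exp (- 1) * exp (- 2 * (norm \<omega>)\<^sup>2)) * exp (- (3/2) * (norm b)\<^sup>2))"
        by (intro integrable_mult_right integrable_plane_gaussian) simp
    qed (use packet_triple_lower[OF \<theta>] packet_triple_integrable in auto)
    then show ?thesis by (simp add: G_def mult_ac)
  qed
  have [measurable]: "J \<in> borel_measurable borel" unfolding J_def by measurable
  have Ji: "integrable lborel J"
  proof (rule Bochner_Integration.integrable_bound[OF integrable_mult_right[OF hi(1), of B]])
    show "AE \<omega> in lborel. norm (J \<omega>) \<le> norm (B * weighted_gaussian (1/8) \<omega>)"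
      using order_trans[OF J_up abs_ge_self] J0 by simp
  qed measurable
  let ?ind = "\<lambda>p :: real \<times> real \<times> real. indicat_real {0..t} (fst p)"
  define X where "X = (LINT p|lborel. ?ind p *\<^sub>R (LINT b|lborel. E p b))"
  define Y where "Y = (LINT p|lborel. ?ind p * J (snd p))"
  have Yi: "integrable lborel (\<lambda>p. L * complex_of_real (?ind p * J (snd p)))"
    using slab_integral(1)[OF Ji t] by (intro integrable_mult_right) (simp only: complex_of_real_integrable_eq)
  have hDi: "integrable lborel (\<lambda>\<omega>. (D * B) * weighted_gaussian (1/8) \<omega>)" by (intro integrable_mult_right hi)
  have sum_le: "cmod (?ind p *\<^sub>R (LINT b|lborel. E p b) + L * complex_of_real (?ind p * J (snd p))) \<le> ?ind p * ((D * B) * weighted_gaussian (1/8) (snd p))" for p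
    using inner[of p] by (cases "fst p \<in> {0..t}") simp_all
  have sum_int: "integrable lborel (\<lambda>p. ?ind p *\<^sub>R (LINT b|lborel. E p b) + L * complex_of_real (?ind p * J (snd p)))"
  proof (rule Bochner_Integration.integrable_bound[OF slab_integral(1)[OF hDi t]])
    show "AE p in lborel. cmod (?ind p *\<^sub>R (LINT b|lborel. E p b) + L * complex_of_real (?ind p * J (snd p))) \<le> norm (?ind p * ((D * B) * weighted_gaussian (1/8) (snd p)))"
      unfolding real_norm_def by (intro AE_I2 order_trans[OF sum_le abs_ge_self])
    have "(\<lambda>p. ?ind p *\<^sub>R (LINT b|lborel. E p b) + L * complex_of_real (?ind p * J (snd p))) \<in> borel_measurable (lborel \<Otimes>\<^sub>M lborel)"
      by measurable
    then show "(\<lambda>p. ?ind p *\<^sub>R (LINT b|lborel. E p b) + L * complex_of_real (?ind p * J (snd p))) \<in> borel_measurable lborel"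
      by (simp only: lborel_prod)
  qed
  have "integrable lborel (\<lambda>p. ?ind p *\<^sub>R (LINT b|lborel. E p b) + L * complex_of_real (?ind p * J (snd p)) - L * complex_of_real (?ind p * J (snd p)))"
    by (rule Bochner_Integration.integrable_diff[OF sum_int Yi])
  then have Xi: "integrable lborel (\<lambda>p. ?ind p *\<^sub>R (LINT b|lborel. E p b))" by simp
  have "X + L * complex_of_real Y = (LINT p|lborel. ?ind p *\<^sub>R (LINT b|lborel. E p b) + L * complex_of_real (?ind p * J (snd p)))"
    unfolding Bochner_Integration.integral_add[OF Xi Yi] X_def Y_def integral_mult_right_zero integral_complex_of_real ..
  also have "cmod \<dots> \<le> (LINT p|lborel. ?ind p * ((D * B) * weighted_gaussian (1/8) (snd p)))"
    by (rule order_trans[OF integral_norm_bound integral_mono[OF integrable_norm[OF sum_int] slab_integral(1)[OF hDi t] sum_le]])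
  also have "\<dots> = t * (D * B * H)"
    unfolding slab_integral(2)[OF hDi t] by (simp add: H_def)
  finally have XY: "cmod (X + L * complex_of_real Y) \<le> t * (D * B * H)" .
  have Gi: "integrable lborel (\<lambda>\<omega> :: real \<times> real. exp (- 1) * G * exp (- 2 * (norm \<omega>)\<^sup>2))"
    by (intro integrable_mult_right integrable_plane_gaussian) simp
  have "t * (exp (- 1) * G * G2) = (LINT p|lborel. ?ind p * (exp (- 1) * G * exp (- 2 * (norm (snd p))\<^sup>2)))"
    unfolding slab_integral(2)[OF Gi t] by (simp add: G2_def)
  also have "\<dots> \<le> Y"
    unfolding Y_def
    by (rule integral_mono[OF slab_integral(1)[OF Gi t] slab_integral(1)[OF Ji t]]) (intro mult_left_mono J_low, simp)
  finally have Y: "t * (exp (- 1) * G * G2) \<le> Y" .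
  have "5/4 * N * (t * (exp (- 1) * G * G2)) \<le> 5/4 * N * Y"
    using Y N by (intro mult_left_mono) auto
  also have "\<dots> \<le> cmod (L * complex_of_real Y)"
    unfolding norm_mult L norm_of_real using N by (intro mult_left_mono) auto
  also have "\<dots> \<le> cmod X + t * (D * B * H)"
    using norm_triangle_ineq4[of "X + L * complex_of_real Y" X] XY by simp
  finally have main: "t * (5/4 * N * (exp (- 1) * G * G2) - (2 + 80 * N\<^sup>2 * t) * (B * H)) \<le> cmod X"
    by (simp add: D_def algebra_simps)
  have "cmod (fourier (picard3 (datum N) t) ((N, 0) + \<theta>)) = cmod (cis (t * dispersion ((N, 0) + \<theta>)) * fourier (picard3 (datum N) t) ((N, 0) + \<theta>))"
    by (simp add: norm_mult)
  also have "\<dots> = (1 / (2 * pi)\<^sup>2)\<^sup>2 * cmod X"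
    unfolding fourier_picard3_datum_carrier[OF t] X_def E_def norm_mult norm_of_real by (simp add: power2_eq_square)
  finally show "(1 / (2 * pi)\<^sup>2)\<^sup>2 * (t * (5/4 * N * (exp (- 1) * G * G2) - (2 + 80 * N\<^sup>2 * t) * (B * H))) \<le> cmod (fourier (picard3 (datum N) t) ((N, 0) + \<theta>))"
    using main by (simp add: mult_left_mono)
qed

lemma sobolev_norm_le:
  assumes "sobolev_sqnorm s f \<le> ennreal (a\<^sup>2)" "a \<ge> 0"
  shows "sobolev_norm s f \<le> ennreal a"
proof -
  have fin: "sobolev_sqnorm s f \<noteq> \<infinity>" using assms(1) by (auto simp: top_unique)
  have "enn2real (sobolev_sqnorm s f) \<le> a\<^sup>2" using enn2real_mono[OF assms(1)] by simp
  then have "sqrt (enn2real (sobolev_sqnorm s f)) \<le> a" using assms(2) by (intro real_le_lsqrt) auto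
  with fin show ?thesis by (simp add: sobolev_norm_def ennreal_leI)
qed

lemma sobolev_norm_ge:
  assumes "ennreal (a\<^sup>2) \<le> sobolev_sqnorm s f" "a \<ge> 0"
  shows "ennreal a \<le> sobolev_norm s f"
proof (cases "sobolev_sqnorm s f = \<infinity>")
  case False
  then have "a\<^sup>2 \<le> enn2real (sobolev_sqnorm s f)"
    using enn2real_mono[OF assms(1)] by (simp add: less_top)
  then have "a \<le> sqrt (enn2real (sobolev_sqnorm s f))" by (rule real_le_rsqrt)
  with False show ?thesis by (simp add: sobolev_norm_def ennreal_leI)
qed (simp add: sobolev_norm_def)

text \<open>Peetre's inequality \<open>N\<^sup>2 \<le> 2 (1 + |\<zeta>|\<^sup>2) (1 + |v|)\<^sup>2\<close> with \<open>v = \<zeta> - (N, 0)\<close> transfers the weight from \<open>\<zeta>\<close> to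
the carrier frequency; the powers of \<open>1 + |v|\<close> that it costs are absorbed by the Gaussian.\<close>
lemma sobolev_norm_datum_le:
  assumes s: "s < 0"
  obtains C where "C \<ge> 0" "\<And>N. N \<ge> 1 \<Longrightarrow> sobolev_norm s (datum N) \<le> ennreal (C * N powr s)"
proof -
  obtain k :: nat where k: "- s \<le> real k" using real_arch_simple by blast
  define f where "f = (\<lambda>v :: real \<times> real. 2 ^ k * ((1 + norm v) ^ (2 * k) * exp (- 1 * (norm v)\<^sup>2)))"
  have fi: "integrable lborel f" unfolding f_def by (intro integrable_mult_right integrable_poly_gaussian) simp
  have f0: "f v \<ge> 0" for v by (simp add: f_def)
  define I where "I = (LINT v|lborel. f v)"
  have I0: "I \<ge> 0" unfolding I_def using f0 by simp
  show ?thesis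
  proof (rule that)
    show "sqrt I \<ge> 0" using I0 by simp
    fix N :: real assume N: "N \<ge> 1"
    have pt: "(1 + (norm \<zeta>)\<^sup>2) powr s * (cmod (fourier (datum N) \<zeta>))\<^sup>2 \<le> N powr (2 * s) * f (\<zeta> - (N, 0))" for \<zeta>
    proof -
      let ?v = "\<zeta> - (N, 0)"
      have "N\<^sup>2 \<le> 2 * (1 + (norm \<zeta>)\<^sup>2) * (1 + norm ?v)\<^sup>2"
      proof -
        have "N \<le> norm \<zeta> + norm ?v"
          using norm_triangle_ineq4[of \<zeta> ?v] N by simp
        then have "N\<^sup>2 \<le> (norm \<zeta> + norm ?v)\<^sup>2" using N by (intro power_mono) auto
        also have "\<dots> \<le> 2 * (norm \<zeta>)\<^sup>2 + 2 * (norm ?v)\<^sup>2"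
          using sum_squares_bound[of "norm \<zeta>" "norm ?v"] by (simp add: power2_sum)
        also have "\<dots> \<le> 2 * ((1 + (norm \<zeta>)\<^sup>2) * (1 + (norm ?v)\<^sup>2))" by (simp add: algebra_simps)
        also have "\<dots> \<le> 2 * ((1 + (norm \<zeta>)\<^sup>2) * (1 + norm ?v)\<^sup>2)"
          by (intro mult_left_mono) (simp_all add: power2_sum)
        finally show ?thesis by (simp only: mult.assoc)
      qed
      moreover have pos: "0 < 2 * (1 + norm ?v)\<^sup>2"
        by (intro mult_pos_pos zero_less_power add_pos_nonneg) simp_all
      ultimately have "N\<^sup>2 / (2 * (1 + norm ?v)\<^sup>2) \<le> 1 + (norm \<zeta>)\<^sup>2"
        unfolding pos_divide_le_eq[OF pos] by (simp only: mult_ac)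
      then have "(1 + (norm \<zeta>)\<^sup>2) powr s \<le> (N\<^sup>2 / (2 * (1 + norm ?v)\<^sup>2)) powr s"
        using s N by (intro powr_mono2' divide_pos_pos pos) auto
      also have "\<dots> = N powr (2 * s) * (2 * (1 + norm ?v)\<^sup>2) powr (- s)"
      proof -
        have "(N\<^sup>2) powr s = N powr (2 * s)"
          using N by (simp add: powr_powr flip: powr_numeral)
        moreover have "(2 * (1 + norm ?v)\<^sup>2) powr (- s) = 1 / (2 * (1 + norm ?v)\<^sup>2) powr s"
          by (rule powr_minus_divide)
        moreover have "(N\<^sup>2 / (2 * (1 + norm ?v)\<^sup>2)) powr s = (N\<^sup>2) powr s / (2 * (1 + norm ?v)\<^sup>2) powr s"
          by (rule powr_divide)
        ultimately show ?thesis by simp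
      qed
      also have "\<dots> \<le> N powr (2 * s) * (2 * (1 + norm ?v)\<^sup>2) powr (real k)"
      proof (intro mult_left_mono powr_mono k)
        have "1 \<le> 2 * x" if "1 \<le> x" for x :: real using that by simp
        moreover have "1 \<le> (1 + norm ?v)\<^sup>2" by (rule one_le_power) simp
        ultimately show "1 \<le> 2 * (1 + norm ?v)\<^sup>2" .
      qed simp
      also have "(2 * (1 + norm ?v)\<^sup>2) powr (real k) = 2 ^ k * (1 + norm ?v) ^ (2 * k)"
        unfolding powr_realpow[OF pos] by (simp add: power_mult_distrib power_mult)
      finally have "(1 + (norm \<zeta>)\<^sup>2) powr s * (cmod (fourier (datum N) \<zeta>))\<^sup>2
          \<le> N powr (2 * s) * (2 ^ k * (1 + norm ?v) ^ (2 * k)) * (cmod (fourier (datum N) \<zeta>))\<^sup>2"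
        by (intro mult_right_mono) auto
      moreover have "(cmod (fourier (datum N) \<zeta>))\<^sup>2 = exp (- 1 * (norm ?v)\<^sup>2)"
        unfolding fourier_datum norm_of_real power2_abs packet_def exp_double[symmetric] by simp
      ultimately show ?thesis by (simp only: f_def mult_ac)
    qed
    have shift: "integrable lborel (\<lambda>\<zeta>. f (\<zeta> - (N, 0)))"
      unfolding f_def by (intro integrable_mult_right integrable_poly_gaussian_shift) simp
    have "(LINT \<zeta>|lborel. f \<zeta>) = 1\<^sup>2 *\<^sub>R (LINT \<zeta>|lborel. f (- (N, 0) + 1 *\<^sub>R \<zeta>))"
      using borel_measurable_integrable[OF fi] by (intro lborel_plane_affine) simp_all
    then have shift_eq: "(LINT \<zeta>|lborel. f (\<zeta> - (N, 0))) = I"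
      by (simp only: I_def scaleR_one uminus_add_conv_diff power_one)
    have "sobolev_sqnorm s (datum N) \<le> (\<integral>\<^sup>+ \<zeta>. ennreal (N powr (2 * s) * f (\<zeta> - (N, 0))) \<partial>lborel)"
      unfolding sobolev_sqnorm_def by (intro nn_integral_mono ennreal_leI pt)
    also have "\<dots> = ennreal (LINT \<zeta>|lborel. N powr (2 * s) * f (\<zeta> - (N, 0)))"
      by (rule nn_integral_eq_integral[OF integrable_mult_right[OF shift]]) (simp add: f0)
    also have "(LINT \<zeta>|lborel. N powr (2 * s) * f (\<zeta> - (N, 0))) = N powr (2 * s) * I"
      by (simp add: shift_eq)
    also have "\<dots> = (sqrt I * N powr s)\<^sup>2"
      using I0 N by (simp add: power_mult_distrib powr_power)
    finally show "sobolev_norm s (datum N) \<le> ennreal (sqrt I * N powr s)"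
      using I0 by (intro sobolev_norm_le) auto
  qed
qed

text \<open>It suffices to integrate over a square of side \<open>1/2\<close> with the corner \<open>(N, 0)\<close>, which lies in the unit
ball around it and on which \<open>1 + |\<zeta>|\<^sup>2 \<le> 5 N\<^sup>2\<close>.\<close>
lemma sobolev_norm_ge_of_carrier_bound:
  assumes s: "s < 0" and N: "N \<ge> 1" and a: "a \<ge> 0"
    and f: "\<And>\<theta>. norm \<theta> \<le> 1 \<Longrightarrow> a \<le> cmod (fourier f ((N, 0) + \<theta>))"
  shows "ennreal (1/2 * 5 powr (s / 2) * N powr s * a) \<le> sobolev_norm s f"
proof (rule sobolev_norm_ge)
  define S where "S = cbox (N, 0) (N + 1/2, 1/2 :: real)"
  have vol: "emeasure lborel S = ennreal (1/4)"
    by (simp add: S_def emeasure_lborel_cbox_eq Basis_prod_def inner_prod_def)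
  have pt: "(5 * N\<^sup>2) powr s * a\<^sup>2 \<le> (1 + (norm \<zeta>)\<^sup>2) powr s * (cmod (fourier f \<zeta>))\<^sup>2" if \<zeta>: "\<zeta> \<in> S" for \<zeta>
  proof (rule mult_mono)
    define \<theta> where "\<theta> = \<zeta> - (N, 0)"
    have \<theta>: "0 \<le> fst \<theta>" "fst \<theta> \<le> 1/2" "0 \<le> snd \<theta>" "snd \<theta> \<le> 1/2"
      using \<zeta> by (auto simp: S_def \<theta>_def mem_box Basis_prod_def inner_prod_def)
    have "norm \<theta> \<le> \<bar>fst \<theta>\<bar> + \<bar>snd \<theta>\<bar>"
      using norm_Pair_le[of "fst \<theta>" "snd \<theta>"] by simp
    with \<theta> have n: "norm \<theta> \<le> 1" by simp
    show "a\<^sup>2 \<le> (cmod (fourier f \<zeta>))\<^sup>2"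
      using f[OF n] a by (intro power_mono) (auto simp: \<theta>_def)
    have "norm \<zeta> \<le> norm (N, 0 :: real) + norm \<theta>" using norm_triangle_ineq[of "(N, 0)" \<theta>] by (simp add: \<theta>_def)
    then have "norm \<zeta> \<le> 2 * N" using n N by (simp add: norm_Pair)
    then have "(norm \<zeta>)\<^sup>2 \<le> (2 * N)\<^sup>2" by (intro power_mono) auto
    moreover have "1 \<le> N\<^sup>2" using N by (rule one_le_power)
    ultimately have "1 + (norm \<zeta>)\<^sup>2 \<le> 5 * N\<^sup>2" by (simp add: power_mult_distrib)
    then show "(5 * N\<^sup>2) powr s \<le> (1 + (norm \<zeta>)\<^sup>2) powr s"
      using s by (intro powr_mono2') (auto simp: add_pos_nonneg)
  qed simp_all
  have "(5 powr (s / 2))\<^sup>2 = 5 powr s" by (simp add: powr_power)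
  moreover have "(N powr s)\<^sup>2 = (N\<^sup>2) powr s"
    using N by (simp add: powr_power powr_powr mult.commute flip: powr_numeral)
  ultimately have "(1/2 * 5 powr (s / 2) * N powr s * a)\<^sup>2 = (5 * N\<^sup>2) powr s * a\<^sup>2 * (1/4)"
    using N by (simp add: power_mult_distrib powr_mult power_divide)
  then have "ennreal ((1/2 * 5 powr (s / 2) * N powr s * a)\<^sup>2) = ennreal ((5 * N\<^sup>2) powr s * a\<^sup>2) * emeasure lborel S"
    unfolding vol by (simp only: ennreal_mult''[of "1/4"])
  also have "\<dots> = (\<integral>\<^sup>+ \<zeta>. ennreal ((5 * N\<^sup>2) powr s * a\<^sup>2) * indicator S \<zeta> \<partial>lborel)"
    by (subst nn_integral_cmult_indicator) (simp_all add: S_def)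
  also have "\<dots> \<le> sobolev_sqnorm s f"
    unfolding sobolev_sqnorm_def
    using pt by (intro nn_integral_mono) (auto simp: indicator_def intro!: ennreal_leI)
  finally show "ennreal ((1/2 * 5 powr (s / 2) * N powr s * a)\<^sup>2) \<le> sobolev_sqnorm s f" .
qed (use a in simp)

theorem theorem1p4:
  fixes s T :: real
  assumes "s < 0" and "T > 0"
  shows "\<not> (\<exists>C::real. \<forall>u0. schwartz u0 \<longrightarrow>
           (SUP t\<in>{0..T}. sobolev_norm s (picard3 u0 t)) \<le> ennreal C * sobolev_norm s u0 ^ 3)"
proof
  assume "\<exists>C::real. \<forall>u0. schwartz u0 \<longrightarrow>
           (SUP t\<in>{0..T}. sobolev_norm s (picard3 u0 t)) \<le> ennreal C * sobolev_norm s u0 ^ 3"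
  then obtain C where C: "\<And>u0. schwartz u0 \<Longrightarrow>
      (SUP t\<in>{0..T}. sobolev_norm s (picard3 u0 t)) \<le> ennreal C * sobolev_norm s u0 ^ 3" by blast
  obtain M where M: "M \<ge> 0" "\<And>N. N \<ge> 1 \<Longrightarrow> sobolev_norm s (datum N) \<le> ennreal (M * N powr s)"
    using sobolev_norm_datum_le[OF assms(1)] by blast
  obtain A0 A1 where A: "A0 > 0" "A1 \<ge> 0" "\<And>N t \<theta>. N \<ge> 1 \<Longrightarrow> t \<ge> 0 \<Longrightarrow> norm \<theta> \<le> 1 \<Longrightarrow>
      (1 / (2 * pi)\<^sup>2)\<^sup>2 * (t * (5/4 * N * A0 - (2 + 80 * N\<^sup>2 * t) * A1)) \<le> cmod (fourier (picard3 (datum N) t) ((N, 0) + \<theta>))"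
    using fourier_picard3_lower_bound by blast
  define K where "K = (1 / (2 * pi)\<^sup>2)\<^sup>2 * A0"
  define P where "P = 1/2 * 5 powr (s / 2) * K"
  have K: "K > 0" using A(1) by (simp add: K_def)
  then have P: "P > 0" by (simp add: P_def)
  have lim: "((\<lambda>N. N powr s) \<longlongrightarrow> 0) at_top"
    by (rule tendsto_neg_powr[OF assms(1) filterlim_ident])
  have "((\<lambda>N. N powr (s - 1)) \<longlongrightarrow> 0) at_top"
    using assms(1) by (intro tendsto_neg_powr filterlim_ident) simp
  then have e1: "\<forall>\<^sub>F N in at_top. N powr (s - 1) < T"
    using assms(2) by (rule order_tendstoD)
  have "((\<lambda>N. (2 * inverse N + 80 * N powr s) * A1) \<longlongrightarrow> (2 * 0 + 80 * 0) * A1) at_top"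
    by (intro tendsto_intros lim tendsto_inverse_0_at_top filterlim_ident)
  then have e2: "\<forall>\<^sub>F N in at_top. (2 * inverse N + 80 * N powr s) * A1 < A0 / 4"
    using A(1) by (intro order_tendstoD(2)[where y = 0]) simp_all
  have "((\<lambda>N. (\<bar>C\<bar> * M ^ 3) * N powr s) \<longlongrightarrow> (\<bar>C\<bar> * M ^ 3) * 0) at_top"
    by (intro tendsto_intros lim)
  then have e3: "\<forall>\<^sub>F N in at_top. (\<bar>C\<bar> * M ^ 3) * N powr s < P"
    using P by (intro order_tendstoD(2)[where y = 0]) simp_all
  have ev: "\<forall>\<^sub>F N :: real in at_top. N \<ge> 1 \<and> N powr (s - 1) < T \<and> (2 * inverse N + 80 * N powr s) * A1 < A0 / 4
      \<and> (\<bar>C\<bar> * M ^ 3) * N powr s < P"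
    using eventually_ge_at_top[of "1::real"] e1 e2 e3 by eventually_elim simp
  \<comment> \<open>the third condition leaves at least \<open>A0 N\<close> of the main term \<open>(5/4) A0 N\<close>, the fourth contradicts the assumed bound\<close>
  then obtain N :: real where N: "N \<ge> 1" "N powr (s - 1) < T" "(2 * inverse N + 80 * N powr s) * A1 < A0 / 4"
      "(\<bar>C\<bar> * M ^ 3) * N powr s < P"
    using eventually_happens'[OF trivial_limit_at_top_linorder ev] by blast
  \<comment> \<open>short compared to \<open>1 / N\<close>, so that there is no oscillation, but with \<open>t N = N\<^sup>s\<close> not too small\<close>
  define t where "t = N powr (s - 1)"
  have t: "t \<in> {0..T}" using N(2) by (simp add: t_def)
  have tN: "t * N = N powr s" using N(1) by (simp add: t_def powr_diff)
  have low: "K * N powr s \<le> cmod (fourier (picard3 (datum N) t) ((N, 0) + \<theta>))" if "norm \<theta> \<le> 1" for \<theta>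
  proof -
    have "(2 + 80 * N\<^sup>2 * t) * A1 = N * ((2 * inverse N + 80 * (t * N)) * A1)"
      using N(1) by (simp add: field_simps power2_eq_square)
    also have "\<dots> \<le> N * (A0 / 4)" unfolding tN using N by (intro mult_left_mono) auto
    finally have "A0 * N \<le> 5/4 * N * A0 - (2 + 80 * N\<^sup>2 * t) * A1" by (simp add: algebra_simps)
    then have "t * (A0 * N) \<le> t * (5/4 * N * A0 - (2 + 80 * N\<^sup>2 * t) * A1)"
      using t by (intro mult_left_mono) auto
    then have "(1 / (2 * pi)\<^sup>2)\<^sup>2 * (t * (A0 * N)) \<le> (1 / (2 * pi)\<^sup>2)\<^sup>2 * (t * (5/4 * N * A0 - (2 + 80 * N\<^sup>2 * t) * A1))"
      by (rule mult_left_mono) simp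
    also have "\<dots> \<le> cmod (fourier (picard3 (datum N) t) ((N, 0) + \<theta>))"
      using N(1) t that by (intro A(3)) auto
    finally show ?thesis unfolding K_def tN[symmetric] by (simp add: mult_ac)
  qed
  have "ennreal (P * (N powr s * N powr s)) = ennreal (1/2 * 5 powr (s / 2) * N powr s * (K * N powr s))"
    by (simp add: P_def mult_ac)
  also have "\<dots> \<le> sobolev_norm s (picard3 (datum N) t)"
    using K by (intro sobolev_norm_ge_of_carrier_bound assms(1) N(1) low) simp_all
  also have "\<dots> \<le> (SUP t\<in>{0..T}. sobolev_norm s (picard3 (datum N) t))"
    using t by (rule SUP_upper)
  also have "\<dots> \<le> ennreal C * sobolev_norm s (datum N) ^ 3"
    by (rule C[OF schwartz_datum])
  also have "\<dots> \<le> ennreal \<bar>C\<bar> * ennreal (M * N powr s) ^ 3"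
    by (intro mult_mono power_mono M(2) N(1) ennreal_leI) auto
  also have "\<dots> = ennreal (\<bar>C\<bar> * (M * N powr s) ^ 3)"
  proof -
    have "ennreal (M * N powr s) ^ 3 = ennreal ((M * N powr s) ^ 3)"
      using M(1) by (intro ennreal_power) simp
    then show ?thesis by (simp only: ennreal_mult'[OF abs_ge_zero])
  qed
  finally have "P * (N powr s * N powr s) \<le> \<bar>C\<bar> * (M * N powr s) ^ 3"
    using M(1) by (subst (asm) ennreal_le_iff) auto
  also have "\<dots> = ((\<bar>C\<bar> * M ^ 3) * N powr s) * (N powr s * N powr s)"
    by (simp add: power3_eq_cube mult_ac)
  also have "\<dots> < P * (N powr s * N powr s)"
    using N by (intro mult_strict_right_mono) auto
  finally show False by simp
qed

end
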